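(* Let $n\geq 1$ be an integer, let $\alpha>0$ and $1<q\leq 1+\frac{\alpha}{n}$ be real numbers. Let $\mathcal L=\sum_{i,j=1}^n\frac{\partial}{\partial x_i}\left[a_{ij}(t,x)\frac{\partial}{\partial x_j}\right]$ be a differential operator on $\mathbb E=\mathbb R\times\mathbb R^n$ whose coefficients satisfy the standing assumptions given in the context, with bounding function $A(t,x)$, and suppose that for this $\alpha$ and some constant $c>0$ one has $$\mathcal A(R):=\operatorname*{ess\,sup}_{(t,x)\in(-\infty,+\infty)\times\{R/2<|x|<R\}}A(t,x)\leq cR^{2-\alpha}\quad\text{for all } R>1.$$ Let $u=u(t,x)$ be a non-negative weak solution in $\mathbb E$ of the inequality $u_t\geq\mathcal L u+|u|^{q-1}u$. Then $u=0$ (almost everywhere) in $\mathbb E$.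
   Context: Setting: $\mathbb E=\mathbb R\times\mathbb R^n$ with points $(t,x)$, $t\in\mathbb R$, $x\in\mathbb R^n$. Standing assumptions on $\mathcal L=\sum_{i,j=1}^n\frac{\partial}{\partial x_i}\left[a_{ij}(t,x)\frac{\partial}{\partial x_j}\right]$: the real-valued coefficients $a_{ij}$, $i,j=1,\dots,n$, are defined, measurable and locally bounded in $\mathbb E$; $a_{ij}(t,x)=a_{ji}(t,x)$ for almost all $(t,x)\in\mathbb E$; and $$0\leq\sum_{i,j=1}^n a_{ij}(t,x)\xi_i\xi_j\leq A(t,x)|\xi|^2$$ for all $\xi\in\mathbb R^n$ and almost all $(t,x)\in\mathbb E$, where $A$ is a measurable, non-negative, locally bounded function on $\mathbb E$. (No positive lower ellipticity bound is assumed.) Function spaces: let $\hat q=\max\{1,q\}$. For a domain $\Omega\subset\mathbb E$, $W^{\mathcal L,q}(\Omega)$ is the completion of the space $C^\infty(\Omega)$ of infinitely differentiable functions on $\Omega$ (those with finite norm) with respect to the norm $$\|w\|_{W^{\mathcal L,q}(\Omega)}=\int_\Omega|w_t|\,dt\,dx+\left[\int_\Omega\sum_{i,j=1}^n a_{ij}(t,x)\frac{\partial w}{\partial x_i}\frac{\partial w}{\partial x_j}\,dt\,dx\right]^{1/2}+\left[\int_\Omega|w|^{\hat q}\,dt\,dx\right]^{1/\hat q}.$$ A function $w$ belongs to $W^{\mathcal L,q}_{\mathrm{loc}}(\mathbb E)$ if it belongs to $W^{\mathcal L,q}(\Omega)$ for every bounded domain $\Omega\subset\mathbb E$. Weak solution: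 a measurable function $u$ on $\mathbb E$ is a weak solution in $\mathbb E$ of $u_t\geq\mathcal L u+|u|^{q-1}u$ if $u\in W^{\mathcal L,q}_{\mathrm{loc}}(\mathbb E)$ and $$\int_{\mathbb E}\left[u_t\varphi+\sum_{i,j=1}^n a_{ij}\frac{\partial\varphi}{\partial x_i}\frac{\partial u}{\partial x_j}-|u|^{q-1}u\,\varphi\right]dt\,dx\geq 0$$ for every non-negative $\varphi\in C^\infty(\mathbb E)$ with compact support in $\mathbb E$. For elements of the completion, $w_t$ and the integral of $\sum_{i,j}a_{ij}\frac{\partial\varphi}{\partial x_i}\frac{\partial w}{\partial x_j}$ are understood as limits along the sequences of smooth functions, Cauchy in the norm $\|\cdot\|_{W^{\mathcal L,q}(\Omega)}$ on a bounded domain $\Omega\subset\mathbb E$ containing the support of $\varphi$, that represent the element $w$ of the completion. *)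

theory Defs
  imports "HOL-Analysis.Analysis" "HOL-Probability.Essential_Supremum"
begin

text \<open>Points of \<open>\<real> \<times> \<real>\<^sup>n\<close> are pairs \<open>(t, x)\<close>, with \<open>n = CARD('n)\<close>.\<close>

type_synonym 'n pt = "real \<times> (real ^ 'n)"
type_synonym 'n coeffs = "'n \<Rightarrow> 'n \<Rightarrow> 'n pt \<Rightarrow> real"


subsection \<open>Smooth functions\<close>

fun k_times_diff_on :: "nat \<Rightarrow> 'a::real_normed_vector set \<Rightarrow> ('a \<Rightarrow> real) \<Rightarrow> bool" where
  "k_times_diff_on 0 S f \<longleftrightarrow> continuous_on S f"
| "k_times_diff_on (Suc k) S f \<longleftrightarrow>
     (\<forall>x\<in>S. f differentiable (at x)) \<and>
     (\<forall>v. k_times_diff_on k S (\<lambda>x. frechet_derivative f (at x) v))"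

text \<open>Intended for open \<open>S\<close>; the values of \<open>f\<close> outside \<open>S\<close> are then irrelevant.\<close>

definition smooth_on :: "'a::real_normed_vector set \<Rightarrow> ('a \<Rightarrow> real) \<Rightarrow> bool" where
  "smooth_on S f \<longleftrightarrow> (\<forall>k. k_times_diff_on k S f)"

definition dt :: "('n::finite pt \<Rightarrow> real) \<Rightarrow> 'n pt \<Rightarrow> real" where
  "dt w p = frechet_derivative w (at p) (1, 0)"

definition dx :: "'n::finite \<Rightarrow> ('n pt \<Rightarrow> real) \<Rightarrow> 'n pt \<Rightarrow> real" where
  "dx i w p = frechet_derivative w (at p) (0, axis i 1)"

definition bounded_domain :: "'a::real_normed_vector set \<Rightarrow> bool" where
  "bounded_domain \<Omega> \<longleftrightarrow> open \<Omega> \<and> connected \<Omega> \<and> \<Omega> \<noteq> {} \<and> bounded \<Omega>"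


subsection \<open>The operator\<close>

definition locally_bounded :: "('a::real_normed_vector \<Rightarrow> real) \<Rightarrow> bool" where
  "locally_bounded f \<longleftrightarrow> (\<forall>p. \<exists>r>0. bounded (f ` ball p r))"

definition admissible_operator :: "'n::finite coeffs \<Rightarrow> ('n pt \<Rightarrow> real) \<Rightarrow> bool" where
  "admissible_operator a A \<longleftrightarrow>
     (\<forall>i j. a i j \<in> borel_measurable lebesgue \<and> locally_bounded (a i j)) \<and>
     (AE p in lebesgue. \<forall>i j. a i j p = a j i p) \<and>
     A \<in> borel_measurable lebesgue \<and> (\<forall>p. 0 \<le> A p) \<and> locally_bounded A \<and>
     (AE p in lebesgue. \<forall>\<xi> :: real ^ 'n.
        0 \<le> (\<Sum>i\<in>UNIV. \<Sum>j\<in>UNIV. a i j p * \<xi> $ i * \<xi> $ j) \<and>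
        (\<Sum>i\<in>UNIV. \<Sum>j\<in>UNIV. a i j p * \<xi> $ i * \<xi> $ j) \<le> A p * (norm \<xi>)\<^sup>2)"

definition annular_esssup :: "('n::finite pt \<Rightarrow> real) \<Rightarrow> real \<Rightarrow> ereal" where
  "annular_esssup A R =
     esssup (restrict_space lebesgue (UNIV \<times> {x. R / 2 < norm x \<and> norm x < R}))
            (\<lambda>p. ereal (A p))"

definition energy_form ::
  "'n::finite coeffs \<Rightarrow> ('n pt \<Rightarrow> real) \<Rightarrow> ('n pt \<Rightarrow> real) \<Rightarrow> 'n pt \<Rightarrow> real" where
  "energy_form a f g p = (\<Sum>i\<in>UNIV. \<Sum>j\<in>UNIV. a i j p * dx i f p * dx j g p)"


subsection \<open>The function space as a completion\<close>

definition qhat :: "real \<Rightarrow> real" where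
  "qhat q = max 1 q"

definition W_norm :: "'n::finite coeffs \<Rightarrow> real \<Rightarrow> 'n pt set \<Rightarrow> ('n pt \<Rightarrow> real) \<Rightarrow> real" where
  "W_norm a q \<Omega> w =
     (LINT p:\<Omega>|lebesgue. \<bar>dt w p\<bar>)
     + sqrt (LINT p:\<Omega>|lebesgue. energy_form a w w p)
     + (LINT p:\<Omega>|lebesgue. \<bar>w p\<bar> powr qhat q) powr (1 / qhat q)"

text \<open>Integrability of the three integrands expresses that the norm is finite.\<close>

definition W_smooth :: "'n::finite coeffs \<Rightarrow> real \<Rightarrow> 'n pt set \<Rightarrow> ('n pt \<Rightarrow> real) set" where
  "W_smooth a q \<Omega> = {w. smooth_on \<Omega> w \<and>
     set_integrable lebesgue \<Omega> (\<lambda>p. \<bar>dt w p\<bar>) \<and>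
     set_integrable lebesgue \<Omega> (energy_form a w w) \<and>
     set_integrable lebesgue \<Omega> (\<lambda>p. \<bar>w p\<bar> powr qhat q)}"

definition W_Cauchy :: "'n::finite coeffs \<Rightarrow> real \<Rightarrow> 'n pt set \<Rightarrow> (nat \<Rightarrow> 'n pt \<Rightarrow> real) set" where
  "W_Cauchy a q \<Omega> = {s. (\<forall>k. s k \<in> W_smooth a q \<Omega>) \<and>
     (\<forall>\<epsilon>>0. \<exists>N. \<forall>k\<ge>N. \<forall>l\<ge>N. W_norm a q \<Omega> (\<lambda>p. s k p - s l p) < \<epsilon>)}"

definition W_rel ::
  "'n::finite coeffs \<Rightarrow> real \<Rightarrow> 'n pt set \<Rightarrow> ((nat \<Rightarrow> 'n pt \<Rightarrow> real) \<times> (nat \<Rightarrow> 'n pt \<Rightarrow> real)) set" where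
  "W_rel a q \<Omega> = {(s, s'). s \<in> W_Cauchy a q \<Omega> \<and> s' \<in> W_Cauchy a q \<Omega> \<and>
     (\<lambda>k. W_norm a q \<Omega> (\<lambda>p. s k p - s' k p)) \<longlonglongrightarrow> 0}"

definition W_space :: "'n::finite coeffs \<Rightarrow> real \<Rightarrow> 'n pt set \<Rightarrow> (nat \<Rightarrow> 'n pt \<Rightarrow> real) set set" where
  "W_space a q \<Omega> = W_Cauchy a q \<Omega> // W_rel a q \<Omega>"

text \<open>The function carried by an element of the completion is the common \<open>L\<close>-\<open>qhat q\<close> limit of the
  representing sequences. As \<open>a\<close> may degenerate, the energy form need not be closable, so that
  different elements of the completion may carry the same function.\<close>

definition W_represents ::
  "real \<Rightarrow> 'n::finite pt set \<Rightarrow> (nat \<Rightarrow> 'n pt \<Rightarrow> real) set \<Rightarrow> ('n pt \<Rightarrow> real) \<Rightarrow> bool" where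
  "W_represents q \<Omega> X w \<longleftrightarrow>
     set_borel_measurable lebesgue \<Omega> w \<and>
     set_integrable lebesgue \<Omega> (\<lambda>p. \<bar>w p\<bar> powr qhat q) \<and>
     (\<forall>s\<in>X. (\<lambda>k. LINT p:\<Omega>|lebesgue. \<bar>s k p - w p\<bar> powr qhat q) \<longlonglongrightarrow> 0)"

definition W_time_deriv ::
  "'n::finite pt set \<Rightarrow> (nat \<Rightarrow> 'n pt \<Rightarrow> real) set \<Rightarrow> ('n pt \<Rightarrow> real) \<Rightarrow> bool" where
  "W_time_deriv \<Omega> X v \<longleftrightarrow>
     set_integrable lebesgue \<Omega> v \<and>
     (\<forall>s\<in>X. (\<lambda>k. LINT p:\<Omega>|lebesgue. \<bar>dt (s k) p - v p\<bar>) \<longlonglongrightarrow> 0)"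

definition W_energy_pairing ::
  "'n::finite coeffs \<Rightarrow> 'n pt set \<Rightarrow> ('n pt \<Rightarrow> real) \<Rightarrow> (nat \<Rightarrow> 'n pt \<Rightarrow> real) set \<Rightarrow> real \<Rightarrow> bool" where
  "W_energy_pairing a \<Omega> \<phi> X e \<longleftrightarrow>
     (\<forall>s\<in>X. (\<lambda>k. LINT p:\<Omega>|lebesgue. energy_form a \<phi> (s k) p) \<longlonglongrightarrow> e)"


subsection \<open>Weak solutions of \<open>u\<^sub>t \<ge> L u + |u|\<^bsup>q-1\<^esup> u\<close>\<close>

definition supp :: "('a::real_normed_vector \<Rightarrow> real) \<Rightarrow> 'a set" where
  "supp \<phi> = closure {p. \<phi> p \<noteq> 0}"

definition test_function :: "('n::finite pt \<Rightarrow> real) \<Rightarrow> bool" where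
  "test_function \<phi> \<longleftrightarrow> smooth_on UNIV \<phi> \<and> compact (supp \<phi>) \<and> (\<forall>p. 0 \<le> \<phi> p)"

text \<open>On each bounded domain, one element of the completion carrying \<open>u\<close> serves all test functions
  supported there. The elements belonging to different domains need not be related to each
  other; if the energy form is closable they are determined by \<open>u\<close>.\<close>

definition weak_solution :: "'n::finite coeffs \<Rightarrow> real \<Rightarrow> ('n pt \<Rightarrow> real) \<Rightarrow> bool" where
  "weak_solution a q u \<longleftrightarrow>
     u \<in> borel_measurable lebesgue \<and>
     (\<forall>\<Omega>. bounded_domain \<Omega> \<longrightarrow>
       (\<exists>X \<in> W_space a q \<Omega>. W_represents q \<Omega> X u \<and>
         (\<forall>\<phi>. test_function \<phi> \<and> supp \<phi> \<subseteq> \<Omega> \<longrightarrow>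
           (\<exists>v e. W_time_deriv \<Omega> X v \<and> W_energy_pairing a \<Omega> \<phi> X e \<and>
              (LINT p:\<Omega>|lebesgue. v p * \<phi> p) + e
              - (LINT p|lebesgue. \<bar>u p\<bar> powr (q - 1) * u p * \<phi> p) \<ge> 0))))"

end

theory Submission
  imports Defs
begin

text \<open>
  A non-negative weak solution is tested with a decreasing function of itself. Let \<open>s\<^sub>k\<close> be smooth
  functions representing \<open>u\<close> on a bounded domain, \<open>\<zeta>\<close> a smooth cutoff and \<open>h\<close> a bounded smooth function
  with \<open>1 \<le> h \<le> 2\<close> and \<open>h' < 0\<close>. The test function \<open>\<phi> = h(s\<^sub>k) \<zeta>\<close> gives, up to an error that
  tends to \<open>0\<close> as \<open>k\<close> grows,
  \<open>\<integral> u\<^sup>q \<zeta> \<le> - \<integral> H(s\<^sub>k) \<zeta>\<^sub>t + \<integral> (h'(s\<^sub>k) \<zeta> \<langle>\<nabla>s\<^sub>k, \<nabla>s\<^sub>k\<rangle> + h(s\<^sub>k) \<langle>\<nabla>\<zeta>, \<nabla>s\<^sub>k\<rangle>)\<close>,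
  where \<open>H' = h\<close> and \<open>\<langle>\<cdot>, \<cdot>\<rangle>\<close> is the form with matrix \<open>a\<close>. Its Cauchy-Schwarz inequality lets the
  negative first term absorb the gradient in the second one. What remains is at most a multiple of
  \<open>\<langle>\<nabla>\<zeta>, \<nabla>\<zeta>\<rangle> / (\<zeta> |h'(s\<^sub>k)|)\<close>, which contains no derivative of the solution. This works for a
  degenerate \<open>a\<close>, for which \<open>u\<close> itself may have no gradient
  (\<open>energy_form_absorption\<close>, \<open>tested_inequality_eventually\<close>, \<open>weak_solution_estimate\<close>).

  The function \<open>h\<close> can be chosen with \<open>1/|h'(s)| \<le> C \<epsilon> (1 + |s/\<epsilon>|\<^sup>p)\<close>, where \<open>1 < p < min q 2\<close>,
  \<open>\<epsilon> > 0\<close> is arbitrary and \<open>C\<close> does not depend on \<open>\<epsilon>\<close> (\<open>ex_scaled_concave_profile\<close>). Since \<open>p < q\<close>, the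
  \<open>L\<^sup>q\<close> convergence of \<open>s\<^sub>k\<close> is enough to pass to the limit. With \<open>\<zeta> = \<psi>\<^sup>N\<close> for a cutoff \<open>\<psi>\<close> of the
  cylinder \<open>|t| \<le> R\<^sup>\<alpha>\<close>, \<open>|x| \<le> R\<close>, the growth condition on \<open>A\<close> makes both \<open>|\<psi>\<^sub>t|\<close> and \<open>A |\<nabla>\<psi>|\<^sup>2\<close> of
  order \<open>R\<^bsup>-\<alpha>\<^esup>\<close>, and they live on the shell \<open>T\<close> between this cylinder and the one of half its
  size. Hence, with a constant independent of \<open>R\<close> and \<open>\<epsilon>\<close>,
  \<open>\<integral> u\<^sup>q \<psi>\<^sup>N \<le> K R\<^bsup>-\<alpha>\<^esup> \<integral>\<^sub>T \<epsilon> (1 + (u/\<epsilon>)\<^sup>p) \<psi>\<^bsup>N-2\<^esup>\<close>.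

  The natural size of a solution on this cylinder is \<open>\<rho> = R\<^bsup>-\<alpha>/(q-1)\<^esup>\<close>, and \<open>\<rho>\<^sup>q |T|\<close> is bounded exactly
  because \<open>q \<le> 1 + \<alpha>/n\<close>. Taking \<open>\<epsilon> = \<rho>\<close> and Young's inequality, \<open>\<integral> u\<^sup>q \<psi>\<^sup>N\<close> is bounded
  uniformly in \<open>R\<close>, so \<open>u\<^sup>q\<close> is integrable on the whole space. Taking \<open>\<epsilon> = b \<rho>\<close> with \<open>b\<close> small
  instead, \<open>\<integral> u\<^sup>q \<psi>\<^sup>N \<le> C b + C\<^sub>b \<integral>\<^sub>T u\<^sup>q\<close>. The last integral is part of the tail of a convergent
  integral and vanishes as \<open>R\<close> grows, whence \<open>\<integral> u\<^sup>q \<le> C b\<close> for every \<open>b > 0\<close>. The freedom in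
  \<open>b\<close> settles the critical exponent \<open>q = 1 + \<alpha>/n\<close> together with the subcritical ones.
\<close>

section \<open>Calculus of smooth functions\<close>

lemma frechet_derivative_cong_open:
  assumes "open S" "x \<in> S" "\<And>y. y \<in> S \<Longrightarrow> f y = g y"
  shows "frechet_derivative f (at x) = frechet_derivative g (at x)"
proof -
  have "(f has_derivative D) (at x) \<longleftrightarrow> (g has_derivative D) (at x)" for D
    using has_derivative_transform_within_open[of f D x UNIV S g]
      has_derivative_transform_within_open[of g D x UNIV S f] assms by auto
  then show ?thesis unfolding frechet_derivative_def by simp
qed

lemma differentiable_cong_open:
  assumes "open S" "x \<in> S" "\<And>y. y \<in> S \<Longrightarrow> f y = g y"
  shows "f differentiable (at x) \<longleftrightarrow> g differentiable (at x)"
  unfolding differentiable_def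
  using has_derivative_transform_within_open[of f _ x UNIV S g]
      has_derivative_transform_within_open[of g _ x UNIV S f] assms by auto

lemma k_times_diff_on_cong:
  assumes "open S" "\<And>x. x \<in> S \<Longrightarrow> f x = g x"
  shows "k_times_diff_on k S f \<longleftrightarrow> k_times_diff_on k S g"
  using assms(2)
proof (induction k arbitrary: f g)
  case 0 then show ?case by (auto intro: continuous_on_cong)
next
  case (Suc k)
  have "k_times_diff_on k S (\<lambda>x. frechet_derivative f (at x) v) \<longleftrightarrow>
        k_times_diff_on k S (\<lambda>x. frechet_derivative g (at x) v)" for v
    by (rule Suc.IH) (simp add: frechet_derivative_cong_open[OF assms(1) _ Suc.prems])
  then show ?case using differentiable_cong_open[OF assms(1) _ Suc.prems] by simp
qed

lemma k_times_diff_on_SucD: "k_times_diff_on (Suc k) S f \<Longrightarrow> k_times_diff_on k S f"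
proof (induction k arbitrary: f)
  case 0
  then show ?case
    by (auto simp: continuous_at_imp_continuous_on differentiable_imp_continuous_within)
qed (metis k_times_diff_on.simps(2))

lemma k_times_diff_on_subset: "k_times_diff_on k S f \<Longrightarrow> T \<subseteq> S \<Longrightarrow> k_times_diff_on k T f"
  by (induction k arbitrary: f) (auto intro: continuous_on_subset)

lemma k_times_diff_on_Un:
  "open S \<Longrightarrow> open T \<Longrightarrow> k_times_diff_on k S f \<Longrightarrow> k_times_diff_on k T f \<Longrightarrow> k_times_diff_on k (S \<union> T) f"
  by (induction k arbitrary: f) (auto intro: continuous_on_open_Un)

lemma k_times_diff_on_const: "k_times_diff_on k S (\<lambda>x. c)"
  by (induction k arbitrary: c) auto

lemma k_times_diff_on_add:
  assumes "open S" "k_times_diff_on k S f" "k_times_diff_on k S g"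
  shows "k_times_diff_on k S (\<lambda>x. f x + g x)"
  using assms(2,3)
proof (induction k arbitrary: f g)
  case 0 then show ?case by (auto intro: continuous_intros)
next
  case (Suc k)
  have "frechet_derivative (\<lambda>x. f x + g x) (at x) v
      = frechet_derivative f (at x) v + frechet_derivative g (at x) v" if "x \<in> S" for x v
  proof -
    have "((\<lambda>x. f x + g x) has_derivative (\<lambda>v. frechet_derivative f (at x) v + frechet_derivative g (at x) v)) (at x)"
      using Suc.prems that by (intro has_derivative_add) (auto simp: frechet_derivative_works[symmetric])
    then show ?thesis by (metis frechet_derivative_at)
  qed
  then have "k_times_diff_on k S (\<lambda>x. frechet_derivative (\<lambda>x. f x + g x) (at x) v)" for v
    by (rule k_times_diff_on_cong[OF assms(1), THEN iffD2]) (use Suc in auto)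
  then show ?case using Suc.prems by auto
qed

lemma k_times_diff_on_mult:
  assumes "open S" "k_times_diff_on k S f" "k_times_diff_on k S g"
  shows "k_times_diff_on k S (\<lambda>x. f x * g x)"
  using assms(2,3)
proof (induction k arbitrary: f g)
  case 0 then show ?case by (auto intro: continuous_intros)
next
  case (Suc k)
  have "frechet_derivative (\<lambda>x. f x * g x) (at x) v
      = f x * frechet_derivative g (at x) v + frechet_derivative f (at x) v * g x" if "x \<in> S" for x v
  proof -
    have "((\<lambda>x. f x * g x) has_derivative (\<lambda>v. f x * frechet_derivative g (at x) v + frechet_derivative f (at x) v * g x)) (at x)"
      using Suc.prems that by (intro has_derivative_mult) (auto simp: frechet_derivative_works[symmetric])
    then show ?thesis by (metis frechet_derivative_at)
  qed
  moreover have "k_times_diff_on k S f" "k_times_diff_on k S g"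
    using Suc.prems k_times_diff_on_SucD by blast+
  ultimately have "k_times_diff_on k S (\<lambda>x. frechet_derivative (\<lambda>x. f x * g x) (at x) v)" for v
    using Suc.IH Suc.prems k_times_diff_on_cong[OF assms(1), of "\<lambda>x. frechet_derivative (\<lambda>x. f x * g x) (at x) v"
        "\<lambda>x. f x * frechet_derivative g (at x) v + frechet_derivative f (at x) v * g x"]
    by (auto intro!: k_times_diff_on_add[OF assms(1)])
  then show ?case using Suc.prems by auto
qed

lemma k_times_diff_on_compose:
  fixes g :: "real \<Rightarrow> real"
  assumes "open S" "open T" "k_times_diff_on k T g" "k_times_diff_on k S f" "f ` S \<subseteq> T"
  shows "k_times_diff_on k S (\<lambda>x. g (f x))"
  using assms(3,4,5)
proof (induction k arbitrary: f g)
  case 0 then show ?case by (auto intro: continuous_on_compose2)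
next
  case (Suc k)
  have D: "((\<lambda>x. g (f x)) has_derivative (\<lambda>v. frechet_derivative g (at (f x)) (frechet_derivative f (at x) v))) (at x)"
    if "x \<in> S" for x
  proof -
    have "(f has_derivative frechet_derivative f (at x)) (at x)"
      using Suc.prems that by (auto simp: frechet_derivative_works[symmetric])
    moreover have "(g has_derivative frechet_derivative g (at (f x))) (at (f x))"
      using Suc.prems that by (auto simp: frechet_derivative_works[symmetric])
    ultimately show ?thesis by (rule has_derivative_compose)
  qed
  have "frechet_derivative (\<lambda>x. g (f x)) (at x) v
      = frechet_derivative g (at (f x)) 1 * frechet_derivative f (at x) v" if "x \<in> S" for x v
  proof -
    have lin: "linear (frechet_derivative g (at (f x)))"
      using Suc.prems that by (auto intro: linear_frechet_derivative)
    have "frechet_derivative (\<lambda>x. g (f x)) (at x) v = frechet_derivative g (at (f x)) (frechet_derivative f (at x) v *\<^sub>R 1)"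
      using frechet_derivative_at[OF D[OF that]] by (metis real_scaleR_def mult.right_neutral)
    then show ?thesis by (simp add: linear_scale[OF lin] del: real_scaleR_def) simp
  qed
  moreover have "k_times_diff_on k S (\<lambda>x. frechet_derivative g (at (f x)) 1)"
    using Suc.IH[of "\<lambda>y. frechet_derivative g (at y) 1" f] Suc.prems k_times_diff_on_SucD[of k S f] by auto
  ultimately have "k_times_diff_on k S (\<lambda>x. frechet_derivative (\<lambda>x. g (f x)) (at x) v)" for v
    using Suc.prems k_times_diff_on_cong[OF assms(1), of "\<lambda>x. frechet_derivative (\<lambda>x. g (f x)) (at x) v"
        "\<lambda>x. frechet_derivative g (at (f x)) 1 * frechet_derivative f (at x) v"]
    by (auto intro!: k_times_diff_on_mult[OF assms(1)])
  then show ?case using D by (auto simp: differentiable_def)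
qed

lemma k_times_diff_on_bounded_linear: "bounded_linear f \<Longrightarrow> k_times_diff_on k S f"
proof (cases k)
  case 0 then show "bounded_linear f \<Longrightarrow> ?thesis" by (simp add: linear_continuous_on)
next
  case (Suc m)
  assume f: "bounded_linear f"
  then have "frechet_derivative f (at x) = f" for x
    by (metis bounded_linear_imp_has_derivative frechet_derivative_at)
  then show ?thesis using f Suc by (auto simp: k_times_diff_on_const bounded_linear_imp_differentiable)
qed

lemma smooth_on_cong:
  "open S \<Longrightarrow> (\<And>x. x \<in> S \<Longrightarrow> f x = g x) \<Longrightarrow> smooth_on S f \<longleftrightarrow> smooth_on S g"
  unfolding smooth_on_def using k_times_diff_on_cong by blast

lemma smooth_on_subset: "smooth_on S f \<Longrightarrow> T \<subseteq> S \<Longrightarrow> smooth_on T f"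
  unfolding smooth_on_def using k_times_diff_on_subset by blast

lemma smooth_on_Un: "open S \<Longrightarrow> open T \<Longrightarrow> smooth_on S f \<Longrightarrow> smooth_on T f \<Longrightarrow> smooth_on (S \<union> T) f"
  unfolding smooth_on_def using k_times_diff_on_Un by blast

lemma smooth_on_const: "smooth_on S (\<lambda>x. c)"
  unfolding smooth_on_def by (simp add: k_times_diff_on_const)

lemma smooth_on_add: "open S \<Longrightarrow> smooth_on S f \<Longrightarrow> smooth_on S g \<Longrightarrow> smooth_on S (\<lambda>x. f x + g x)"
  unfolding smooth_on_def using k_times_diff_on_add by blast

lemma smooth_on_mult: "open S \<Longrightarrow> smooth_on S f \<Longrightarrow> smooth_on S g \<Longrightarrow> smooth_on S (\<lambda>x. f x * g x)"
  unfolding smooth_on_def using k_times_diff_on_mult by blast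

lemma smooth_on_diff: 
  assumes "open S" "smooth_on S f" "smooth_on S g" shows "smooth_on S (\<lambda>x. f x - g x)"
  using smooth_on_add[OF assms(1,2) smooth_on_mult[OF assms(1) smooth_on_const[of S "-1"] assms(3)]] by simp

lemma smooth_on_sum: "open S \<Longrightarrow> (\<And>i. i \<in> I \<Longrightarrow> smooth_on S (f i)) \<Longrightarrow> smooth_on S (\<lambda>x. \<Sum>i\<in>I. f i x)"
  by (induction I rule: infinite_finite_induct) (auto intro: smooth_on_const smooth_on_add)

lemma smooth_on_power: "open S \<Longrightarrow> smooth_on S f \<Longrightarrow> smooth_on S (\<lambda>x. f x ^ m)"
  by (induction m) (auto intro: smooth_on_const smooth_on_mult)

lemma smooth_on_compose:
  fixes g :: "real \<Rightarrow> real"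
  shows "open S \<Longrightarrow> open T \<Longrightarrow> smooth_on T g \<Longrightarrow> smooth_on S f \<Longrightarrow> f ` S \<subseteq> T \<Longrightarrow> smooth_on S (\<lambda>x. g (f x))"
  unfolding smooth_on_def using k_times_diff_on_compose by blast

lemma smooth_on_bounded_linear: "bounded_linear f \<Longrightarrow> smooth_on S f"
  unfolding smooth_on_def by (simp add: k_times_diff_on_bounded_linear)

lemma smooth_on_differentiable: "smooth_on S f \<Longrightarrow> x \<in> S \<Longrightarrow> f differentiable (at x)"
  unfolding smooth_on_def by (metis k_times_diff_on.simps(2))

lemma smooth_on_continuous: "smooth_on S f \<Longrightarrow> continuous_on S f"
  unfolding smooth_on_def by (metis k_times_diff_on.simps(1))

lemma smooth_on_continuous_frechet_derivative:
  "smooth_on S f \<Longrightarrow> continuous_on S (\<lambda>x. frechet_derivative f (at x) v)"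
  unfolding smooth_on_def by (metis k_times_diff_on.simps)

text \<open>Smoothness is proved for a whole family at once when the derivative of each member is a
  combination of members: the induction on the order of differentiability then closes without a
  formula for the higher derivatives. Two summands suffice for the real powers and for the
  functions \<open>exp (- 1 / x) / x\<^sup>k\<close>.\<close>

lemma smooth_on_closed_family:
  fixes F :: "'i \<Rightarrow> real \<Rightarrow> real" 
  assumes "open S"
    and "\<And>i x. x \<in> S \<Longrightarrow> (F i has_real_derivative (c i * F (d i) x + c' i * F (d' i) x)) (at x)"
  shows "smooth_on S (F i)"
proof -
  have "k_times_diff_on k S (F i)" for k
  proof (induction k arbitrary: i)
    case 0 show ?case using assms(2)
      by (auto intro!: continuous_at_imp_continuous_on DERIV_isCont)
  next
    case (Suc k)
    have "frechet_derivative (F i) (at x) v = v * (c i * F (d i) x + c' i * F (d' i) x)" if "x \<in> S" for x v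
      using assms(2)[OF that] frechet_derivative_at[of "F i"] 
      by (metis (no_types, lifting) has_field_derivative_def mult.commute)
    moreover have "k_times_diff_on k S (\<lambda>x. v * (c i * F (d i) x + c' i * F (d' i) x))" for v
      using Suc by (intro k_times_diff_on_mult k_times_diff_on_add k_times_diff_on_const assms(1))
    ultimately have "k_times_diff_on k S (\<lambda>x. frechet_derivative (F i) (at x) v)" for v
      by (subst k_times_diff_on_cong[OF assms(1)]) auto
    moreover have "\<forall>x\<in>S. F i differentiable (at x)"
      using assms(2) real_differentiable_def by blast
    ultimately show ?case by simp
  qed
  then show ?thesis unfolding smooth_on_def by simp
qed

lemma smooth_on_powr: "smooth_on {0<..} (\<lambda>x::real. x powr e)"
  by (rule smooth_on_closed_family[where F = "\<lambda>e x. x powr e" and c = "\<lambda>e. e" and d = "\<lambda>e. e - 1" and c' = "\<lambda>_. 0" and d' = "\<lambda>e. e"])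
    (auto intro!: derivative_eq_intros)

lemma frechet_derivative_diff_real:
  fixes f g :: "'a::real_normed_vector \<Rightarrow> real"
  assumes "f differentiable (at p)" "g differentiable (at p)"
  shows "frechet_derivative (\<lambda>p. f p - g p) (at p) v = frechet_derivative f (at p) v - frechet_derivative g (at p) v"
proof -
  have "((\<lambda>p. f p - g p) has_derivative (\<lambda>v. frechet_derivative f (at p) v - frechet_derivative g (at p) v)) (at p)"
    using assms by (intro has_derivative_diff) (auto simp: frechet_derivative_works[symmetric])
  then show ?thesis by (metis frechet_derivative_at)
qed

lemma frechet_derivative_compose_mult:
  fixes s \<zeta> :: "'a::real_normed_vector \<Rightarrow> real"
  assumes "(G has_real_derivative G') (at (s p))" "s differentiable (at p)" "\<zeta> differentiable (at p)"
  shows "frechet_derivative (\<lambda>p. G (s p) * \<zeta> p) (at p) v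
    = G' * \<zeta> p * frechet_derivative s (at p) v + G (s p) * frechet_derivative \<zeta> (at p) v"
proof -
  have "(s has_derivative frechet_derivative s (at p)) (at p)"
    using assms(2) by (simp add: frechet_derivative_works[symmetric])
  from has_derivative_compose[OF this assms(1)[unfolded has_field_derivative_def]]
  have 1: "((\<lambda>p. G (s p)) has_derivative (\<lambda>v. G' * frechet_derivative s (at p) v)) (at p)" .
  have 2: "(\<zeta> has_derivative frechet_derivative \<zeta> (at p)) (at p)"
    using assms(3) by (simp add: frechet_derivative_works[symmetric])
  have "((\<lambda>p. G (s p) * \<zeta> p) has_derivative
     (\<lambda>v. G (s p) * frechet_derivative \<zeta> (at p) v + (G' * frechet_derivative s (at p) v) * \<zeta> p)) (at p)"
    by (rule has_derivative_mult[OF 1 2])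
  then have "frechet_derivative (\<lambda>p. G (s p) * \<zeta> p) (at p) =
     (\<lambda>v. G (s p) * frechet_derivative \<zeta> (at p) v + (G' * frechet_derivative s (at p) v) * \<zeta> p)"
    by (metis frechet_derivative_at)
  then show ?thesis by simp
qed

lemma notin_supp: "p \<notin> supp f \<Longrightarrow> f p = 0"
  unfolding supp_def using closure_subset[of "{p. f p \<noteq> 0}"] by blast

lemma supp_mult_subset: "supp (\<lambda>p. f p * g p) \<subseteq> supp g"
  unfolding supp_def by (intro closure_mono) auto

lemma compact_supp_mult:
  fixes f g :: "'n::finite pt \<Rightarrow> real"
  assumes "compact (supp g)" shows "compact (supp (\<lambda>p. f p * g p))"
proof -
  have "bounded (supp (\<lambda>p. f p * g p))"
    by (rule bounded_subset[OF compact_imp_bounded[OF assms] supp_mult_subset])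
  moreover have "closed (supp (\<lambda>p. f p * g p))" unfolding supp_def by (rule closed_closure)
  ultimately show ?thesis unfolding compact_eq_bounded_closed by blast
qed

text \<open>The factor \<open>s\<close> is smooth only in \<open>\<Omega>\<close>. The product is smooth everywhere because it vanishes in the
  open complement of \<open>supp \<zeta>\<close>, which together with \<open>\<Omega>\<close> covers the space.\<close>

lemma smooth_on_compose_mult_compact_support:
  fixes s \<zeta> :: "'a::real_normed_vector \<Rightarrow> real"
  assumes "open \<Omega>" "smooth_on UNIV G" "smooth_on \<Omega> s" "smooth_on UNIV \<zeta>" "supp \<zeta> \<subseteq> \<Omega>"
  shows "smooth_on UNIV (\<lambda>p. G (s p) * \<zeta> p)"
proof -
  have op: "open (- supp \<zeta>)" by (simp add: supp_def open_Compl)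
  have "smooth_on \<Omega> (\<lambda>p. G (s p) * \<zeta> p)"
    by (intro smooth_on_mult smooth_on_compose[OF assms(1) open_UNIV assms(2,3)] assms(1)
        smooth_on_subset[OF assms(4)]) auto
  moreover have "smooth_on (- supp \<zeta>) (\<lambda>p. G (s p) * \<zeta> p)"
    by (rule smooth_on_cong[OF op, THEN iffD2, OF _ smooth_on_const[of _ 0]]) (simp add: notin_supp)
  ultimately have "smooth_on (\<Omega> \<union> - supp \<zeta>) (\<lambda>p. G (s p) * \<zeta> p)"
    using assms(1) op by (rule smooth_on_Un[rotated 2])
  moreover have "\<Omega> \<union> - supp \<zeta> = UNIV" using assms(5) by auto
  ultimately show ?thesis by simp
qed

lemma test_function_compose_mult:
  assumes "open \<Omega>" "smooth_on UNIV h" "\<And>r. 0 \<le> h r" "smooth_on \<Omega> s" "test_function \<zeta>" "supp \<zeta> \<subseteq> \<Omega>"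
  shows "test_function (\<lambda>p. h (s p) * \<zeta> p)" "supp (\<lambda>p. h (s p) * \<zeta> p) \<subseteq> \<Omega>"
  using assms supp_mult_subset[of "\<lambda>p. h (s p)" \<zeta>]
  by (auto simp: test_function_def compact_supp_mult intro: smooth_on_compose_mult_compact_support)

section \<open>A plateau function\<close>

text \<open>The factors \<open>inverse x ^ k\<close> make the family closed under differentiation.\<close>

definition flat :: "nat \<Rightarrow> real \<Rightarrow> real" where
  "flat k x = (if 0 < x then exp (- inverse x) * inverse x ^ k else 0)"

lemma exp_power_tendsto_0: "((\<lambda>x. exp (- inverse x) * inverse x ^ k) \<longlongrightarrow> 0) (at_right (0::real))"
proof -
  have "((\<lambda>y. y ^ k / exp y) \<longlongrightarrow> 0) (at_top::real filter)"
    by (rule tendsto_power_div_exp_0)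
  then have "((\<lambda>x. inverse x ^ k / exp (inverse x)) \<longlongrightarrow> 0) (at_right (0::real))"
    by (rule filterlim_compose[OF _ filterlim_inverse_at_top_right])
  then show ?thesis by (simp add: exp_minus field_simps)
qed

lemma flat_has_derivative:
  "(flat k has_real_derivative (- real k) * flat (Suc k) x + 1 * flat (k + 2) x) (at x)"
proof -
  consider "x > 0" | "x < 0" | "x = 0" by linarith
  then show ?thesis
  proof cases
    case 1
    have "((\<lambda>x. exp (- inverse x) * inverse x ^ k) has_real_derivative 
        (- real k) * flat (Suc k) x + 1 * flat (k + 2) x) (at x)"
      using 1 power_Suc[of x "k - 1"]
      by (cases "k = 0") (auto intro!: derivative_eq_intros simp: flat_def field_simps power2_eq_square)
    then show ?thesis
      by (rule has_field_derivative_transform_within_open[of _ _ _ "{0<..}"]) (use 1 in \<open>auto simp: flat_def\<close>)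
  next
    case 2
    have "((\<lambda>x. 0) has_real_derivative (- real k) * flat (Suc k) x + 1 * flat (k + 2) x) (at x)"
      using 2 by (auto simp: flat_def)
    then show ?thesis
      by (rule has_field_derivative_transform_within_open[of _ _ _ "{..<0}"]) (use 2 in \<open>auto simp: flat_def\<close>)
  next
    case 3
    have "((\<lambda>y. (flat k y - flat k 0) / (y - 0)) \<longlongrightarrow> 0) (at_right 0)"
      by (rule Lim_transform_eventually[OF exp_power_tendsto_0[of "Suc k"]])
        (auto simp: eventually_at_filter flat_def divide_inverse)
    moreover have "((\<lambda>y. (flat k y - flat k 0) / (y - 0)) \<longlongrightarrow> 0) (at_left 0)"
      by (rule Lim_transform_eventually[OF tendsto_const])
        (auto simp: eventually_at_filter flat_def divide_inverse)
    ultimately show ?thesis using 3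
      by (simp add: has_field_derivative_iff filterlim_at_split flat_def)
  qed
qed

lemma smooth_on_flat: "smooth_on UNIV (flat k)"
  by (rule smooth_on_closed_family[where F = flat and c = "\<lambda>k. - real k" and d = "\<lambda>k. Suc k" and c' = "\<lambda>_. 1" and d' = "\<lambda>k. k + 2"])
    (use flat_has_derivative in auto)

lemma flat_nonneg: "0 \<le> flat k x" by (simp add: flat_def)

lemma flat_mono: "x \<le> y \<Longrightarrow> flat 0 x \<le> flat 0 y" by (auto simp: flat_def le_imp_inverse_le)

text \<open>With \<open>f = flat 0\<close> and \<open>c = f (3/4)\<close> the function \<open>f (c - f (r - 1/4)) / f c\<close> works: the inner \<open>f\<close>
  vanishes for \<open>r \<le> 1/4\<close>, and it is at least \<open>c\<close> for \<open>r \<ge> 1\<close>, so that the outer \<open>f\<close> vanishes there.\<close>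

lemma ex_cutoff:
  "\<exists>(\<eta>::real \<Rightarrow> real) (\<eta>'::real \<Rightarrow> real) (M::real). smooth_on UNIV \<eta> \<and> (\<forall>r. (\<eta> has_real_derivative \<eta>' r) (at r)) \<and>
     (\<forall>r. 0 \<le> \<eta> r \<and> \<eta> r \<le> 1) \<and> (\<forall>r\<le>1/4. \<eta> r = 1) \<and> (\<forall>r\<ge>1. \<eta> r = 0) \<and>
     (\<forall>r. \<bar>\<eta>' r\<bar> \<le> M) \<and> (\<forall>r. r \<le> 1/4 \<or> 1 \<le> r \<longrightarrow> \<eta>' r = 0)"
proof -
  define c where "c = flat 0 (3/4)"
  have c0: "c > 0" by (simp add: c_def flat_def)
  define \<eta> where "\<eta> r = inverse (flat 0 c) * flat 0 (c + (- 1) * flat 0 (- (1/4) + r))" for r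
  define \<eta>' where "\<eta>' r = inverse (flat 0 c) * (flat 2 (c + (- 1) * flat 0 (- (1/4) + r)) * ((- 1) * flat 2 (- (1/4) + r)))" for r
  have fc: "flat 0 c > 0" using c0 by (simp add: flat_def)
  have sm1: "smooth_on UNIV (\<lambda>r::real. - (1/4) + r)"
    by (intro smooth_on_add smooth_on_const smooth_on_bounded_linear bounded_linear_ident) auto
  have sm2: "smooth_on UNIV (\<lambda>r::real. flat 0 (- (1/4) + r))"
    by (rule smooth_on_compose[OF _ _ smooth_on_flat sm1]) auto
  have sm3: "smooth_on UNIV (\<lambda>r::real. c + (- 1) * flat 0 (- (1/4) + r))"
    by (intro smooth_on_add smooth_on_mult smooth_on_const sm2) auto
  have sm4: "smooth_on UNIV (\<lambda>r::real. flat 0 (c + (- 1) * flat 0 (- (1/4) + r)))"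
    by (rule smooth_on_compose[OF _ _ smooth_on_flat sm3]) auto
  have sm: "smooth_on UNIV \<eta>"
    unfolding \<eta>_def[abs_def] by (intro smooth_on_mult smooth_on_const sm4) auto
  have fd: "(flat 0 has_real_derivative flat 2 x) (at x)" for x
    using flat_has_derivative[of 0 x] by (simp add: numeral_2_eq_2)
  have D: "(\<eta> has_real_derivative \<eta>' r) (at r)" for r
    unfolding \<eta>_def[abs_def] \<eta>'_def
    by (rule derivative_eq_intros DERIV_chain2[OF fd] refl)+ simp
  have one: "\<eta> r = 1" if "r \<le> 1/4" for r
    using that fc by (simp add: \<eta>_def flat_def)
  have zero: "\<eta> r = 0" if "r \<ge> 1" for r
  proof -
    have "c \<le> flat 0 (- (1/4) + r)" unfolding c_def using that by (intro flat_mono) simp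
    then show ?thesis by (simp add: \<eta>_def flat_def[of 0 "c - _"])
  qed
  have bd: "0 \<le> \<eta> r \<and> \<eta> r \<le> 1" for r
  proof -
    have "flat 0 (c + (- 1) * flat 0 (- (1/4) + r)) \<le> flat 0 c"
      by (rule flat_mono) (simp add: flat_nonneg)
    then show ?thesis using fc by (simp add: \<eta>_def flat_nonneg field_simps)
  qed
  have z': "\<eta>' r = 0" if "r \<le> 1/4 \<or> 1 \<le> r" for r
  proof -
    consider "r \<le> 1/4" | "r \<ge> 1" using \<open>r \<le> 1/4 \<or> 1 \<le> r\<close> by linarith
    then show ?thesis
    proof cases
      case 1 then show ?thesis by (simp add: \<eta>'_def flat_def)
    next
      case 2
      have "c \<le> flat 0 (- (1/4) + r)" unfolding c_def using 2 by (intro flat_mono) simp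
      then show ?thesis by (simp add: \<eta>'_def flat_def[of 2 "c - _"])
    qed
  qed
  have cflat: "continuous_on UNIV (flat k)" for k
    by (rule smooth_on_continuous[OF smooth_on_flat])
  have cont: "continuous_on {1/4..1} \<eta>'"
    unfolding \<eta>'_def[abs_def]
    by (intro continuous_intros continuous_on_compose2[OF cflat]) auto
  then have "bounded (\<eta>' ` {1/4..1})"
    by (intro compact_imp_bounded compact_continuous_image) auto
  then obtain M where M: "\<forall>r\<in>{1/4..1}. \<bar>\<eta>' r\<bar> \<le> M"
    unfolding bounded_iff by auto
  have "\<bar>\<eta>' r\<bar> \<le> M" for r
  proof (cases "r \<in> {1/4..1}")
    case True then show ?thesis using M by blast
  next
    case False
    then have "\<eta>' r = 0" by (intro z') auto
    moreover have "0 \<le> M" using M by force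
    ultimately show ?thesis by simp
  qed
  with sm D one zero bd z' show ?thesis by blast
qed

section \<open>Concave profiles with slowly decaying second derivative\<close>

text \<open>
  The test function is built with \<open>h\<close>, the time derivative is integrated with \<open>H\<close>, and \<open>\<Theta>\<close> bounds the
  factor \<open>1 / |h'|\<close> that absorption of the gradient term costs.
\<close>

definition concave_profile ::
  "(real \<Rightarrow> real) \<Rightarrow> real \<Rightarrow> (real \<Rightarrow> real) \<Rightarrow> (real \<Rightarrow> real) \<Rightarrow> (real \<Rightarrow> real) \<Rightarrow> bool" where
  "concave_profile \<Theta> L H h h' \<longleftrightarrow> smooth_on UNIV H \<and> smooth_on UNIV h \<and>
     (\<forall>s. (H has_real_derivative h s) (at s)) \<and> (\<forall>s. (h has_real_derivative h' s) (at s)) \<and>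
     (\<forall>s. 1 \<le> h s \<and> h s \<le> 2) \<and> (\<forall>s. - L \<le> h' s \<and> h' s \<le> 0) \<and> (\<forall>s. \<bar>H s\<bar> \<le> 2 * \<bar>s\<bar>) \<and>
     (\<forall>s. 1 \<le> - h' s * \<Theta> s)"

text \<open>
  Any \<open>h\<close> with \<open>- h'\<close> comparable to \<open>(1 + s\<^sup>2) powr (- p/2)\<close> is bounded, because \<open>p > 1\<close>. An explicit \<open>H\<close>
  is \<open>3/2 s - 1/2 (w\<^bsup>1/2\<^esup> - w\<^bsup>(2-p)/2\<^esup>)\<close> with \<open>w = 1 + s\<^sup>2\<close>: the second derivative of the bracket
  is at least \<open>(2 - p) (p - 1) w\<^bsup>-p/2\<^esup>\<close> and its first derivative stays between \<open>-1\<close> and \<open>1\<close>.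
\<close>

lemma ex_concave_profile:
  fixes p :: real
  assumes "1 < p" "p < 2"
  shows "\<exists>(H::real \<Rightarrow> real) h h'. \<exists>C>0. concave_profile (\<lambda>s. C * (1 + \<bar>s\<bar> powr p)) 2 H h h'"
proof -
  define b where "b = 2 - p"
  have b: "0 < b" "b < 1" "b * p \<le> 1"
    using assms by (auto simp: b_def) (use sum_squares_ge_zero[of "p - 1" 0] in \<open>simp add: algebra_simps power2_eq_square\<close>)
  define w where "w s = 1 + s\<^sup>2" for s :: real
  have w1: "1 \<le> w s" "0 < w s" for s by (auto simp: w_def add_pos_nonneg)
  define H where "H s = 3/2 * s + ((- 1/2) * w s powr (1/2) + 1/2 * w s powr (b/2))" for s
  define h where "h s = 3/2 + ((- 1/2) * (s * w s powr (- 1/2)) + 1/2 * (b * (s * w s powr (- p/2))))" for s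
  define h' where "h' s = (- 1/2) * (w s powr (- 3/2) - b * (p * w s powr (- p/2 - 1) - (p - 1) * w s powr (- p/2)))" for s
  have smid: "smooth_on UNIV (\<lambda>s::real. s)" by (intro smooth_on_bounded_linear bounded_linear_ident)
  have smw: "smooth_on UNIV w" unfolding w_def[abs_def]
    by (intro smooth_on_add smooth_on_const smooth_on_power smid) auto
  have smwp: "smooth_on UNIV (\<lambda>s. w s powr e)" for e
    by (rule smooth_on_compose[OF _ _ smooth_on_powr smw]) (use w1 in auto)
  have smH: "smooth_on UNIV H" unfolding H_def[abs_def]
    by (intro smooth_on_add smooth_on_mult smooth_on_const smid smwp) auto
  have smh: "smooth_on UNIV h" unfolding h_def[abs_def]
    by (intro smooth_on_add smooth_on_mult smooth_on_const smid smwp) auto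
  have Dw: "(w has_real_derivative 2 * s) (at s)" for s
    unfolding w_def[abs_def] by (auto intro!: derivative_eq_intros)
  have Dwp: "((\<lambda>s. w s powr e) has_real_derivative 2 * e * (s * w s powr (e - 1))) (at s)" for s e
    using DERIV_chain2[OF DERIV_powr[OF DERIV_ident _ DERIV_const] Dw[of s], of e] w1[of s] 
    by (auto intro!: derivative_eq_intros Dw simp: powr_diff field_simps)
  have DH: "(H has_real_derivative h s) (at s)" for s
  proof -
    have "(H has_real_derivative 3/2 * 1 + ((- 1/2) * (2 * (1/2) * (s * w s powr (1/2 - 1))) + 1/2 * (2 * (b/2) * (s * w s powr (b/2 - 1))))) (at s)"
      unfolding H_def[abs_def] by (intro DERIV_add DERIV_cmult Dwp DERIV_ident)
    moreover have "b/2 - 1 = - p/2" by (simp add: b_def field_simps)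
    ultimately show ?thesis by (simp add: h_def)
  qed
  have Dsw: "((\<lambda>s. s * w s powr e) has_real_derivative (1 + 2 * e) * w s powr e - 2 * e * w s powr (e - 1)) (at s)" for s e
  proof -
    have "s * s * w s powr (e - 1) = w s powr e - w s powr (e - 1)"
    proof -
      have "w s powr e = w s * w s powr (e - 1)" using w1(2)[of s] by (simp add: powr_diff)
      moreover have "s * s = w s - 1" by (simp add: w_def power2_eq_square)
      ultimately show ?thesis by (simp only: left_diff_distrib mult_1_left)
    qed
    moreover have "s * (2 * e * (s * w s powr (e - 1))) = 2 * e * (s * s * w s powr (e - 1))"
      by simp
    ultimately have "s * (2 * e * (s * w s powr (e - 1))) + 1 * w s powr e = (1 + 2 * e) * w s powr e - 2 * e * w s powr (e - 1)"
      by (simp only:) (simp add: algebra_simps)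
    then show ?thesis using DERIV_mult'[OF DERIV_ident Dwp[of e s]] by simp
  qed
  have Dh: "(h has_real_derivative h' s) (at s)" for s
  proof -
    have "(h has_real_derivative 0 + ((- 1/2) * ((1 + 2 * (- 1/2)) * w s powr (- 1/2) - 2 * (- 1/2) * w s powr (- 1/2 - 1))
       + 1/2 * (b * ((1 + 2 * (- p/2)) * w s powr (- p/2) - 2 * (- p/2) * w s powr (- p/2 - 1))))) (at s)"
      unfolding h_def[abs_def] by (intro DERIV_add DERIV_cmult Dsw DERIV_const)
    then show ?thesis by (simp add: h'_def algebra_simps)
  qed
  have sw: "\<bar>s\<bar> * w s powr (- 1/2) \<le> 1" for s
  proof -
    have "\<bar>s\<bar> = sqrt (s\<^sup>2)" by simp
    also have "\<dots> \<le> sqrt (w s)" by (rule real_sqrt_le_mono) (simp add: w_def)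
    finally have "\<bar>s\<bar> \<le> w s powr (1/2)" using w1(2)[of s] by (simp add: powr_half_sqrt)
    then show ?thesis using w1(2)[of s] by (simp add: powr_minus field_simps)
  qed
  have hb: "1 \<le> h s \<and> h s \<le> 2" for s
  proof -
    define y where "y = 1 - b * w s powr ((1 - p)/2)"
    have "w s powr ((1 - p)/2) \<le> w s powr 0" using w1(1)[of s] assms by (intro powr_mono) auto
    then have "w s powr ((1 - p)/2) \<le> 1" using w1(2)[of s] by simp
    then have "b * w s powr ((1 - p)/2) \<le> 1" using b by (meson mult_le_one powr_ge_zero less_imp_le)
    then have y: "0 \<le> y" "y \<le> 1" using b by (auto simp: y_def)
    have "w s powr (- p/2) = w s powr (- 1/2) * w s powr ((1 - p)/2)"
      by (simp add: powr_add[symmetric] field_simps)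
    then have "h s = 3/2 - 1/2 * ((s * w s powr (- 1/2)) * y)"
      by (simp add: h_def y_def algebra_simps)
    moreover have "\<bar>(s * w s powr (- 1/2)) * y\<bar> \<le> 1"
      using mult_le_one[OF sw[of s] y] by (simp add: abs_mult y)
    ultimately show ?thesis by (auto simp: abs_le_iff)
  qed
  have wm: "w s powr e \<le> 1" if "e \<le> 0" for s e
    using powr_mono[of e 0 "w s"] that w1[of s] by simp
  \<comment> \<open>This uses \<open>p (2 - p) \<le> 1\<close>, which is why both powers of \<open>w\<close> may enter \<open>H\<close> with the same weight.\<close>
  have lo: "b * (p - 1) * w s powr (- p/2) \<le> - 2 * h' s" for s
  proof -
    have "b * p * w s powr (- p/2 - 1) \<le> 1 * w s powr (- 3/2)"
      using b assms w1(1)[of s] by (intro mult_mono powr_mono) auto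
    then show ?thesis by (simp add: h'_def algebra_simps)
  qed
  have h'0: "h' s \<le> 0" for s
  proof -
    have "0 \<le> b * (p - 1) * w s powr (- p/2)" using b assms by simp
    then show ?thesis using lo[of s] by linarith
  qed
  have h'2: "- 2 \<le> h' s" for s
  proof -
    have "b * (p * w s powr (- p/2 - 1)) \<ge> 0" using b assms by simp
    moreover have "b * ((p - 1) * w s powr (- p/2)) \<le> 1 * (1 * 1)"
      using b assms by (intro mult_mono wm) auto
    moreover have "w s powr (- 3/2) \<le> 1" by (rule wm) simp
    ultimately show ?thesis by (simp add: h'_def algebra_simps)
  qed
  have H2: "\<bar>H s\<bar> \<le> 2 * \<bar>s\<bar>" for s
  proof -
    have H0: "H 0 = 0" by (simp add: H_def w_def)
    have "norm (H s - H 0) \<le> 2 * norm (s - 0)"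
      by (rule field_differentiable_bound[of UNIV H h])
        (use DH hb in \<open>auto intro: order_trans[OF _ hb[THEN conjunct2]] simp: abs_le_iff\<close>, smt hb)
    then show ?thesis by (simp add: H0)
  qed
  define C where "C = 2 * 2 powr p / (b * (p - 1))"
  have C: "C > 0" using b assms by (simp add: C_def)
  have "1 \<le> - h' s * (C * (1 + \<bar>s\<bar> powr p))" for s
  proof -
    have "w s powr (p/2) \<le> ((1 + \<bar>s\<bar>)\<^sup>2) powr (p/2)"
      using w1(2)[of s] assms by (intro powr_mono2) (auto simp: w_def power2_sum)
    also have "\<dots> = (1 + \<bar>s\<bar>) powr p"
      by (simp add: powr_powr flip: powr_numeral)
    also have "\<dots> \<le> (2 * max 1 \<bar>s\<bar>) powr p"
      using assms by (intro powr_mono2) auto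
    also have "\<dots> = 2 powr p * max 1 \<bar>s\<bar> powr p" by (simp add: powr_mult)
    also have "\<dots> \<le> 2 powr p * (1 + \<bar>s\<bar> powr p)"
      by (auto simp: max_def)
    finally have "w s powr (p/2) \<le> 2 powr p * (1 + \<bar>s\<bar> powr p)" .
    then have "b * (p - 1) * (w s powr (- p/2) * w s powr (p/2)) \<le> b * (p - 1) * (w s powr (- p/2) * (2 powr p * (1 + \<bar>s\<bar> powr p)))"
      using b assms by (intro mult_left_mono) auto
    moreover have "w s powr (- p/2) * w s powr (p/2) = 1"
      using w1(2)[of s] by (simp add: powr_add[symmetric])
    ultimately have "b * (p - 1) \<le> b * (p - 1) * w s powr (- p/2) * (2 powr p * (1 + \<bar>s\<bar> powr p))"
      by (simp add: mult.assoc)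
    also have "\<dots> \<le> - 2 * h' s * (2 powr p * (1 + \<bar>s\<bar> powr p))"
      using lo[of s] by (intro mult_right_mono) auto
    finally show ?thesis using b assms by (simp add: C_def field_simps)
  qed
  then have "concave_profile (\<lambda>s. C * (1 + \<bar>s\<bar> powr p)) 2 H h h'"
    unfolding concave_profile_def using smH smh DH Dh hb h'0 h'2 H2 by blast
  with C show ?thesis by blast
qed

text \<open>
  Rescaling to \<open>\<epsilon> H(s/\<epsilon>)\<close> leaves the bounds on \<open>h\<close> and \<open>H\<close> unchanged. That \<open>C\<close> does not depend on \<open>\<epsilon>\<close>
  is what later allows \<open>\<epsilon>\<close> to be adapted to the size of the cylinder.
\<close>

lemma ex_scaled_concave_profile:
  fixes p :: real
  assumes "1 < p" "p < 2"
  shows "\<exists>C>0. \<forall>\<epsilon>>0. \<exists>(H::real \<Rightarrow> real) h h'.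
     concave_profile (\<lambda>s. C * (\<epsilon> * (1 + \<bar>s / \<epsilon>\<bar> powr p))) (2 / \<epsilon>) H h h'"
proof -
  obtain H h h' :: "real \<Rightarrow> real" and C
    where C: "C > 0" and prof: "concave_profile (\<lambda>s. C * (1 + \<bar>s\<bar> powr p)) 2 H h h'"
    using ex_concave_profile[OF assms] by blast
  have sm: "smooth_on UNIV H" "smooth_on UNIV h"
    and D: "\<And>s. (H has_real_derivative h s) (at s)" "\<And>s. (h has_real_derivative h' s) (at s)"
    and b: "\<And>s. 1 \<le> h s" "\<And>s. h s \<le> 2" "\<And>s. - 2 \<le> h' s" "\<And>s. h' s \<le> 0" "\<And>s. \<bar>H s\<bar> \<le> 2 * \<bar>s\<bar>"
      "\<And>s. 1 \<le> - h' s * (C * (1 + \<bar>s\<bar> powr p))"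
    using prof unfolding concave_profile_def by blast+
  show ?thesis
  proof (intro exI[of _ C] conjI allI impI C)
    fix \<epsilon> :: real assume e: "\<epsilon> > 0"
    have lin: "smooth_on UNIV (\<lambda>s. inverse \<epsilon> * s)"
      by (intro smooth_on_bounded_linear bounded_linear_mult_right)
    have Dl: "((\<lambda>s. inverse \<epsilon> * s) has_real_derivative inverse \<epsilon>) (at s)" for s
      by (auto intro!: derivative_eq_intros)
    have DH: "((\<lambda>s. \<epsilon> * H (inverse \<epsilon> * s)) has_real_derivative h (inverse \<epsilon> * s)) (at s)" for s
      by (rule DERIV_cong[OF DERIV_cmult[OF DERIV_chain2[OF D(1) Dl]]]) (use e in simp)
    have Dh: "((\<lambda>s. h (inverse \<epsilon> * s)) has_real_derivative h' (inverse \<epsilon> * s) * inverse \<epsilon>) (at s)" for s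
      by (rule DERIV_chain2[OF D(2) Dl])
    have sH: "smooth_on UNIV (\<lambda>s. \<epsilon> * H (inverse \<epsilon> * s))"
      by (intro smooth_on_mult smooth_on_const smooth_on_compose[OF _ _ sm(1) lin]) auto
    have sh: "smooth_on UNIV (\<lambda>s. h (inverse \<epsilon> * s))"
      by (intro smooth_on_compose[OF _ _ sm(2) lin]) auto
    have 1: "- (2 / \<epsilon>) \<le> h' (inverse \<epsilon> * s) * inverse \<epsilon>" for s
      using b(3)[of "inverse \<epsilon> * s"] e by (simp add: field_simps)
    have 2: "h' (inverse \<epsilon> * s) * inverse \<epsilon> \<le> 0" for s
      using b(4)[of "inverse \<epsilon> * s"] e by (simp add: mult_nonpos_nonneg)
    have 3: "\<bar>\<epsilon> * H (inverse \<epsilon> * s)\<bar> \<le> 2 * \<bar>s\<bar>" for s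
      using mult_left_mono[OF b(5)[of "inverse \<epsilon> * s"], of \<epsilon>] e by (simp add: abs_mult field_simps)
    have 4: "1 \<le> - (h' (inverse \<epsilon> * s) * inverse \<epsilon>) * (C * (\<epsilon> * (1 + \<bar>s / \<epsilon>\<bar> powr p)))" for s
    proof -
      have "- (x * inverse \<epsilon>) * (C * (\<epsilon> * y)) = - x * (C * y)" for x y
        using e by (simp add: field_simps)
      then show ?thesis
        using b(6)[of "inverse \<epsilon> * s"] by (simp only: divide_inverse mult.commute[of s])
    qed
    have "concave_profile (\<lambda>s. C * (\<epsilon> * (1 + \<bar>s / \<epsilon>\<bar> powr p))) (2 / \<epsilon>)
        (\<lambda>s. \<epsilon> * H (inverse \<epsilon> * s)) (\<lambda>s. h (inverse \<epsilon> * s)) (\<lambda>s. h' (inverse \<epsilon> * s) * inverse \<epsilon>)"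
      unfolding concave_profile_def using sH sh DH Dh b(1,2) 1 2 3 4 by blast
    then show "\<exists>(H::real \<Rightarrow> real) h h'. concave_profile (\<lambda>s. C * (\<epsilon> * (1 + \<bar>s / \<epsilon>\<bar> powr p))) (2 / \<epsilon>) H h h'"
      by blast
  qed
qed

section \<open>Elementary inequalities between powers\<close>

lemma powr_le_const_add:
  fixes p q \<kappa> :: real
  assumes "0 < p" "p < q" "0 < \<kappa>"
  shows "\<exists>C>0. \<forall>x\<ge>0. x powr p \<le> \<kappa> + C * x powr q"
proof (intro exI conjI allI impI)
  show "\<kappa> powr ((p - q) / p) > 0" using assms by simp
  fix x :: real assume x: "x \<ge> 0"
  show "x powr p \<le> \<kappa> + \<kappa> powr ((p - q) / p) * x powr q"
  proof (cases "x powr p \<le> \<kappa>")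
    case True then show ?thesis by (simp add: add_increasing2)
  next
    case False
    then have x0: "x > 0" using x assms by (cases "x = 0") auto
    have "x powr p = (x powr p) powr ((p - q) / p) * x powr q"
      using assms by (simp add: powr_powr powr_add[symmetric])
    also have "\<dots> \<le> \<kappa> powr ((p - q) / p) * x powr q"
      using False assms x0 by (intro mult_right_mono powr_mono2') (auto simp: divide_nonpos_pos)
    finally show ?thesis using assms by simp
  qed
qed

lemma powr_le_small_add:
  fixes p q \<kappa> :: real
  assumes "0 < p" "p < q" "0 < \<kappa>"
  shows "\<exists>C>0. \<forall>x\<ge>0. x powr p \<le> \<kappa> * x powr q + C"
proof -
  define x0 where "x0 = \<kappa> powr (- (1 / (q - p)))"
  show ?thesis
  proof (intro exI conjI allI impI)
    show "x0 powr p > 0" using assms by (simp add: x0_def)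
    fix x :: real assume x: "x \<ge> 0"
    show "x powr p \<le> \<kappa> * x powr q + x0 powr p"
    proof (cases "x \<le> x0")
      case True
      then have "x powr p \<le> x0 powr p" using x assms by (intro powr_mono2) auto
      then show ?thesis using assms by (simp add: add_increasing)
    next
      case False
      have x00: "x0 > 0" using assms by (simp add: x0_def)
      have "x powr p = x powr (p - q) * x powr q" by (simp add: powr_add[symmetric])
      also have "\<dots> \<le> x0 powr (p - q) * x powr q"
        using False assms x00 by (intro mult_right_mono powr_mono2') auto
      also have "x0 powr (p - q) = \<kappa>"
      proof -
        have "(- (1 / (q - p))) * (p - q) = 1" using assms by (simp add: field_simps)
        then show ?thesis using assms unfolding x0_def powr_powr by simp
      qed
      finally show ?thesis by (simp add: add_increasing2)
    qed
  qed
qed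

lemma powr_abs_add_le:
  fixes x y p :: real
  assumes "p \<ge> 0"
  shows "\<bar>x + y\<bar> powr p \<le> 2 powr p * (\<bar>x\<bar> powr p + \<bar>y\<bar> powr p)"
proof -
  have "\<bar>x + y\<bar> powr p \<le> (2 * max \<bar>x\<bar> \<bar>y\<bar>) powr p" using assms by (intro powr_mono2) auto
  also have "\<dots> = 2 powr p * max \<bar>x\<bar> \<bar>y\<bar> powr p" by (simp add: powr_mult)
  also have "\<dots> \<le> 2 powr p * (\<bar>x\<bar> powr p + \<bar>y\<bar> powr p)" by (auto simp: max_def)
  finally show ?thesis .
qed

lemma le_one_add_powr: "x \<ge> 0 \<Longrightarrow> p \<ge> 1 \<Longrightarrow> x \<le> 1 + x powr (p::real)"
  using powr_mono[of 1 p x] by (cases "x \<ge> 1") (auto simp: add_increasing2)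

text \<open>The power of the cutoff lost by differentiating \<open>\<psi>\<^sup>N\<close> twice is recovered from Young's inequality applied
  to \<open>x y powr (N / q)\<close>, provided that \<open>N p / q \<le> N - 2\<close>.\<close>

lemma powr_cutoff_absorb:
  fixes p q \<kappa> :: real
  assumes "0 < p" "p < q" "0 < \<kappa>" and N: "real N * p / q \<le> real N - 2" "N \<ge> 3"
  shows "\<exists>C>0. \<forall>x\<ge>0. \<forall>y. 0 \<le> y \<and> y \<le> 1 \<longrightarrow> x powr p * y ^ (N - 2) \<le> \<kappa> * (x powr q * y ^ N) + C"
proof -
  obtain C where C: "C > 0" "\<forall>x\<ge>0. x powr p \<le> \<kappa> * x powr q + C"
    using powr_le_small_add[OF assms(1-3)] by blast
  show ?thesis
  proof (intro exI[of _ C] conjI allI impI C(1))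
    fix x y :: real assume x: "0 \<le> x" and y: "0 \<le> y \<and> y \<le> 1"
    show "x powr p * y ^ (N - 2) \<le> \<kappa> * (x powr q * y ^ N) + C"
    proof (cases "y = 0")
      case True then show ?thesis using N C by (simp add: power_0_left)
    next
      case False
      then have y0: "0 < y" using y by simp
      have "y ^ (N - 2) = y powr (real N - 2)" using y0 N by (simp add: powr_realpow[symmetric])
      also have "\<dots> \<le> y powr (real N * p / q)" using y0 y N by (intro powr_mono') auto
      finally have "x powr p * y ^ (N - 2) \<le> x powr p * y powr (real N * p / q)" by (intro mult_left_mono) auto
      also have "\<dots> = (x * y powr (real N / q)) powr p"
        using x by (simp add: powr_mult powr_powr)
      also have "\<dots> \<le> \<kappa> * (x * y powr (real N / q)) powr q + C"
        using C(2) x by simp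
      also have "(x * y powr (real N / q)) powr q = x powr q * y ^ N"
        using x y0 assms by (simp add: powr_mult powr_powr powr_realpow)
      finally show ?thesis .
    qed
  qed
qed

lemma ex_exponent:
  fixes p q :: real assumes "0 < p" "p < q"
  shows "\<exists>N::nat. N \<ge> 3 \<and> real N * p / q \<le> real N - 2"
proof -
  have d: "1 - p / q > 0" using assms by simp
  obtain N0 :: nat where N0: "2 / (1 - p / q) \<le> real N0" using real_arch_simple by blast
  have "2 \<le> real (max N0 3) * (1 - p / q)"
    using N0 d order_trans[OF N0, of "real (max N0 3)"] by (simp add: divide_le_eq)
  then show ?thesis by (intro exI[of _ "max N0 3"]) (auto simp: algebra_simps)
qed

section \<open>The energy form\<close>

text \<open>The pointwise part of the standing assumptions, so that the algebra of the energy form can be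
  done at a single point.\<close>

definition elliptic_at :: "'n::finite coeffs \<Rightarrow> ('n pt \<Rightarrow> real) \<Rightarrow> 'n pt \<Rightarrow> bool" where
  "elliptic_at a A p \<longleftrightarrow> (\<forall>i j. a i j p = a j i p) \<and> (\<forall>\<xi> :: real ^ 'n.
        0 \<le> (\<Sum>i\<in>UNIV. \<Sum>j\<in>UNIV. a i j p * \<xi> $ i * \<xi> $ j) \<and>
        (\<Sum>i\<in>UNIV. \<Sum>j\<in>UNIV. a i j p * \<xi> $ i * \<xi> $ j) \<le> A p * (norm \<xi>)\<^sup>2)"

lemma AE_elliptic_at: "admissible_operator a A \<Longrightarrow> AE p in lebesgue. elliptic_at a A p"
  unfolding admissible_operator_def elliptic_at_def AE_conj_iff by (elim conjE) (intro conjI)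

lemma energy_form_compose_mult:
  assumes "(G has_real_derivative G') (at (s p))" "s differentiable (at p)" "\<zeta> differentiable (at p)"
  shows "energy_form a (\<lambda>p. G (s p) * \<zeta> p) w p
    = G' * \<zeta> p * energy_form a s w p + G (s p) * energy_form a \<zeta> w p"
  unfolding energy_form_def dx_def frechet_derivative_compose_mult[OF assms]
  by (simp add: algebra_simps sum.distrib sum_distrib_left)

lemma energy_form_diff_right:
  assumes "f differentiable (at p)" "g differentiable (at p)"
  shows "energy_form a \<phi> (\<lambda>p. f p - g p) p = energy_form a \<phi> f p - energy_form a \<phi> g p"
  unfolding energy_form_def dx_def frechet_derivative_diff_real[OF assms]
  by (simp add: algebra_simps sum_subtractf)

lemma energy_form_nonneg: 
  assumes "elliptic_at a A p" shows "0 \<le> energy_form a f f p"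
proof -
  have "0 \<le> (\<Sum>i\<in>UNIV. \<Sum>j\<in>UNIV. a i j p * (vec_lambda (\<lambda>i. dx i f p)) $ i * (vec_lambda (\<lambda>i. dx i f p)) $ j)"
    using assms unfolding elliptic_at_def by blast
  then show ?thesis by (simp add: energy_form_def)
qed

lemma energy_form_le:
  assumes "elliptic_at a A p" 
  shows "energy_form a f f p \<le> A p * (\<Sum>i\<in>UNIV. (dx i f p)\<^sup>2)"
proof -
  define \<xi> :: "real ^ 'a" where "\<xi> = vec_lambda (\<lambda>i. dx i f p)"
  have "(\<Sum>i\<in>UNIV. \<Sum>j\<in>UNIV. a i j p * \<xi> $ i * \<xi> $ j) \<le> A p * (norm \<xi>)\<^sup>2"
    using assms unfolding elliptic_at_def by blast
  moreover have "(norm \<xi>)\<^sup>2 = (\<Sum>i\<in>UNIV. (dx i f p)\<^sup>2)"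
    by (simp add: \<xi>_def norm_vec_def L2_set_def sum_nonneg)
  ultimately show ?thesis by (simp add: energy_form_def \<xi>_def)
qed

text \<open>This is \<open>\<langle>x \<nabla>f + y \<nabla>g, x \<nabla>f + y \<nabla>g\<rangle> \<ge> 0\<close>, from which all Cauchy-Schwarz type inequalities below
  are derived.\<close>

lemma energy_form_young:
  assumes "elliptic_at a A p"
  shows "0 \<le> x\<^sup>2 * energy_form a f f p + 2 * x * y * energy_form a f g p + y\<^sup>2 * energy_form a g g p"
proof -
  define \<xi> :: "real ^ 'a" where "\<xi> = vec_lambda (\<lambda>i. x * dx i f p + y * dx i g p)"
  have "0 \<le> (\<Sum>i\<in>UNIV. \<Sum>j\<in>UNIV. a i j p * \<xi> $ i * \<xi> $ j)"
    using assms unfolding elliptic_at_def by blast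
  also have "\<dots> = x\<^sup>2 * energy_form a f f p + x * y * energy_form a f g p
     + x * y * (\<Sum>i\<in>UNIV. \<Sum>j\<in>UNIV. a i j p * dx j f p * dx i g p) + y\<^sup>2 * energy_form a g g p"
    unfolding energy_form_def
    by (simp add: \<xi>_def algebra_simps power2_eq_square sum.distrib sum_distrib_left)
  also have "(\<Sum>i\<in>UNIV. \<Sum>j\<in>UNIV. a i j p * dx j f p * dx i g p) = energy_form a f g p"
    unfolding energy_form_def
    by (subst sum.swap, intro sum.cong refl) (use assms in \<open>auto simp: elliptic_at_def\<close>)
  finally show ?thesis by (simp add: algebra_simps)
qed

lemma abs_energy_form_le:
  assumes "elliptic_at a A p" "l > 0"
  shows "2 * \<bar>energy_form a f g p\<bar> \<le> l * energy_form a f f p + energy_form a g g p / l"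
proof -
  have "0 \<le> (l)\<^sup>2 * energy_form a f f p + 2 * l * 1 * energy_form a f g p + 1\<^sup>2 * energy_form a g g p"
    and "0 \<le> (l)\<^sup>2 * energy_form a f f p + 2 * l * (-1) * energy_form a f g p + (-1)\<^sup>2 * energy_form a g g p"
    by (rule energy_form_young[OF assms(1)])+
  then have "2 * l * \<bar>energy_form a f g p\<bar> \<le> l\<^sup>2 * energy_form a f f p + energy_form a g g p"
    by (cases "energy_form a f g p \<ge> 0") (auto)
  then show ?thesis using assms(2) by (simp add: field_simps power2_eq_square)
qed

lemma energy_form_combination:
  assumes "elliptic_at a A p" and "\<And>i. dx i f p = x * dx i g p + y * dx i k p"
  shows "energy_form a f f p \<le> 2 * x\<^sup>2 * energy_form a g g p + 2 * y\<^sup>2 * energy_form a k k p"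
proof -
  define s where "s = (\<Sum>i\<in>UNIV. \<Sum>j\<in>UNIV. a i j p * dx i k p * dx j g p)"
  have "energy_form a f f p = x\<^sup>2 * energy_form a g g p + x * y * energy_form a g k p
     + x * y * s + y\<^sup>2 * energy_form a k k p"
    unfolding energy_form_def s_def
    by (simp add: assms(2) algebra_simps power2_eq_square sum.distrib sum_distrib_left)
  moreover have "s = energy_form a g k p"
    unfolding energy_form_def s_def
    by (subst sum.swap, intro sum.cong refl) (use assms in \<open>auto simp: elliptic_at_def\<close>)
  moreover have "0 \<le> x\<^sup>2 * energy_form a g g p + 2 * x * (- y) * energy_form a g k p + (- y)\<^sup>2 * energy_form a k k p"
    by (rule energy_form_young[OF assms(1)])
  ultimately show ?thesis by (simp add: algebra_simps)
qed

lemma energy_form_diff_le: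
  assumes "elliptic_at a A p" "f differentiable (at p)" "g differentiable (at p)"
  shows "energy_form a (\<lambda>p. f p - g p) (\<lambda>p. f p - g p) p \<le> 2 * energy_form a f f p + 2 * energy_form a g g p"
  using energy_form_combination[OF assms(1), of "\<lambda>p. f p - g p" 1 f "- 1" g]
  by (simp add: dx_def frechet_derivative_diff_real[OF assms(2,3)])

lemma energy_form_le_diff:
  assumes "elliptic_at a A p" "f differentiable (at p)" "g differentiable (at p)"
  shows "energy_form a f f p \<le> 2 * energy_form a (\<lambda>p. f p - g p) (\<lambda>p. f p - g p) p + 2 * energy_form a g g p"
  using energy_form_combination[OF assms(1), of f 1 "\<lambda>p. f p - g p" 1 g]
  by (simp add: dx_def frechet_derivative_diff_real[OF assms(2,3)])

text \<open>The weight \<open>l = 1 / (|h'| z)\<close> in Young's inequality makes the energy of \<open>s\<close> cancel exactly. For \<open>z = 0\<close> there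
  is nothing to absorb with, but then the energy of \<open>\<zeta>\<close> vanishes as well and Cauchy-Schwarz kills
  the mixed term.\<close>

lemma energy_form_absorption:
  assumes "elliptic_at a A p" and "energy_form a \<zeta> \<zeta> p \<le> g * z"
    and "0 \<le> z" "0 \<le> g" "0 \<le> h" "h \<le> 2" "h' \<le> 0" "1 \<le> - h' * B"
  shows "h' * z * energy_form a s s p + h * energy_form a \<zeta> s p \<le> g * B"
proof -
  let ?E = "energy_form a s s p" and ?X = "energy_form a \<zeta> s p" and ?Z = "energy_form a \<zeta> \<zeta> p"
  have h': "h' < 0" using assms(7,8) by (cases "h' = 0") auto
  then have B: "B \<ge> 1 / - h'" using assms(8) by (simp add: field_simps)
  have E0: "0 \<le> ?E" "0 \<le> ?Z" using energy_form_nonneg[OF assms(1)] by auto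
  have X: "2 * \<bar>?X\<bar> \<le> l * ?Z + ?E / l" if "l > 0" for l
    using abs_energy_form_le[OF assms(1) that] .
  show ?thesis
  proof (cases "z = 0")
    case True
    have "?X = 0"
    proof (rule ccontr)
      assume ne: "?X \<noteq> 0"
      have Z: "?Z = 0" using assms(2) True E0 by auto
      have "2 * \<bar>?X\<bar> \<le> ?E / l" if "l > 0" for l using X[OF that] Z by simp
      \<comment> \<open>a large \<open>l\<close> gives a contradiction\<close>
      from this[of "(?E + 1) / \<bar>?X\<bar>"] have "2 * \<bar>?X\<bar> \<le> ?E / ((?E + 1) / \<bar>?X\<bar>)"
        using ne E0 by (meson add_nonneg_pos divide_pos_pos zero_less_abs_iff zero_less_one)
      also have "\<dots> = (?E / (?E + 1)) * \<bar>?X\<bar>" by simp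
      also have "\<dots> \<le> 1 * \<bar>?X\<bar>" using E0 by (intro mult_right_mono) auto
      finally show False using ne by simp
    qed
    moreover have "B \<ge> 0"
    proof -
      have "0 \<le> 1 / - h'" using h' by simp
      then show ?thesis using B by linarith
    qed
    ultimately show ?thesis using True assms by simp
  next
    case False
    then have z: "z > 0" using assms(3) by simp
    have "h * ?X \<le> 2 * \<bar>?X\<bar>"
    proof -
      have "h * ?X \<le> h * \<bar>?X\<bar>" using assms(5) by (intro mult_left_mono) auto
      also have "\<dots> \<le> 2 * \<bar>?X\<bar>" using assms(6) by (intro mult_right_mono) auto
      finally show ?thesis .
    qed
    also have "\<dots> \<le> 1 / (- h' * z) * ?Z + ?E / (1 / (- h' * z))"
      using h' z by (intro X) (simp add: mult_neg_pos)
    also have "?E / (1 / (- h' * z)) = - h' * z * ?E" by simp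
    finally have "h' * z * ?E + h * ?X \<le> 1 / (- h' * z) * ?Z" by simp
    also have "\<dots> \<le> 1 / (- h' * z) * (g * z)"
      using h' z assms(2) by (intro mult_left_mono) (auto simp: mult_neg_pos less_imp_le)
    also have "\<dots> = g * (1 / - h')" using z h' by (simp add: field_simps)
    also have "\<dots> \<le> g * B" using B assms(4) by (intro mult_left_mono) auto
    finally show ?thesis .
  qed
qed

section \<open>Integration by parts in time\<close>

lemma continuous_compact_support_integrable:
  fixes f :: "'a::euclidean_space \<Rightarrow> real"
  assumes "continuous_on UNIV f" "compact (supp f)"
  shows "integrable lborel f"
proof -
  have "set_integrable lborel (supp f) f"
    unfolding set_integrable_def
    by (rule borel_integrable_compact[OF assms(2)]) (rule continuous_on_subset[OF assms(1)], simp)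
  moreover have "indicator (supp f) x *\<^sub>R f x = f x" for x
    using notin_supp[of x f] by (auto simp: indicator_def)
  ultimately show ?thesis unfolding set_integrable_def by (simp only:)
qed

lemma integral_dt_eq_0:
  fixes F :: "'n::finite pt \<Rightarrow> real"
  assumes sm: "smooth_on UNIV F" and co: "compact (supp F)"
  shows "integrable lebesgue (dt F)" "integral\<^sup>L lebesgue (dt F) = 0"
proof -
  have cont: "continuous_on UNIV (dt F)"
    unfolding dt_def[abs_def] by (rule smooth_on_continuous_frechet_derivative[OF sm])
  have opn: "open (- supp F)" by (simp add: supp_def open_Compl)
  have zero: "dt F p = 0" if "p \<notin> supp F" for p
    using frechet_derivative_cong_open[OF opn, of p F "\<lambda>_. 0"] that by (simp add: dt_def notin_supp)
  have "supp (dt F) \<subseteq> supp F"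
    unfolding supp_def[of "dt F"] by (rule closure_minimal) (use zero in \<open>auto simp: supp_def\<close>)
  then have co': "compact (supp (dt F))"
    using co bounded_subset closed_closure unfolding compact_eq_bounded_closed supp_def by blast
  have int: "integrable lborel (dt F)" by (rule continuous_compact_support_integrable[OF cont co'])
  then show "integrable lebesgue (dt F)" by (subst integrable_completion) auto
  obtain K where K: "K > 0" "\<And>p. p \<in> supp F \<Longrightarrow> norm p < K"
    using compact_imp_bounded[OF co] by (auto simp: bounded_pos_less)
  have tdom: "(t, x) \<notin> supp F" if "\<bar>t\<bar> \<ge> K" for t x
  proof
    assume "(t, x) \<in> supp F"
    then have "norm (t, x) < K" by (rule K(2))
    then show False using norm_fst_le[of t x] that by simp
  qed
  have inner: "(\<integral>t. dt F (t, x) \<partial>lborel) = 0" for x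
  proof -
    have D: "((\<lambda>t. F (t, x)) has_real_derivative dt F (t, x)) (at t)" for t
    proof -
      have "(F has_derivative frechet_derivative F (at (t, x))) (at (t, x))"
        using smooth_on_differentiable[OF sm] by (simp add: frechet_derivative_works[symmetric])
      moreover have "((\<lambda>t. (t, x)) has_derivative (\<lambda>v. (v, 0))) (at t)"
        by (intro has_derivative_Pair has_derivative_ident has_derivative_const)
      ultimately have *: "((\<lambda>t. F (t, x)) has_derivative (\<lambda>v. frechet_derivative F (at (t, x)) (v, 0))) (at t)"
        using has_derivative_compose[of "\<lambda>t. (t, x)" "\<lambda>v. (v, 0)" t UNIV F "frechet_derivative F (at (t, x))"] by blast
      have lin: "linear (frechet_derivative F (at (t, x)))"
        using smooth_on_differentiable[OF sm] by (auto intro: linear_frechet_derivative)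
      have "frechet_derivative F (at (t, x)) (v, 0) = dt F (t, x) * v" for v
        using linear_scale[OF lin, of v "(1, 0)"] by (simp add: dt_def)
      with * show ?thesis by (simp add: has_field_derivative_def)
    qed
    have c2: "continuous_on UNIV (\<lambda>t. dt F (t, x))"
      by (rule continuous_on_compose2[OF cont]) (auto intro: continuous_intros)
    have "(\<integral>t. indicator {-K..K} t *\<^sub>R dt F (t, x) \<partial>lborel) = F (K, x) - F (- K, x)"
    proof (rule integral_FTC_atLeastAtMost[of "- K" K "\<lambda>t. F (t, x)"])
      show "((\<lambda>t. F (t, x)) has_vector_derivative dt F (t, x)) (at t within {- K..K})" for t
        using D[of t] by (simp add: has_real_derivative_iff_has_vector_derivative has_vector_derivative_at_within)
    qed (use K continuous_on_subset[OF c2] in auto)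
    moreover have "F (K, x) = 0" "F (-K, x) = 0"
      by (intro notin_supp tdom; use K in simp)+
    moreover have "indicator {-K..K} t *\<^sub>R dt F (t, x) = dt F (t, x)" for t
      using zero[OF tdom, of t x] by (cases "\<bar>t\<bar> \<ge> K") (auto simp: indicator_def)
    ultimately show ?thesis by (simp only: diff_self)
  qed
  have "integral\<^sup>L lebesgue (dt F) = integral\<^sup>L lborel (dt F)"
    by (rule integral_completion) (use int in simp)
  also have "\<dots> = (\<integral>p. dt F p \<partial>(lborel \<Otimes>\<^sub>M lborel))" by (simp add: lborel_prod)
  also have "\<dots> = (\<integral>x. (\<integral>t. dt F (t, x) \<partial>lborel) \<partial>lborel)"
    using lborel_pair.integral_snd[of "\<lambda>t x. dt F (t, x)"] int by (simp add: lborel_prod)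
  also have "\<dots> = 0" by (simp add: inner)
  finally show "integral\<^sup>L lebesgue (dt F) = 0" .
qed

lemma bounded_domain_lmeasurable:
  fixes \<Omega> :: "'n::finite pt set"
  assumes "bounded_domain \<Omega>" shows "open \<Omega>" "\<Omega> \<in> sets lebesgue" "\<Omega> \<in> lmeasurable"
proof -
  show op: "open \<Omega>" using assms by (simp add: bounded_domain_def)
  then show "\<Omega> \<in> sets lebesgue" by auto
  then show "\<Omega> \<in> lmeasurable" using assms by (auto simp: bounded_domain_def intro: bounded_set_imp_lmeasurable)
qed

lemma set_integral_eq_lebesgue_on:
  fixes f :: "'n::finite pt \<Rightarrow> real"
  assumes "\<Omega> \<in> sets lebesgue"
  shows "(LINT p:\<Omega>|lebesgue. f p) = integral\<^sup>L (lebesgue_on \<Omega>) f"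
    and "set_integrable lebesgue \<Omega> f \<longleftrightarrow> integrable (lebesgue_on \<Omega>) f"
  using assms by (auto simp: set_lebesgue_integral_def set_integrable_def integral_restrict_space integrable_restrict_space)

lemma integral_eq_lebesgue_on:
  fixes f :: "'n::finite pt \<Rightarrow> real"
  assumes "\<Omega> \<in> sets lebesgue" and "\<And>p. p \<notin> \<Omega> \<Longrightarrow> f p = 0"
  shows "integral\<^sup>L lebesgue f = integral\<^sup>L (lebesgue_on \<Omega>) f"
proof -
  have "indicator \<Omega> p *\<^sub>R f p = f p" for p using assms(2)[of p] by (cases "p \<in> \<Omega>") auto
  then have eq: "(\<lambda>p. indicator \<Omega> p *\<^sub>R f p) = f" by (rule ext)
  have "\<Omega> \<inter> space lebesgue \<in> sets lebesgue" using assms(1) by simp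
  from integral_restrict_space[OF this, of f] eq show ?thesis by (simp only:)
qed

lemma AE_lebesgue_onI:
  assumes "\<Omega> \<in> sets lebesgue" "AE p in lebesgue. p \<in> \<Omega> \<longrightarrow> P p"
  shows "AE p in lebesgue_on \<Omega>. P p"
  using assms by (simp add: AE_restrict_space_iff)

lemma smooth_on_measurable:
  fixes f :: "'n::finite pt \<Rightarrow> real"
  assumes "\<Omega> \<in> sets lebesgue" "smooth_on \<Omega> f"
  shows "f \<in> borel_measurable (lebesgue_on \<Omega>)" "dt f \<in> borel_measurable (lebesgue_on \<Omega>)"
    "dx i f \<in> borel_measurable (lebesgue_on \<Omega>)"
  using assms unfolding dt_def[abs_def] dx_def[abs_def]
  by (auto intro!: continuous_imp_measurable_on_sets_lebesgue smooth_on_continuous smooth_on_continuous_frechet_derivative)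

text \<open>Apply \<open>integral_dt_eq_0\<close> to \<open>H(s) \<zeta>\<close>. As \<open>H\<close> is smooth, this product is smooth on the whole space.\<close>

lemma integral_dt_compose_mult:
  fixes s \<zeta> :: "'n::finite pt \<Rightarrow> real"
  assumes dom: "bounded_domain \<Omega>" and s: "smooth_on \<Omega> s" "integrable (lebesgue_on \<Omega>) (dt s)"
    and H: "smooth_on UNIV H" "\<And>r. (H has_real_derivative h r) (at r)" 
    and h: "continuous_on UNIV h" "\<And>r. \<bar>h r\<bar> \<le> 2"
    and \<zeta>: "test_function \<zeta>" "supp \<zeta> \<subseteq> \<Omega>" "\<And>p. \<zeta> p \<le> 1"
  shows "(\<integral>p. dt s p * (h (s p) * \<zeta> p) \<partial>lebesgue_on \<Omega>) = - (\<integral>p. H (s p) * dt \<zeta> p \<partial>lebesgue_on \<Omega>)"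
    and "integrable (lebesgue_on \<Omega>) (\<lambda>p. H (s p) * dt \<zeta> p)"
proof -
  note \<Omega> = bounded_domain_lmeasurable[OF dom]
  let ?M = "lebesgue_on \<Omega>"
  let ?F = "\<lambda>p. H (s p) * \<zeta> p"
  have \<zeta>sm: "smooth_on UNIV \<zeta>" and \<zeta>0: "\<And>p. 0 \<le> \<zeta> p" and \<zeta>c: "compact (supp \<zeta>)"
    using \<zeta>(1) by (auto simp: test_function_def)
  have Fs: "smooth_on UNIV ?F" by (rule smooth_on_compose_mult_compact_support[OF \<Omega>(1) H(1) s(1) \<zeta>sm \<zeta>(2)])
  have Fc: "compact (supp ?F)" by (rule compact_supp_mult[OF \<zeta>c])
  have opn: "open (- supp \<zeta>)" by (simp add: supp_def open_Compl)
  have zero: "dt ?F p = 0" if "p \<notin> \<Omega>" for p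
  proof -
    have "p \<in> - supp \<zeta>" using that \<zeta>(2) by auto
    then have "frechet_derivative ?F (at p) = frechet_derivative (\<lambda>_. 0) (at p)"
      by (rule frechet_derivative_cong_open[OF opn]) (simp add: notin_supp)
    then show ?thesis by (simp add: dt_def)
  qed
  have int0: "(\<integral>p. dt ?F p \<partial>?M) = 0"
    using integral_dt_eq_0(2)[OF Fs Fc] integral_eq_lebesgue_on[OF \<Omega>(2) zero] by simp
  have intF: "integrable ?M (dt ?F)"
  proof -
    have "\<Omega> \<inter> space lebesgue \<in> sets lebesgue" using \<Omega>(2) by simp
    from integrable_restrict_space[OF this, of "dt ?F"]
      integrable_mult_indicator[OF \<Omega>(2) integral_dt_eq_0(1)[OF Fs Fc]]
    show ?thesis by (rule iffD2)
  qed
  have eq: "dt ?F p = dt s p * (h (s p) * \<zeta> p) + H (s p) * dt \<zeta> p" if "p \<in> \<Omega>" for p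
    unfolding dt_def
    using frechet_derivative_compose_mult[OF H(2) smooth_on_differentiable[OF s(1) that], of \<zeta> "(1, 0)"]
      smooth_on_differentiable[OF \<zeta>sm] by simp
  have int1: "integrable ?M (\<lambda>p. dt s p * (h (s p) * \<zeta> p))"
  proof (rule Bochner_Integration.integrable_bound)
    show "integrable ?M (\<lambda>p. 2 * dt s p)" using s(2) by simp
    have "(\<lambda>p. h (s p)) \<in> borel_measurable ?M"
      by (intro measurable_compose[OF smooth_on_measurable(1)[OF \<Omega>(2) s(1)]] borel_measurable_continuous_onI h(1))
    moreover have "\<zeta> \<in> borel_measurable ?M"
      by (rule smooth_on_measurable(1)[OF \<Omega>(2) smooth_on_subset[OF \<zeta>sm]]) simp
    ultimately show "(\<lambda>p. dt s p * (h (s p) * \<zeta> p)) \<in> borel_measurable ?M" using s(2) by auto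
    have "\<bar>dt s p * (h (s p) * \<zeta> p)\<bar> \<le> \<bar>dt s p\<bar> * (2 * 1)" for p
      unfolding abs_mult using h(2) \<zeta>(3) \<zeta>0[of p] by (intro mult_mono) auto
    then show "AE p in ?M. norm (dt s p * (h (s p) * \<zeta> p)) \<le> norm (2 * dt s p)"
      by (auto simp: abs_mult mult.commute)
  qed
  have "integrable ?M (\<lambda>p. dt ?F p - dt s p * (h (s p) * \<zeta> p))" using intF int1 by simp
  then show int2: "integrable ?M (\<lambda>p. H (s p) * dt \<zeta> p)"
    by (rule Bochner_Integration.integrable_cong[THEN iffD1, rotated 2]) (auto simp: eq)
  have "(\<integral>p. dt ?F p \<partial>?M) = (\<integral>p. dt s p * (h (s p) * \<zeta> p) + H (s p) * dt \<zeta> p \<partial>?M)"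
    by (rule Bochner_Integration.integral_cong) (auto simp: eq)
  also have "\<dots> = (\<integral>p. dt s p * (h (s p) * \<zeta> p) \<partial>?M) + (\<integral>p. H (s p) * dt \<zeta> p \<partial>?M)"
    using int1 int2 by simp
  finally show "(\<integral>p. dt s p * (h (s p) * \<zeta> p) \<partial>?M) = - (\<integral>p. H (s p) * dt \<zeta> p \<partial>?M)"
    using int0 by simp
qed

section \<open>Representing sequences\<close>

lemma AE_lebesgue_on_elliptic_at:
  assumes "admissible_operator a A" "\<Omega> \<in> sets lebesgue"
  shows "AE p in lebesgue_on \<Omega>. p \<in> \<Omega> \<and> elliptic_at a A p"
  by (rule AE_lebesgue_onI[OF assms(2)]) (use AE_elliptic_at[OF assms(1)] in eventually_elim, simp)

lemma energy_form_measurable: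
  fixes f g :: "'n::finite pt \<Rightarrow> real"
  assumes "admissible_operator a A" "\<Omega> \<in> sets lebesgue" "smooth_on \<Omega> f" "smooth_on \<Omega> g"
  shows "energy_form a f g \<in> borel_measurable (lebesgue_on \<Omega>)"
proof -
  have "a i j \<in> borel_measurable (lebesgue_on \<Omega>)" for i j
    using assms(1) by (intro measurable_restrict_space1) (auto simp: admissible_operator_def)
  then show ?thesis unfolding energy_form_def[abs_def]
    by (intro borel_measurable_sum borel_measurable_times smooth_on_measurable(3) assms)
qed

lemma energy_form_integrable:
  fixes f g :: "'n::finite pt \<Rightarrow> real"
  assumes "admissible_operator a A" "\<Omega> \<in> sets lebesgue" "smooth_on \<Omega> f" "smooth_on \<Omega> g"
    and "integrable (lebesgue_on \<Omega>) (energy_form a f f)" "integrable (lebesgue_on \<Omega>) (energy_form a g g)"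
  shows "integrable (lebesgue_on \<Omega>) (energy_form a f g)"
proof (rule Bochner_Integration.integrable_bound)
  show "integrable (lebesgue_on \<Omega>) (\<lambda>p. energy_form a f f p + energy_form a g g p)"
    using assms by simp
  show "energy_form a f g \<in> borel_measurable (lebesgue_on \<Omega>)"
    by (rule energy_form_measurable[OF assms(1-4)])
  have "AE p in lebesgue_on \<Omega>. elliptic_at a A p"
    by (rule AE_lebesgue_onI[OF assms(2)]) (use AE_elliptic_at[OF assms(1)] in eventually_elim, simp)
  then show "AE p in lebesgue_on \<Omega>. norm (energy_form a f g p) \<le> norm (energy_form a f f p + energy_form a g g p)"
  proof eventually_elim
    case (elim p)
    show ?case using abs_energy_form_le[OF elim, of 1 f g] energy_form_nonneg[OF elim, of f] energy_form_nonneg[OF elim, of g]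
      by simp
  qed
qed

lemma W_smoothD:
  assumes "\<Omega> \<in> sets lebesgue" "w \<in> W_smooth a q \<Omega>" "1 < q"
  shows "smooth_on \<Omega> w" "integrable (lebesgue_on \<Omega>) (dt w)" "integrable (lebesgue_on \<Omega>) (energy_form a w w)"
    "integrable (lebesgue_on \<Omega>) (\<lambda>p. \<bar>w p\<bar> powr q)"
proof -
  have q: "qhat q = q" using assms(3) by (simp add: qhat_def)
  show sm: "smooth_on \<Omega> w" using assms by (simp add: W_smooth_def)
  have "integrable (lebesgue_on \<Omega>) (\<lambda>p. \<bar>dt w p\<bar>)"
    using assms by (simp add: W_smooth_def set_integral_eq_lebesgue_on)
  then show "integrable (lebesgue_on \<Omega>) (dt w)"
    using smooth_on_measurable(2)[OF assms(1) sm] by (rule Bochner_Integration.integrable_bound) simp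
  show "integrable (lebesgue_on \<Omega>) (energy_form a w w)" 
    "integrable (lebesgue_on \<Omega>) (\<lambda>p. \<bar>w p\<bar> powr q)"
    using assms by (simp_all add: W_smooth_def set_integral_eq_lebesgue_on q)
qed

lemma W_CauchyD:
  fixes s :: "nat \<Rightarrow> 'n::finite pt \<Rightarrow> real"
  assumes adm: "admissible_operator a A" and dom: "bounded_domain \<Omega>" and q: "1 < q"
    and s: "s \<in> W_Cauchy a q \<Omega>" and e: "\<epsilon> > 0"
  shows "\<exists>N. \<forall>k\<ge>N. \<forall>l\<ge>N. (\<integral>p. \<bar>dt (s k) p - dt (s l) p\<bar> \<partial>lebesgue_on \<Omega>) < \<epsilon> \<and>
     (\<integral>p. energy_form a (\<lambda>p. s k p - s l p) (\<lambda>p. s k p - s l p) p \<partial>lebesgue_on \<Omega>) < \<epsilon>"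
proof -
  note \<Omega> = bounded_domain_lmeasurable[OF dom]
  have sm: "smooth_on \<Omega> (s k)" for k using s by (simp add: W_Cauchy_def W_smooth_def)
  have d: "s k differentiable (at p)" if "p \<in> \<Omega>" for k p using smooth_on_differentiable[OF sm that] .
  obtain N where N: "\<forall>k\<ge>N. \<forall>l\<ge>N. W_norm a q \<Omega> (\<lambda>p. s k p - s l p) < min \<epsilon> (sqrt \<epsilon>)"
  proof -
    have "min \<epsilon> (sqrt \<epsilon>) > 0" using e by simp
    then show ?thesis using s that unfolding W_Cauchy_def by blast
  qed
  show ?thesis
  proof (intro exI[of _ N] allI impI)
    fix k l assume kl: "k \<ge> N" "l \<ge> N"
    let ?w = "\<lambda>p. s k p - s l p"
    have N': "W_norm a q \<Omega> ?w < \<epsilon>" "W_norm a q \<Omega> ?w < sqrt \<epsilon>" using N kl by auto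
    define T where "T = (\<integral>p. \<bar>dt ?w p\<bar> \<partial>lebesgue_on \<Omega>)"
    define E where "E = (\<integral>p. energy_form a ?w ?w p \<partial>lebesgue_on \<Omega>)"
    have "W_norm a q \<Omega> ?w = T + sqrt E + (LINT p:\<Omega>|lebesgue. \<bar>?w p\<bar> powr qhat q) powr (1 / qhat q)"
      unfolding W_norm_def T_def E_def using \<Omega> by (simp add: set_integral_eq_lebesgue_on)
    moreover have "0 \<le> T" unfolding T_def by simp
    moreover have E0: "0 \<le> E" unfolding E_def
      by (rule integral_nonneg_AE, rule AE_lebesgue_onI[OF \<Omega>(2)])
        (use AE_elliptic_at[OF adm] in eventually_elim, simp add: energy_form_nonneg)
    ultimately have "T < \<epsilon>" "sqrt E < sqrt \<epsilon>"
      using N' real_sqrt_ge_zero[OF E0] powr_ge_zero[of "LINT p:\<Omega>|lebesgue. \<bar>?w p\<bar> powr qhat q" "1 / qhat q"]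
      by linarith+
    moreover have "T = (\<integral>p. \<bar>dt (s k) p - dt (s l) p\<bar> \<partial>lebesgue_on \<Omega>)"
      unfolding T_def by (rule Bochner_Integration.integral_cong)
        (auto simp: dt_def frechet_derivative_diff_real d)
    ultimately show "(\<integral>p. \<bar>dt (s k) p - dt (s l) p\<bar> \<partial>lebesgue_on \<Omega>) < \<epsilon> \<and> (\<integral>p. energy_form a ?w ?w p \<partial>lebesgue_on \<Omega>) < \<epsilon>"
      by (simp add: E_def)
  qed
qed

lemma W_space_representative:
  fixes X :: "(nat \<Rightarrow> 'n::finite pt \<Rightarrow> real) set"
  assumes "X \<in> W_space a q \<Omega>" shows "\<exists>s\<in>X. s \<in> W_Cauchy a q \<Omega>"
proof -
  obtain s where s: "s \<in> W_Cauchy a q \<Omega>" "X = W_rel a q \<Omega> `` {s}"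
    using assms unfolding W_space_def quotient_def by blast
  have "dt (\<lambda>p::'n pt. 0) = (\<lambda>p. 0)" "dx i (\<lambda>p::'n pt. 0) = (\<lambda>p. 0)" for i
    by (auto simp: dt_def dx_def)
  then have "W_norm a q \<Omega> (\<lambda>p. s k p - s k p) = 0" for k
    by (simp add: W_norm_def energy_form_def set_lebesgue_integral_def)
  then show ?thesis using s by (auto simp: W_rel_def)
qed

lemma weak_solution_integrable:
  fixes u :: "'n::finite pt \<Rightarrow> real"
  assumes "weak_solution a q u" "1 < q" "bounded_domain \<Omega>"
  shows "integrable (lebesgue_on \<Omega>) (\<lambda>z. \<bar>u z\<bar> powr q)"
proof -
  have "\<exists>X. W_represents q \<Omega> X u" using assms(1,3) unfolding weak_solution_def by blast
  moreover have "qhat q = q" using assms(2) by (simp add: qhat_def)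
  ultimately show ?thesis
    using set_integral_eq_lebesgue_on(2)[OF bounded_domain_lmeasurable(2)[OF assms(3)], of "\<lambda>z. \<bar>u z\<bar> powr q"]
    by (auto simp: W_represents_def)
qed

section \<open>The nonlinear test function\<close>

text \<open>The weak inequality, tested with \<open>\<phi> k\<close>, involves the limits \<open>v\<close> and \<open>e\<close> of the time derivative and of the
  energy pairing along the representing sequence. Both may be replaced by their values at the
  same index \<open>k\<close>: the sequence is Cauchy in the energy seminorm, and the energies of the
  functions \<open>\<phi> k\<close> are bounded uniformly in \<open>k\<close>. The functional \<open>B\<close> stands for the reaction term.\<close>

lemma tested_inequality_eventually:
  fixes s :: "nat \<Rightarrow> 'n::finite pt \<Rightarrow> real" and h h' :: "real \<Rightarrow> real" and \<zeta> :: "'n pt \<Rightarrow> real"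
  defines "\<phi> k \<equiv> \<lambda>p. h (s k p) * \<zeta> p"
  assumes adm: "admissible_operator a A" and dom: "bounded_domain \<Omega>" and q: "1 < q"
    and s: "s \<in> W_Cauchy a q \<Omega>"
    and h: "smooth_on UNIV h" "\<And>r. (h has_real_derivative h' r) (at r)" "\<And>r. 0 \<le> h r" "\<And>r. h r \<le> 2"
      "\<And>r. \<bar>h' r\<bar> \<le> L"
    and \<zeta>: "test_function \<zeta>" "supp \<zeta> \<subseteq> \<Omega>" "\<And>p. \<zeta> p \<le> 1"
      "integrable (lebesgue_on \<Omega>) (energy_form a \<zeta> \<zeta>)"
    and sol: "\<And>\<phi>. test_function \<phi> \<Longrightarrow> supp \<phi> \<subseteq> \<Omega> \<Longrightarrow> \<exists>v e. integrable (lebesgue_on \<Omega>) v \<and>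
        (\<lambda>k. \<integral>p. \<bar>dt (s k) p - v p\<bar> \<partial>lebesgue_on \<Omega>) \<longlonglongrightarrow> 0 \<and>
        (\<lambda>k. \<integral>p. energy_form a \<phi> (s k) p \<partial>lebesgue_on \<Omega>) \<longlonglongrightarrow> e \<and>
        B \<phi> \<le> (\<integral>p. v p * \<phi> p \<partial>lebesgue_on \<Omega>) + e"
    and \<tau>: "\<tau> > 0"
  shows "\<exists>N. \<forall>k\<ge>N. B (\<phi> k) \<le> \<tau> + (\<integral>p. dt (s k) p * \<phi> k p \<partial>lebesgue_on \<Omega>)
     + (\<integral>p. energy_form a (\<phi> k) (s k) p \<partial>lebesgue_on \<Omega>)
     \<and> integrable (lebesgue_on \<Omega>) (energy_form a (\<phi> k) (s k))"
proof -
  note \<Omega> = bounded_domain_lmeasurable[OF dom]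
  let ?M = "lebesgue_on \<Omega>"
  let ?E = "\<lambda>f. \<integral>p. energy_form a f f p \<partial>?M"
  have sW: "s k \<in> W_smooth a q \<Omega>" for k using s by (simp add: W_Cauchy_def)
  note sD = W_smoothD[OF \<Omega>(2) sW q]
  have sd: "s k differentiable (at p)" if "p \<in> \<Omega>" for k p
    using smooth_on_differentiable[OF sD(1) that] .
  have \<zeta>sm: "smooth_on UNIV \<zeta>" and \<zeta>0: "\<And>p. 0 \<le> \<zeta> p" using \<zeta>(1) by (auto simp: test_function_def)
  have \<zeta>s\<Omega>: "smooth_on \<Omega> \<zeta>" by (rule smooth_on_subset[OF \<zeta>sm]) simp
  have \<zeta>d: "\<zeta> differentiable (at p)" for p using smooth_on_differentiable[OF \<zeta>sm] by simp
  have ell: "AE p in ?M. p \<in> \<Omega> \<and> elliptic_at a A p" by (rule AE_lebesgue_on_elliptic_at[OF adm \<Omega>(2)])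
  have En: "0 \<le> ?E f" for f
    by (rule integral_nonneg_AE, use ell in eventually_elim) (auto intro: energy_form_nonneg)
  have ml: "x * y \<le> c * \<bar>y\<bar>" if "\<bar>x\<bar> \<le> c" for x y c :: real
  proof -
    have "x * y \<le> \<bar>x\<bar> * \<bar>y\<bar>" by (simp add: abs_mult[symmetric])
    also have "\<dots> \<le> c * \<bar>y\<bar>" using that by (rule mult_right_mono) simp
    finally show ?thesis .
  qed
  have L0: "L \<ge> 0" using h(5)[of 0] by simp
  have test: "test_function (\<phi> k)" "supp (\<phi> k) \<subseteq> \<Omega>" for k
    unfolding \<phi>_def using test_function_compose_mult[OF \<Omega>(1) h(1,3) sD(1) \<zeta>(1,2)] by auto
  have \<phi>s: "smooth_on \<Omega> (\<phi> k)" for k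
    using test(1)[of k] smooth_on_subset[of UNIV "\<phi> k" \<Omega>] by (simp add: test_function_def)
  have \<phi>b: "0 \<le> \<phi> k p" "\<phi> k p \<le> 2" for k p
    using mult_mono[OF h(4) \<zeta>(3)[of p], of "s k p"] \<zeta>0[of p] h(3)[of "s k p"] by (auto simp: \<phi>_def)
  have \<phi>e: "energy_form a (\<phi> k) w p = h' (s k p) * \<zeta> p * energy_form a (s k) w p + h (s k p) * energy_form a \<zeta> w p"
    if "p \<in> \<Omega>" for k w p
    unfolding \<phi>_def by (rule energy_form_compose_mult[OF h(2) sd[OF that] \<zeta>d])
  have \<phi>E: "integrable ?M (energy_form a (\<phi> k) (\<phi> k))" for k
  proof (rule Bochner_Integration.integrable_bound)
    show "integrable ?M (\<lambda>p. 2 * L\<^sup>2 * energy_form a (s k) (s k) p + 8 * energy_form a \<zeta> \<zeta> p)"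
      using sD(3) \<zeta>(4) by simp
    show "energy_form a (\<phi> k) (\<phi> k) \<in> borel_measurable ?M"
      by (rule energy_form_measurable[OF adm \<Omega>(2) \<phi>s \<phi>s])
    show "AE p in ?M. norm (energy_form a (\<phi> k) (\<phi> k) p) \<le> norm (2 * L\<^sup>2 * energy_form a (s k) (s k) p + 8 * energy_form a \<zeta> \<zeta> p)"
      using ell
    proof eventually_elim
      case (elim p)
      then have p: "p \<in> \<Omega>" and el: "elliptic_at a A p" by auto
      have "energy_form a (\<phi> k) (\<phi> k) p \<le> 2 * (h' (s k p) * \<zeta> p)\<^sup>2 * energy_form a (s k) (s k) p + 2 * (h (s k p))\<^sup>2 * energy_form a \<zeta> \<zeta> p"
        by (rule energy_form_combination[OF el])
          (simp add: dx_def \<phi>_def frechet_derivative_compose_mult[OF h(2) sd[OF p] \<zeta>d])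
      also have "\<dots> \<le> 2 * L\<^sup>2 * energy_form a (s k) (s k) p + 2 * 2\<^sup>2 * energy_form a \<zeta> \<zeta> p"
      proof (intro add_mono mult_right_mono mult_left_mono energy_form_nonneg[OF el])
        have "\<bar>h' (s k p) * \<zeta> p\<bar> \<le> L * 1"
          unfolding abs_mult using h(5) \<zeta>(3) \<zeta>0[of p] L0 by (intro mult_mono) auto
        then show "(h' (s k p) * \<zeta> p)\<^sup>2 \<le> L\<^sup>2" using L0 abs_le_square_iff[of "h' (s k p) * \<zeta> p" L] by simp
        show "(h (s k p))\<^sup>2 \<le> 2\<^sup>2" using h(3,4) by (intro power_mono) auto
      qed auto
      finally show ?case using energy_form_nonneg[OF el, of "\<phi> k"] by simp
    qed
  qed
  have \<phi>sE: "integrable ?M (energy_form a (\<phi> k) (s l))" for k l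
    by (rule energy_form_integrable[OF adm \<Omega>(2) \<phi>s sD(1) \<phi>E sD(3)])
  have diff_sm: "smooth_on \<Omega> (\<lambda>p. s k p - s l p)" for k l
    by (intro smooth_on_diff \<Omega>(1) sD(1))
  have diffE: "integrable ?M (energy_form a (\<lambda>p. s k p - s l p) (\<lambda>p. s k p - s l p))" for k l
  proof (rule Bochner_Integration.integrable_bound)
    show "integrable ?M (\<lambda>p. 2 * energy_form a (s k) (s k) p + 2 * energy_form a (s l) (s l) p)"
      using sD(3) by simp
    show "energy_form a (\<lambda>p. s k p - s l p) (\<lambda>p. s k p - s l p) \<in> borel_measurable ?M"
      by (rule energy_form_measurable[OF adm \<Omega>(2) diff_sm diff_sm])
    show "AE p in ?M. norm (energy_form a (\<lambda>p. s k p - s l p) (\<lambda>p. s k p - s l p) p)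
        \<le> norm (2 * energy_form a (s k) (s k) p + 2 * energy_form a (s l) (s l) p)"
      using ell
    proof eventually_elim
      case (elim p)
      then have p: "p \<in> \<Omega>" and el: "elliptic_at a A p" by auto
      show ?case
        using energy_form_diff_le[OF el sd[OF p] sd[OF p], of k l] energy_form_nonneg[OF el, of "\<lambda>p. s k p - s l p"]
        by simp
    qed
  qed
  \<comment> \<open>The weight \<open>l0\<close> makes the part of Young's inequality with the energies of \<open>s k\<close> and \<open>\<zeta>\<close> at most
    \<open>\<tau> / 4\<close>. Afterwards \<open>\<delta>\<close> does the same for the part with the energy of \<open>s l - s k\<close>.\<close>
  obtain N0 where N0: "\<forall>k\<ge>N0. \<forall>l\<ge>N0. ?E (\<lambda>p. s k p - s l p) < 1"
    using W_CauchyD[OF adm dom q s, of 1] by auto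
  define M0 where "M0 = 2 + 2 * ?E (s N0)"
  have M0: "?E (s k) \<le> M0" if "k \<ge> N0" for k
  proof -
    have "?E (s k) \<le> (\<integral>p. 2 * energy_form a (\<lambda>p. s k p - s N0 p) (\<lambda>p. s k p - s N0 p) p + 2 * energy_form a (s N0) (s N0) p \<partial>?M)"
    proof (rule integral_mono_AE)
      show "AE p in ?M. energy_form a (s k) (s k) p \<le> 2 * energy_form a (\<lambda>p. s k p - s N0 p) (\<lambda>p. s k p - s N0 p) p + 2 * energy_form a (s N0) (s N0) p"
        using ell
      proof eventually_elim
        case (elim p)
        then show ?case using energy_form_le_diff[of a A p "s k" "s N0"] sd by auto
      qed
    qed (use sD(3) diffE in auto)
    also have "\<dots> = 2 * ?E (\<lambda>p. s k p - s N0 p) + 2 * ?E (s N0)" using sD(3) diffE by simp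
    finally have "?E (s k) \<le> 2 * ?E (\<lambda>p. s k p - s N0 p) + 2 * ?E (s N0)" .
    moreover have "?E (\<lambda>p. s k p - s N0 p) < 1" using N0 that by blast
    ultimately show ?thesis unfolding M0_def by linarith
  qed
  define K where "K = (L + 2) * (M0 + ?E \<zeta> + 1)"
  have K: "K > 0" unfolding K_def M0_def using L0 En[of "s N0"] En[of \<zeta>] by (intro mult_pos_pos) auto
  define l0 where "l0 = \<tau> / (2 * K)"
  have l0: "l0 > 0" using \<tau> K by (simp add: l0_def)
  define \<delta> where "\<delta> = l0 * \<tau> / (4 * (L + 2))"
  have \<delta>: "\<delta> > 0" using l0 \<tau> L0 by (simp add: \<delta>_def)
  obtain N1 where N1: "\<forall>k\<ge>N1. \<forall>l\<ge>N1. ?E (\<lambda>p. s k p - s l p) < \<delta>"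
    using W_CauchyD[OF adm dom q s \<delta>] by auto
  obtain N2 where N2: "\<forall>k\<ge>N2. \<forall>l\<ge>N2. (\<integral>p. \<bar>dt (s k) p - dt (s l) p\<bar> \<partial>?M) < \<tau> / 8"
    using W_CauchyD[OF adm dom q s, of "\<tau> / 8"] \<tau> by auto
  define N where "N = max N0 (max N1 N2)"
  show ?thesis
  proof (intro exI[of _ N] allI impI conjI \<phi>sE)
    fix k assume "k \<ge> N"
    then have kN: "k \<ge> N0" "k \<ge> N1" "k \<ge> N2" by (auto simp: N_def)
    obtain v e where v: "integrable ?M v" and vl: "(\<lambda>k. \<integral>p. \<bar>dt (s k) p - v p\<bar> \<partial>?M) \<longlonglongrightarrow> 0"
      and el: "(\<lambda>l. \<integral>p. energy_form a (\<phi> k) (s l) p \<partial>?M) \<longlonglongrightarrow> e"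
      and B: "B (\<phi> k) \<le> (\<integral>p. v p * \<phi> k p \<partial>?M) + e"
      using sol[OF test(1)[of k] test(2)[of k]] by blast
    have "e \<le> (\<integral>p. energy_form a (\<phi> k) (s k) p \<partial>?M) + \<tau> / 2"
    proof (rule LIMSEQ_le_const2[OF el], intro exI[of _ N1] allI impI)
      fix l assume l: "l \<ge> N1"
      let ?w = "\<lambda>p. s l p - s k p"
      let ?c = "(L + 2) / 2"
      have "(\<integral>p. energy_form a (\<phi> k) (s l) p \<partial>?M) \<le> (\<integral>p. energy_form a (\<phi> k) (s k) p
         + ?c * (l0 * (energy_form a (s k) (s k) p + energy_form a \<zeta> \<zeta> p) + 2 * (energy_form a ?w ?w p / l0)) \<partial>?M)"
      proof (rule integral_mono_AE)
        show "integrable ?M (\<lambda>p. energy_form a (\<phi> k) (s k) p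
         + ?c * (l0 * (energy_form a (s k) (s k) p + energy_form a \<zeta> \<zeta> p) + 2 * (energy_form a ?w ?w p / l0)))"
          using \<phi>sE sD(3) \<zeta>(4) diffE by (intro Bochner_Integration.integrable_add integrable_mult_right integrable_divide) auto
        show "AE p in ?M. energy_form a (\<phi> k) (s l) p \<le> energy_form a (\<phi> k) (s k) p
         + ?c * (l0 * (energy_form a (s k) (s k) p + energy_form a \<zeta> \<zeta> p) + 2 * (energy_form a ?w ?w p / l0))"
          using ell
        proof eventually_elim
          case (elim p)
          then have p: "p \<in> \<Omega>" and elp: "elliptic_at a A p" by auto
          have "energy_form a (\<phi> k) (s l) p - energy_form a (\<phi> k) (s k) p = energy_form a (\<phi> k) ?w p"
            by (simp add: energy_form_diff_right[OF sd[OF p] sd[OF p]])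
          also have "\<dots> = (h' (s k p) * \<zeta> p) * energy_form a (s k) ?w p + h (s k p) * energy_form a \<zeta> ?w p"
            by (rule \<phi>e[OF p])
          also have "\<dots> \<le> (L + 2) * \<bar>energy_form a (s k) ?w p\<bar> + (L + 2) * \<bar>energy_form a \<zeta> ?w p\<bar>"
          proof (rule add_mono)
            have x: "\<bar>h' (s k p) * \<zeta> p\<bar> \<le> (L + 2) * 1"
              unfolding abs_mult using order_trans[OF h(5), of "L + 2"] \<zeta>(3) \<zeta>0[of p] L0 by (intro mult_mono) auto
            have y: "\<bar>h (s k p)\<bar> \<le> L + 2" using h(3,4)[of "s k p"] L0 by simp
            show "(h' (s k p) * \<zeta> p) * energy_form a (s k) ?w p \<le> (L + 2) * \<bar>energy_form a (s k) ?w p\<bar>"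
              by (rule ml) (use x in simp)
            show "h (s k p) * energy_form a \<zeta> ?w p \<le> (L + 2) * \<bar>energy_form a \<zeta> ?w p\<bar>"
              by (rule ml[OF y])
          qed
          also have "\<dots> = ?c * (2 * \<bar>energy_form a (s k) ?w p\<bar> + 2 * \<bar>energy_form a \<zeta> ?w p\<bar>)"
            by (simp add: field_simps)
          also have "\<dots> \<le> ?c * ((l0 * energy_form a (s k) (s k) p + energy_form a ?w ?w p / l0)
               + (l0 * energy_form a \<zeta> \<zeta> p + energy_form a ?w ?w p / l0))"
            using L0 by (intro mult_left_mono add_mono abs_energy_form_le[OF elp l0]) auto
          also have "\<dots> = ?c * (l0 * (energy_form a (s k) (s k) p + energy_form a \<zeta> \<zeta> p) + 2 * (energy_form a ?w ?w p / l0))"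
            by (simp add: algebra_simps)
          finally show ?case by (simp only: diff_le_eq add.commute)
        qed
      qed (rule \<phi>sE)
      also have "\<dots> = (\<integral>p. energy_form a (\<phi> k) (s k) p \<partial>?M)
           + ?c * (l0 * (?E (s k) + ?E \<zeta>) + 2 * (?E ?w / l0))"
        using \<phi>sE sD(3) \<zeta>(4) diffE by simp
      also have "?c * (l0 * (?E (s k) + ?E \<zeta>) + 2 * (?E ?w / l0)) \<le> ?c * (l0 * (M0 + ?E \<zeta> + 1) + 2 * (\<delta> / l0))"
      proof -
        have 1: "?E (s k) + ?E \<zeta> \<le> M0 + ?E \<zeta> + 1" using M0[OF kN(1)] by linarith
        have "?E ?w < \<delta>" using N1 l kN(2) by blast
        then have 2: "?E ?w / l0 \<le> \<delta> / l0" using l0 by (intro divide_right_mono) auto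
        show ?thesis
          by (intro mult_left_mono add_mono[OF mult_left_mono[OF 1] mult_left_mono[OF 2]]) (use L0 l0 in auto)
      qed
      also have "\<dots> = \<tau> / 2"
      proof -
        have "?c * (l0 * (M0 + ?E \<zeta> + 1)) = l0 * K / 2" by (simp add: K_def)
        also have "\<dots> = \<tau> / 4" using K by (simp add: l0_def)
        finally have 1: "?c * (l0 * (M0 + ?E \<zeta> + 1)) = \<tau> / 4" .
        have 2: "?c * (2 * (\<delta> / l0)) = \<tau> / 4" 
        proof -
          have "\<delta> / l0 = \<tau> / (4 * (L + 2))" using l0 by (simp add: \<delta>_def)
          moreover have "x / 2 * (2 * (\<tau> / (4 * x))) = \<tau> / 4" if "x \<noteq> 0" for x using that by simp
          moreover have "L + 2 \<noteq> 0" using L0 by simp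
          ultimately show ?thesis by (simp only:)
        qed
        show ?thesis unfolding distrib_left[of ?c] 1 2 by simp
      qed
      finally show "(\<integral>p. energy_form a (\<phi> k) (s l) p \<partial>?M) \<le> (\<integral>p. energy_form a (\<phi> k) (s k) p \<partial>?M) + \<tau> / 2" by simp
    qed
    moreover have "(\<integral>p. v p * \<phi> k p \<partial>?M) \<le> (\<integral>p. dt (s k) p * \<phi> k p \<partial>?M) + \<tau> / 2"
    proof -
      have dv: "(\<integral>p. \<bar>dt (s k) p - v p\<bar> \<partial>?M) \<le> \<tau> / 8"
      proof (rule LIMSEQ_le_const)
        show "(\<lambda>l. \<tau> / 8 + (\<integral>p. \<bar>dt (s l) p - v p\<bar> \<partial>?M)) \<longlonglongrightarrow> \<tau> / 8"
          using tendsto_add[OF tendsto_const vl, of "\<tau> / 8"] by simp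
        show "\<exists>N. \<forall>l\<ge>N. (\<integral>p. \<bar>dt (s k) p - v p\<bar> \<partial>?M) \<le> \<tau> / 8 + (\<integral>p. \<bar>dt (s l) p - v p\<bar> \<partial>?M)"
        proof (intro exI[of _ N2] allI impI)
          fix l assume l: "l \<ge> N2"
          have "(\<integral>p. \<bar>dt (s k) p - v p\<bar> \<partial>?M) \<le> (\<integral>p. \<bar>dt (s k) p - dt (s l) p\<bar> + \<bar>dt (s l) p - v p\<bar> \<partial>?M)"
            using sD(2) v by (intro integral_mono) auto
          also have "\<dots> = (\<integral>p. \<bar>dt (s k) p - dt (s l) p\<bar> \<partial>?M) + (\<integral>p. \<bar>dt (s l) p - v p\<bar> \<partial>?M)"
            using sD(2) v by (intro Bochner_Integration.integral_add) auto
          finally have "(\<integral>p. \<bar>dt (s k) p - v p\<bar> \<partial>?M) \<le> (\<integral>p. \<bar>dt (s k) p - dt (s l) p\<bar> \<partial>?M) + (\<integral>p. \<bar>dt (s l) p - v p\<bar> \<partial>?M)" .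
          moreover have "(\<integral>p. \<bar>dt (s k) p - dt (s l) p\<bar> \<partial>?M) < \<tau> / 8" using N2 l kN(3) by blast
          ultimately show "(\<integral>p. \<bar>dt (s k) p - v p\<bar> \<partial>?M) \<le> \<tau> / 8 + (\<integral>p. \<bar>dt (s l) p - v p\<bar> \<partial>?M)"
            by linarith
        qed
      qed
      have \<phi>m: "\<phi> k \<in> borel_measurable ?M" by (rule smooth_on_measurable(1)[OF \<Omega>(2) \<phi>s])
      have im: "integrable ?M (\<lambda>p. f p * \<phi> k p)" if "integrable ?M f" for f
      proof (rule Bochner_Integration.integrable_bound)
        show "integrable ?M (\<lambda>p. 2 * f p)" using that by simp
        show "(\<lambda>p. f p * \<phi> k p) \<in> borel_measurable ?M" using that \<phi>m by auto
        show "AE p in ?M. norm (f p * \<phi> k p) \<le> norm (2 * f p)"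
          using \<phi>b by (auto simp: abs_mult mult.commute[of 2] intro!: mult_left_mono)
      qed
      have "(\<integral>p. v p * \<phi> k p \<partial>?M) \<le> (\<integral>p. dt (s k) p * \<phi> k p + 2 * \<bar>dt (s k) p - v p\<bar> \<partial>?M)"
      proof (rule integral_mono)
        fix p
        have "(v p - dt (s k) p) * \<phi> k p \<le> \<bar>dt (s k) p - v p\<bar> * 2"
          using \<phi>b[of k p] by (intro mult_mono) auto
        then show "v p * \<phi> k p \<le> dt (s k) p * \<phi> k p + 2 * \<bar>dt (s k) p - v p\<bar>"
          by (simp add: algebra_simps)
      qed (use im[OF v] im[OF sD(2)] sD(2) v in auto)
      also have "\<dots> = (\<integral>p. dt (s k) p * \<phi> k p \<partial>?M) + 2 * (\<integral>p. \<bar>dt (s k) p - v p\<bar> \<partial>?M)"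
        using im[OF sD(2), of k] sD(2) v by simp
      finally show ?thesis using dv \<tau> by simp
    qed
    ultimately show "B (\<phi> k) \<le> \<tau> + (\<integral>p. dt (s k) p * \<phi> k p \<partial>?M) + (\<integral>p. energy_form a (\<phi> k) (s k) p \<partial>?M)"
      using B by simp
  qed
qed

text \<open>
  The gradient of \<open>u\<close> is eliminated altogether. The bound \<open>g\<close> plays the role of both \<open>|\<zeta>\<^sub>t|\<close> and
  \<open>\<langle>\<nabla>\<zeta>, \<nabla>\<zeta>\<rangle> / \<zeta>\<close>. The approximants may be negative somewhere, which is why the profile is
  controlled on the whole real line and not only for non-negative arguments.
\<close>

lemma weak_solution_estimate:
  fixes u \<zeta> g :: "'n::finite pt \<Rightarrow> real" and H h h' :: "real \<Rightarrow> real" and a :: "'n coeffs"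
    and p q \<epsilon> C K :: real
  assumes pq: "1 < p" "p < q" and adm: "admissible_operator a A" and sol: "weak_solution a q u"
    and u0: "AE z in lebesgue. u z \<ge> 0" and dom: "bounded_domain \<Omega>"
    and \<zeta>: "test_function \<zeta>" "supp \<zeta> \<subseteq> \<Omega>" "\<And>z. \<zeta> z \<le> 1"
    and g: "g \<in> borel_measurable lebesgue" "\<And>z. 0 \<le> g z" "\<And>z. g z \<le> K"
    and dt\<zeta>: "AE z in lebesgue. \<bar>dt \<zeta> z\<bar> \<le> g z"
    and en\<zeta>: "AE z in lebesgue. energy_form a \<zeta> \<zeta> z \<le> g z * \<zeta> z"
    and \<epsilon>: "\<epsilon> > 0" and C: "C > 0"
    and prof: "concave_profile (\<lambda>r. C * (\<epsilon> * (1 + \<bar>r / \<epsilon>\<bar> powr p))) L H h h'"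
  shows "(\<integral>z. \<bar>u z\<bar> powr q * \<zeta> z \<partial>lebesgue_on \<Omega>)
    \<le> (C + 2) * (2 powr p * (\<integral>z. g z * (\<epsilon> * (1 + \<bar>u z / \<epsilon>\<bar> powr p)) \<partial>lebesgue_on \<Omega>))"
proof -
  have H: "smooth_on UNIV H" "\<And>r. (H has_real_derivative h r) (at r)" "\<And>r. \<bar>H r\<bar> \<le> 2 * \<bar>r\<bar>"
    and h: "smooth_on UNIV h" "\<And>r. (h has_real_derivative h' r) (at r)" "\<And>r. 1 \<le> h r" "\<And>r. h r \<le> 2"
    and h': "\<And>r. - L \<le> h' r" "\<And>r. h' r \<le> 0" "\<And>r. 1 \<le> - h' r * (C * (\<epsilon> * (1 + \<bar>r / \<epsilon>\<bar> powr p)))"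
    using prof unfolding concave_profile_def by blast+
  note \<Omega> = bounded_domain_lmeasurable[OF dom]
  let ?M = "lebesgue_on \<Omega>"
  interpret finite_measure ?M by (rule finite_measure_lebesgue_on[OF \<Omega>(3)])
  have q: "1 < q" using pq by simp
  have qh: "qhat q = q" using q by (simp add: qhat_def)
  have "\<exists>X \<in> W_space a q \<Omega>. W_represents q \<Omega> X u \<and>
         (\<forall>\<phi>. test_function \<phi> \<and> supp \<phi> \<subseteq> \<Omega> \<longrightarrow>
           (\<exists>v e. W_time_deriv \<Omega> X v \<and> W_energy_pairing a \<Omega> \<phi> X e \<and>
              (LINT p:\<Omega>|lebesgue. v p * \<phi> p) + e
              - (LINT p|lebesgue. \<bar>u p\<bar> powr (q - 1) * u p * \<phi> p) \<ge> 0))"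
    by (rule sol[unfolded weak_solution_def, THEN conjunct2, rule_format, OF dom])
  then obtain X where X: "X \<in> W_space a q \<Omega>" "W_represents q \<Omega> X u"
    and Xt: "\<forall>\<phi>. test_function \<phi> \<and> supp \<phi> \<subseteq> \<Omega> \<longrightarrow>
           (\<exists>v e. W_time_deriv \<Omega> X v \<and> W_energy_pairing a \<Omega> \<phi> X e \<and>
              (LINT p:\<Omega>|lebesgue. v p * \<phi> p) + e
              - (LINT p|lebesgue. \<bar>u p\<bar> powr (q - 1) * u p * \<phi> p) \<ge> 0)"
    by (elim bexE conjE)
  obtain s where sX: "s \<in> X" and s: "s \<in> W_Cauchy a q \<Omega>" using W_space_representative[OF X(1)] by blast
  have sW: "s k \<in> W_smooth a q \<Omega>" for k using s by (simp add: W_Cauchy_def)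
  note sD = W_smoothD[OF \<Omega>(2) sW q]
  have sd: "s k differentiable (at z)" if "z \<in> \<Omega>" for k z
    using smooth_on_differentiable[OF sD(1) that] .
  have sm: "s k \<in> borel_measurable ?M" for k by (rule smooth_on_measurable(1)[OF \<Omega>(2) sD(1)])
  have um: "u \<in> borel_measurable ?M" using sol by (intro measurable_restrict_space1) (simp add: weak_solution_def)
  have ui: "integrable ?M (\<lambda>z. \<bar>u z\<bar> powr q)"
    using X(2) by (simp add: W_represents_def qh set_integral_eq_lebesgue_on[OF \<Omega>(2)])
  have lim: "(\<lambda>k. \<integral>z. \<bar>s k z - u z\<bar> powr q \<partial>?M) \<longlonglongrightarrow> 0"
    using X(2) sX by (simp add: W_represents_def qh set_integral_eq_lebesgue_on[OF \<Omega>(2)])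
  have di: "integrable ?M (\<lambda>z. \<bar>s k z - u z\<bar> powr q)" for k
  proof (rule Bochner_Integration.integrable_bound)
    show "integrable ?M (\<lambda>z. 2 powr q * (\<bar>s k z\<bar> powr q + \<bar>u z\<bar> powr q))" using sD(4) ui by simp
    show "(\<lambda>z. \<bar>s k z - u z\<bar> powr q) \<in> borel_measurable ?M" using sm um by measurable
    show "AE z in ?M. norm (\<bar>s k z - u z\<bar> powr q) \<le> norm (2 powr q * (\<bar>s k z\<bar> powr q + \<bar>u z\<bar> powr q))"
      using powr_abs_add_le[of q "s k _" "- u _"] q by simp
  qed
  have \<zeta>sm: "smooth_on UNIV \<zeta>" and \<zeta>0: "\<And>z. 0 \<le> \<zeta> z" using \<zeta>(1) by (auto simp: test_function_def)
  have \<zeta>s\<Omega>: "smooth_on \<Omega> \<zeta>" by (rule smooth_on_subset[OF \<zeta>sm]) simp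
  have \<zeta>d: "\<zeta> differentiable (at z)" for z using smooth_on_differentiable[OF \<zeta>sm] by simp
  have \<zeta>m: "\<zeta> \<in> borel_measurable ?M" by (rule smooth_on_measurable(1)[OF \<Omega>(2) \<zeta>s\<Omega>])
  have ell: "AE z in ?M. z \<in> \<Omega> \<and> elliptic_at a A z" by (rule AE_lebesgue_on_elliptic_at[OF adm \<Omega>(2)])
  have u0': "AE z in ?M. u z \<ge> 0" by (rule AE_lebesgue_onI[OF \<Omega>(2)]) (use u0 in eventually_elim, simp)
  have dt\<zeta>': "AE z in ?M. \<bar>dt \<zeta> z\<bar> \<le> g z" by (rule AE_lebesgue_onI[OF \<Omega>(2)]) (use dt\<zeta> in eventually_elim, simp)
  have en\<zeta>': "AE z in ?M. energy_form a \<zeta> \<zeta> z \<le> g z * \<zeta> z"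
    by (rule AE_lebesgue_onI[OF \<Omega>(2)]) (use en\<zeta> in eventually_elim, simp)
  have gm: "g \<in> borel_measurable ?M" using g(1) by (rule measurable_restrict_space1)
  have K0: "0 \<le> K" using g(2,3) order_trans by blast
  have \<zeta>E: "integrable ?M (energy_form a \<zeta> \<zeta>)"
  proof (rule integrable_const_bound[of _ K])
    show "energy_form a \<zeta> \<zeta> \<in> borel_measurable ?M"
      by (rule energy_form_measurable[OF adm \<Omega>(2) \<zeta>s\<Omega> \<zeta>s\<Omega>])
    show "AE z in ?M. norm (energy_form a \<zeta> \<zeta> z) \<le> K"
      using ell en\<zeta>'
    proof eventually_elim
      case (elim z)
      have "g z * \<zeta> z \<le> K * 1" using g(2,3) \<zeta>(3) \<zeta>0 K0 by (intro mult_mono) auto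
      then show ?case using elim energy_form_nonneg[of a A z \<zeta>] by simp
    qed
  qed
  let ?B = "\<lambda>\<phi>. LINT z|lebesgue. \<bar>u z\<bar> powr (q - 1) * u z * \<phi> z"
  have sol': "\<exists>v e. integrable ?M v \<and> (\<lambda>k. \<integral>z. \<bar>dt (s k) z - v z\<bar> \<partial>?M) \<longlonglongrightarrow> 0 \<and>
        (\<lambda>k. \<integral>z. energy_form a \<phi> (s k) z \<partial>?M) \<longlonglongrightarrow> e \<and> ?B \<phi> \<le> (\<integral>z. v z * \<phi> z \<partial>?M) + e"
    if tst: "test_function \<phi>" "supp \<phi> \<subseteq> \<Omega>" for \<phi>
  proof -
    obtain v e where "W_time_deriv \<Omega> X v" "W_energy_pairing a \<Omega> \<phi> X e"
      and b: "(LINT p:\<Omega>|lebesgue. v p * \<phi> p) + e - ?B \<phi> \<ge> 0"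
      using Xt[rule_format, OF conjI[OF tst]] by (elim exE conjE)
    then have "integrable ?M v" "(\<lambda>k. \<integral>z. \<bar>dt (s k) z - v z\<bar> \<partial>?M) \<longlonglongrightarrow> 0"
      "(\<lambda>k. \<integral>z. energy_form a \<phi> (s k) z \<partial>?M) \<longlonglongrightarrow> e"
      using sX by (auto simp: W_time_deriv_def W_energy_pairing_def set_integral_eq_lebesgue_on[OF \<Omega>(2)])
    moreover have "?B \<phi> \<le> (\<integral>z. v z * \<phi> z \<partial>?M) + e"
      using b by (simp add: set_integral_eq_lebesgue_on[OF \<Omega>(2)])
    ultimately show ?thesis by blast
  qed
  define \<Theta> where "\<Theta> r = \<epsilon> * (1 + \<bar>r / \<epsilon>\<bar> powr p)" for r :: real
  have \<Theta>0: "0 \<le> \<Theta> r" for r unfolding \<Theta>_def using \<epsilon> by simp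
  have r\<Theta>: "\<bar>r\<bar> \<le> \<Theta> r" for r
  proof -
    have "\<bar>r\<bar> = \<epsilon> * \<bar>r / \<epsilon>\<bar>" using \<epsilon> by simp
    also have "\<dots> \<le> \<Theta> r" unfolding \<Theta>_def using \<epsilon> pq by (intro mult_left_mono le_one_add_powr) auto
    finally show ?thesis .
  qed
  have dpowr: "\<bar>r / \<epsilon>\<bar> powr q = \<epsilon> powr (- q) * \<bar>r\<bar> powr q" for r
  proof -
    have "\<bar>r / \<epsilon>\<bar> = \<bar>r\<bar> / \<epsilon>" using \<epsilon> by simp
    then show ?thesis using \<epsilon> by (simp add: powr_divide powr_minus_divide)
  qed
  have \<Theta>i: "integrable ?M (\<lambda>z. g z * \<Theta> (f z))"
    if f: "f \<in> borel_measurable ?M" "integrable ?M (\<lambda>z. \<bar>f z\<bar> powr q)" for f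
  proof -
    obtain c where c: "c > 0" "\<forall>x\<ge>0. x powr p \<le> 1 + c * x powr q"
      using powr_le_const_add[of p q 1] pq by auto
    show ?thesis
    proof (rule Bochner_Integration.integrable_bound)
      show "integrable ?M (\<lambda>z. K * (\<epsilon> * (1 + (1 + c * (\<epsilon> powr (- q) * \<bar>f z\<bar> powr q)))))"
        using f(2) by simp
      show "(\<lambda>z. g z * \<Theta> (f z)) \<in> borel_measurable ?M" unfolding \<Theta>_def using f(1) gm by measurable
      show "AE z in ?M. norm (g z * \<Theta> (f z)) \<le> norm (K * (\<epsilon> * (1 + (1 + c * (\<epsilon> powr (- q) * \<bar>f z\<bar> powr q)))))"
      proof (rule AE_I2)
        fix z
        have "\<bar>f z / \<epsilon>\<bar> powr p \<le> 1 + c * (\<epsilon> powr (- q) * \<bar>f z\<bar> powr q)"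
          using c(2)[rule_format, of "\<bar>f z / \<epsilon>\<bar>"] unfolding dpowr by simp
        then have "g z * \<Theta> (f z) \<le> K * (\<epsilon> * (1 + (1 + c * (\<epsilon> powr (- q) * \<bar>f z\<bar> powr q))))"
          unfolding \<Theta>_def using g(2,3) \<epsilon> K0 by (intro mult_mono mult_left_mono add_left_mono) auto
        then show "norm (g z * \<Theta> (f z)) \<le> norm (K * (\<epsilon> * (1 + (1 + c * (\<epsilon> powr (- q) * \<bar>f z\<bar> powr q)))))"
          unfolding real_norm_def abs_of_nonneg[OF mult_nonneg_nonneg[OF g(2) \<Theta>0]]
          by (rule order_trans[OF _ abs_ge_self])
      qed
    qed
  qed
  have \<Theta>s: "integrable ?M (\<lambda>z. g z * \<Theta> (s k z))" for k by (rule \<Theta>i[OF sm sD(4)])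
  have \<Theta>u: "integrable ?M (\<lambda>z. g z * \<Theta> (u z))" by (rule \<Theta>i[OF um ui])
  \<comment> \<open>Since \<open>h \<ge> 1\<close>, the reaction term needs no passage to the limit.\<close>
  have uzi: "integrable ?M (\<lambda>z. \<bar>u z\<bar> powr q * \<zeta> z)"
  proof (rule Bochner_Integration.integrable_bound[OF ui])
    show "(\<lambda>z. \<bar>u z\<bar> powr q * \<zeta> z) \<in> borel_measurable ?M" using um \<zeta>m by measurable
    show "AE z in ?M. norm (\<bar>u z\<bar> powr q * \<zeta> z) \<le> norm (\<bar>u z\<bar> powr q)"
      using \<zeta>0 \<zeta>(3) by (auto simp: abs_mult intro!: mult_left_le)
  qed
  have hm: "h \<in> borel_measurable borel" by (rule borel_measurable_continuous_onI[OF smooth_on_continuous[OF h(1)]])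
  have lower: "(\<integral>z. \<bar>u z\<bar> powr q * \<zeta> z \<partial>?M) \<le> ?B (\<lambda>z. h (s k z) * \<zeta> z)" for k
  proof -
    have "(\<integral>z. \<bar>u z\<bar> powr q * \<zeta> z \<partial>?M) \<le> (\<integral>z. \<bar>u z\<bar> powr q * (h (s k z) * \<zeta> z) \<partial>?M)"
    proof (rule integral_mono[OF uzi])
      show "integrable ?M (\<lambda>z. \<bar>u z\<bar> powr q * (h (s k z) * \<zeta> z))"
      proof (rule Bochner_Integration.integrable_bound)
        show "integrable ?M (\<lambda>z. 2 * (\<bar>u z\<bar> powr q * \<zeta> z))" using uzi by simp
        have "(\<lambda>z. h (s k z)) \<in> borel_measurable ?M" by (rule measurable_compose[OF sm hm])
        then show "(\<lambda>z. \<bar>u z\<bar> powr q * (h (s k z) * \<zeta> z)) \<in> borel_measurable ?M" using um \<zeta>m by measurable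
        show "AE z in ?M. norm (\<bar>u z\<bar> powr q * (h (s k z) * \<zeta> z)) \<le> norm (2 * (\<bar>u z\<bar> powr q * \<zeta> z))"
        proof (rule AE_I2)
          fix z
          have "h (s k z) * (\<bar>u z\<bar> powr q * \<zeta> z) \<le> 2 * (\<bar>u z\<bar> powr q * \<zeta> z)"
            using h(4) \<zeta>0 by (intro mult_right_mono) auto
          moreover have "0 \<le> h (s k z)" using h(3)[of "s k z"] by simp
          ultimately show "norm (\<bar>u z\<bar> powr q * (h (s k z) * \<zeta> z)) \<le> norm (2 * (\<bar>u z\<bar> powr q * \<zeta> z))"
            using \<zeta>0[of z] by (simp add: abs_mult mult_ac)
        qed
      qed
      fix z
      have "1 * \<zeta> z \<le> h (s k z) * \<zeta> z" using h(3) \<zeta>0 by (intro mult_right_mono) auto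
      then show "\<bar>u z\<bar> powr q * \<zeta> z \<le> \<bar>u z\<bar> powr q * (h (s k z) * \<zeta> z)" by (intro mult_left_mono) auto
    qed
    also have "\<dots> = (\<integral>z. \<bar>u z\<bar> powr (q - 1) * u z * (h (s k z) * \<zeta> z) \<partial>?M)"
    proof (rule integral_cong_AE)
      have 1: "(\<lambda>z. h (s k z)) \<in> borel_measurable ?M" by (rule measurable_compose[OF sm hm])
      show "(\<lambda>z. \<bar>u z\<bar> powr q * (h (s k z) * \<zeta> z)) \<in> borel_measurable ?M"
        "(\<lambda>z. \<bar>u z\<bar> powr (q - 1) * u z * (h (s k z) * \<zeta> z)) \<in> borel_measurable ?M"
        using 1 um \<zeta>m by measurable
      show "AE z in ?M. \<bar>u z\<bar> powr q * (h (s k z) * \<zeta> z) = \<bar>u z\<bar> powr (q - 1) * u z * (h (s k z) * \<zeta> z)"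
        using u0'
      proof eventually_elim
        case (elim z)
        have "\<bar>u z\<bar> powr q = \<bar>u z\<bar> powr (q - 1) * u z"
          using elim by (cases "u z = 0") (auto simp: powr_diff)
        then show ?case by simp
      qed
    qed
    also have "\<dots> = ?B (\<lambda>z. h (s k z) * \<zeta> z)"
      by (rule integral_eq_lebesgue_on[symmetric, OF \<Omega>(2)]) (use \<zeta>(2) notin_supp in force)
    finally show ?thesis .
  qed
  \<comment> \<open>The derivatives of \<open>s k\<close> disappear: in time by parts, in space by absorption.\<close>
  have upper: "(\<integral>z. dt (s k) z * (h (s k z) * \<zeta> z) \<partial>?M) + (\<integral>z. energy_form a (\<lambda>z. h (s k z) * \<zeta> z) (s k) z \<partial>?M)
      \<le> (C + 2) * (\<integral>z. g z * \<Theta> (s k z) \<partial>?M)"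
    if int: "integrable ?M (energy_form a (\<lambda>z. h (s k z) * \<zeta> z) (s k))" for k
  proof -
    have hb: "\<bar>h r\<bar> \<le> 2" for r using h(3,4)[of r] by simp
    note ibp = integral_dt_compose_mult[OF dom sD(1)[of k] sD(2)[of k] H(1,2) smooth_on_continuous[OF h(1)] hb \<zeta>]
    have "(\<integral>z. dt (s k) z * (h (s k z) * \<zeta> z) \<partial>?M) + (\<integral>z. energy_form a (\<lambda>z. h (s k z) * \<zeta> z) (s k) z \<partial>?M)
      = (\<integral>z. - (H (s k z) * dt \<zeta> z) + energy_form a (\<lambda>z. h (s k z) * \<zeta> z) (s k) z \<partial>?M)"
      using ibp int by simp
    also have "\<dots> \<le> (\<integral>z. (C + 2) * (g z * \<Theta> (s k z)) \<partial>?M)"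
    proof (rule integral_mono_AE)
      show "integrable ?M (\<lambda>z. - (H (s k z) * dt \<zeta> z) + energy_form a (\<lambda>z. h (s k z) * \<zeta> z) (s k) z)"
        using ibp(2) int by simp
      show "integrable ?M (\<lambda>z. (C + 2) * (g z * \<Theta> (s k z)))" using \<Theta>s by simp
      show "AE z in ?M. - (H (s k z) * dt \<zeta> z) + energy_form a (\<lambda>z. h (s k z) * \<zeta> z) (s k) z \<le> (C + 2) * (g z * \<Theta> (s k z))"
        using ell dt\<zeta>' en\<zeta>'
      proof eventually_elim
        case (elim z)
        then have z: "z \<in> \<Omega>" and el: "elliptic_at a A z" by auto
        have "- (H (s k z) * dt \<zeta> z) \<le> \<bar>H (s k z)\<bar> * \<bar>dt \<zeta> z\<bar>"
          by (metis abs_ge_minus_self abs_mult)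
        also have "\<dots> \<le> (2 * \<Theta> (s k z)) * g z"
          using order_trans[OF H(3)[of "s k z"], of "2 * \<Theta> (s k z)"] r\<Theta>[of "s k z"] elim \<Theta>0[of "s k z"]
          by (intro mult_mono) auto
        finally have 1: "- (H (s k z) * dt \<zeta> z) \<le> 2 * (g z * \<Theta> (s k z))" by (simp add: mult_ac)
        have "energy_form a (\<lambda>z. h (s k z) * \<zeta> z) (s k) z
            = h' (s k z) * \<zeta> z * energy_form a (s k) (s k) z + h (s k z) * energy_form a \<zeta> (s k) z"
          by (rule energy_form_compose_mult[OF h(2) sd[OF z] \<zeta>d])
        also have "\<dots> \<le> g z * (C * \<Theta> (s k z))"
        proof (rule energy_form_absorption[OF el _ \<zeta>0 g(2) _ h(4) h'(2)])
          show "energy_form a \<zeta> \<zeta> z \<le> g z * \<zeta> z" using elim by simp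
          show "0 \<le> h (s k z)" using h(3)[of "s k z"] by simp
          show "1 \<le> - h' (s k z) * (C * \<Theta> (s k z))" unfolding \<Theta>_def by (rule h'(3))
        qed
        finally show ?case using 1 by (simp add: algebra_simps)
      qed
    qed
    also have "\<dots> = (C + 2) * (\<integral>z. g z * \<Theta> (s k z) \<partial>?M)" by simp
    finally show ?thesis .
  qed
  \<comment> \<open>As \<open>p < q\<close>, the \<open>p\<close>-th power of \<open>s k - u\<close> is dominated by a small constant plus a multiple of the
    \<open>q\<close>-th power, whose integral tends to \<open>0\<close>.\<close>
  define V where "V = measure ?M (space ?M)"
  have key: "(\<integral>z. \<bar>u z\<bar> powr q * \<zeta> z \<partial>?M) \<le> (C + 2) * (2 powr p * (\<integral>z. g z * \<Theta> (u z) \<partial>?M))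
      + t * (1 + (C + 2) * (2 powr p * (K * \<epsilon> * V)))" if t: "t > 0" for t
  proof -
    obtain c where c: "c > 0" "\<forall>x\<ge>0. x powr p \<le> t + c * x powr q"
      using powr_le_const_add[of p q t] pq t by auto
    let ?R = "\<lambda>k. t + (C + 2) * (2 powr p * (\<integral>z. g z * \<Theta> (u z) \<partial>?M)
        + 2 powr p * (K * \<epsilon> * (t * V + c * (\<epsilon> powr (- q) * (\<integral>z. \<bar>s k z - u z\<bar> powr q \<partial>?M)))))"
    have est: "(\<integral>z. g z * \<Theta> (s k z) \<partial>?M) \<le> 2 powr p * (\<integral>z. g z * \<Theta> (u z) \<partial>?M)
        + 2 powr p * (K * \<epsilon> * (t * V + c * (\<epsilon> powr (- q) * (\<integral>z. \<bar>s k z - u z\<bar> powr q \<partial>?M))))" for k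
    proof -
      have "(\<integral>z. g z * \<Theta> (s k z) \<partial>?M) \<le> (\<integral>z. 2 powr p * (g z * \<Theta> (u z))
          + 2 powr p * (K * \<epsilon> * (t + c * (\<epsilon> powr (- q) * \<bar>s k z - u z\<bar> powr q))) \<partial>?M)"
      proof (rule integral_mono[OF \<Theta>s])
        show "integrable ?M (\<lambda>z. 2 powr p * (g z * \<Theta> (u z))
          + 2 powr p * (K * \<epsilon> * (t + c * (\<epsilon> powr (- q) * \<bar>s k z - u z\<bar> powr q))))"
          using \<Theta>u di[of k] by simp
        fix z
        have "\<bar>s k z / \<epsilon>\<bar> powr p \<le> 2 powr p * (\<bar>u z / \<epsilon>\<bar> powr p + \<bar>(s k z - u z) / \<epsilon>\<bar> powr p)"
          using powr_abs_add_le[of p "u z / \<epsilon>" "(s k z - u z) / \<epsilon>"] pq by (simp add: add_divide_distrib[symmetric])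
        moreover have "1 \<le> (2::real) powr p" using pq by (simp add: ge_one_powr_ge_zero)
        ultimately have "1 + \<bar>s k z / \<epsilon>\<bar> powr p \<le> 2 powr p * ((1 + \<bar>u z / \<epsilon>\<bar> powr p) + \<bar>(s k z - u z) / \<epsilon>\<bar> powr p)"
          by (simp add: algebra_simps)
        then have "\<Theta> (s k z) \<le> \<epsilon> * (2 powr p * ((1 + \<bar>u z / \<epsilon>\<bar> powr p) + \<bar>(s k z - u z) / \<epsilon>\<bar> powr p))"
          unfolding \<Theta>_def using \<epsilon> by (intro mult_left_mono) auto
        also have "\<dots> = 2 powr p * (\<Theta> (u z) + \<epsilon> * \<bar>(s k z - u z) / \<epsilon>\<bar> powr p)"
          by (simp add: \<Theta>_def algebra_simps)
        finally have "g z * \<Theta> (s k z) \<le> g z * (2 powr p * (\<Theta> (u z) + \<epsilon> * \<bar>(s k z - u z) / \<epsilon>\<bar> powr p))"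
          using g(2) by (intro mult_left_mono) auto
        also have "\<dots> = 2 powr p * (g z * \<Theta> (u z)) + 2 powr p * (g z * \<epsilon> * \<bar>(s k z - u z) / \<epsilon>\<bar> powr p)"
          by (simp add: algebra_simps)
        also have "\<dots> \<le> 2 powr p * (g z * \<Theta> (u z)) + 2 powr p * (K * \<epsilon> * (t + c * (\<epsilon> powr (- q) * \<bar>s k z - u z\<bar> powr q)))"
        proof -
          have "\<bar>(s k z - u z) / \<epsilon>\<bar> powr p \<le> t + c * (\<epsilon> powr (- q) * \<bar>s k z - u z\<bar> powr q)"
            using c(2)[rule_format, of "\<bar>(s k z - u z) / \<epsilon>\<bar>"] unfolding dpowr by simp
          then show ?thesis using g(2,3) \<epsilon> K0 by (intro add_left_mono mult_left_mono mult_mono) auto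
        qed
        finally show "g z * \<Theta> (s k z) \<le> 2 powr p * (g z * \<Theta> (u z))
          + 2 powr p * (K * \<epsilon> * (t + c * (\<epsilon> powr (- q) * \<bar>s k z - u z\<bar> powr q)))" .
      qed
      also have "\<dots> = 2 powr p * (\<integral>z. g z * \<Theta> (u z) \<partial>?M)
        + 2 powr p * (K * \<epsilon> * (t * V + c * (\<epsilon> powr (- q) * (\<integral>z. \<bar>s k z - u z\<bar> powr q \<partial>?M))))"
        using \<Theta>u di[of k] by (simp add: V_def)
      finally show ?thesis .
    qed
    have L: "\<bar>h' r\<bar> \<le> L" for r using h'(1,2)[of r] by simp
    have h0: "0 \<le> h r" for r using h(3)[of r] by simp
    obtain N where N: "\<forall>k\<ge>N. ?B (\<lambda>z. h (s k z) * \<zeta> z) \<le> t + (\<integral>z. dt (s k) z * (h (s k z) * \<zeta> z) \<partial>?M)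
     + (\<integral>z. energy_form a (\<lambda>z. h (s k z) * \<zeta> z) (s k) z \<partial>?M)
     \<and> integrable ?M (energy_form a (\<lambda>z. h (s k z) * \<zeta> z) (s k))"
      using tested_inequality_eventually[OF adm dom q s h(1,2) h0 h(4) L \<zeta> \<zeta>E sol' t] by blast
    have lim_R: "?R \<longlonglongrightarrow> t + (C + 2) * (2 powr p * (\<integral>z. g z * \<Theta> (u z) \<partial>?M)
        + 2 powr p * (K * \<epsilon> * (t * V + c * (\<epsilon> powr (- q) * 0))))"
      by (intro tendsto_add tendsto_mult tendsto_const lim)
    have "(\<integral>z. \<bar>u z\<bar> powr q * \<zeta> z \<partial>?M) \<le> t + (C + 2) * (2 powr p * (\<integral>z. g z * \<Theta> (u z) \<partial>?M)
        + 2 powr p * (K * \<epsilon> * (t * V + c * (\<epsilon> powr (- q) * 0))))"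
    proof (rule LIMSEQ_le_const[OF lim_R], intro exI[of _ N] allI impI)
      fix k assume k: "k \<ge> N"
      note Nk = N[rule_format, OF k]
      have "(C + 2) * (\<integral>z. g z * \<Theta> (s k z) \<partial>?M) \<le> (C + 2) * (2 powr p * (\<integral>z. g z * \<Theta> (u z) \<partial>?M)
        + 2 powr p * (K * \<epsilon> * (t * V + c * (\<epsilon> powr (- q) * (\<integral>z. \<bar>s k z - u z\<bar> powr q \<partial>?M)))))"
        using est[of k] C by (intro mult_left_mono) auto
      then show "(\<integral>z. \<bar>u z\<bar> powr q * \<zeta> z \<partial>?M) \<le> ?R k"
        using lower[of k] upper[OF conjunct2[OF Nk]] conjunct1[OF Nk] by linarith
    qed
    then show ?thesis by (simp add: algebra_simps)
  qed
  define D where "D = 1 + (C + 2) * (2 powr p * (K * \<epsilon> * V))"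
  have D: "D > 0" unfolding D_def using C K0 \<epsilon> by (intro add_pos_nonneg mult_nonneg_nonneg) (auto simp: V_def)
  have "(\<integral>z. \<bar>u z\<bar> powr q * \<zeta> z \<partial>?M) \<le> (C + 2) * (2 powr p * (\<integral>z. g z * \<Theta> (u z) \<partial>?M))"
  proof (rule field_le_epsilon)
    fix e :: real assume "e > 0"
    then show "(\<integral>z. \<bar>u z\<bar> powr q * \<zeta> z \<partial>?M) \<le> (C + 2) * (2 powr p * (\<integral>z. g z * \<Theta> (u z) \<partial>?M)) + e"
      using key[of "e / D"] D unfolding D_def[symmetric] by simp
  qed
  then show ?thesis unfolding \<Theta>_def .
qed

section \<open>Cutoffs of space-time cylinders\<close>

definition cylinder :: "real \<Rightarrow> real \<Rightarrow> 'n::finite pt set" where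
  "cylinder S R = {z. \<bar>fst z\<bar> \<le> S \<and> norm (snd z) \<le> R}"

definition shell :: "real \<Rightarrow> real \<Rightarrow> 'n::finite pt set" where
  "shell S R = cylinder S R - cylinder (S / 2) (R / 2)"

definition cylinder_cutoff ::
  "('n::finite pt \<Rightarrow> real) \<Rightarrow> real \<Rightarrow> real \<Rightarrow> real \<Rightarrow> ('n pt \<Rightarrow> real) \<Rightarrow> bool" where
  "cylinder_cutoff A B S R \<psi> \<longleftrightarrow> smooth_on UNIV \<psi> \<and> (\<forall>z. 0 \<le> \<psi> z \<and> \<psi> z \<le> 1) \<and>
     (\<forall>z \<in> cylinder (S / 2) (R / 2). \<psi> z = 1) \<and> (\<forall>z. z \<notin> cylinder S R \<longrightarrow> \<psi> z = 0) \<and>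
     (\<forall>z. \<bar>dt \<psi> z\<bar> \<le> B * indicator (shell S R) z) \<and>
     (AE z in lebesgue. A z * (\<Sum>i\<in>UNIV. (dx i \<psi> z)\<^sup>2) \<le> B * indicator (shell S R) z)"

lemma cylinder_sets: "(cylinder S R :: 'n::finite pt set) \<in> sets lebesgue"
proof -
  have "closed (cylinder S R :: 'n pt set)" unfolding cylinder_def
    by (intro closed_Collect_conj closed_Collect_le continuous_intros)
  then show ?thesis by (intro sets_completionI_sets) (simp add: borel_closed)
qed

lemma shell_sets: "(shell S R :: 'n::finite pt set) \<in> sets lebesgue"
  unfolding shell_def by (intro sets.Diff cylinder_sets)

lemma measure_cylinder_le:
  assumes "0 \<le> S" "0 \<le> R"
  shows "measure lebesgue (cylinder S R :: 'n::finite pt set) \<le> 2 * S * (2 * R) ^ CARD('n)"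
proof -
  define b :: "real ^ 'n" where "b = vec R"
  have nb: "cbox (- b) b \<noteq> {}"
    using assms mem_box_cart(2)[of 0 "- b" b] by (auto simp: b_def)
  have "(cylinder S R :: 'n pt set) \<subseteq> cbox (- S, - b) (S, b)"
  proof
    fix z :: "'n pt" assume "z \<in> cylinder S R"
    then have z: "\<bar>fst z\<bar> \<le> S" "norm (snd z) \<le> R" by (auto simp: cylinder_def)
    have "\<bar>snd z $ i\<bar> \<le> R" for i using component_le_norm_cart[of "snd z" i] z(2) by linarith
    then have "snd z \<in> cbox (- b) b" unfolding mem_box_cart b_def by (auto simp: abs_le_iff minus_le_iff)
    then show "z \<in> cbox (- S, - b) (S, b)" using z(1) by (cases z) (auto simp: cbox_Pair_eq)
  qed
  then have "measure lebesgue (cylinder S R :: 'n pt set) \<le> measure lebesgue (cbox (- S, - b) (S, b))"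
    by (rule measure_mono_fmeasurable) (auto intro: cylinder_sets)
  also have "\<dots> = measure lborel (cbox (- S) S) * measure lborel (cbox (- b) b)"
    by (simp add: content_Pair)
  also have "measure lborel (cbox (- S) S) = 2 * S" using assms by simp
  also have "measure lborel (cbox (- b) b) = (2 * R) ^ CARD('n)"
    unfolding content_cbox_cart[OF nb] by (simp add: b_def power_mult_distrib)
  finally show ?thesis .
qed

lemma AE_bound_in_annulus:
  fixes A :: "'n::finite pt \<Rightarrow> real"
  assumes "annular_esssup A R \<le> ereal B"
  shows "AE z in lebesgue. R / 2 < norm (snd z) \<and> norm (snd z) < R \<longrightarrow> A z \<le> B"
proof -
  let ?S = "UNIV \<times> {x. R / 2 < norm x \<and> norm x < R} :: 'n pt set"
  have "open ?S" by (intro open_Times open_Collect_conj open_Collect_less continuous_intros) auto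
  then have S: "?S \<inter> space lebesgue \<in> sets lebesgue" by auto
  have "AE z in restrict_space lebesgue ?S. ereal (A z) \<le> annular_esssup A R"
    unfolding annular_esssup_def by (rule esssup_AE)
  then have "AE z in restrict_space lebesgue ?S. A z \<le> B"
    by eventually_elim (use assms order_trans in force)
  then have "AE z in lebesgue. z \<in> ?S \<longrightarrow> A z \<le> B" by (simp only: AE_restrict_space_iff[OF S])
  then show ?thesis by eventually_elim auto
qed

text \<open>
  The cutoff is \<open>\<eta>(t\<^sup>2 / R\<^bsup>2\<alpha>\<^esup>) \<eta>(|x|\<^sup>2 / R\<^sup>2)\<close>. Its spatial gradient has size \<open>1/R\<close> and lives in the annulus
  \<open>R/2 < |x| < R\<close>, where \<open>A \<le> c R\<^bsup>2-\<alpha>\<^esup>\<close>. The length \<open>R\<^sup>\<alpha>\<close> in time is the one for which \<open>|\<psi>\<^sub>t|\<close>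
  and \<open>A |\<nabla>\<psi>|\<^sup>2\<close> have the same order.
\<close>

lemma ex_cylinder_cutoff:
  fixes A :: "'n::finite pt \<Rightarrow> real"
  assumes A0: "\<And>z. 0 \<le> A z" and c: "c > 0"
    and A: "\<And>R. R > 1 \<Longrightarrow> annular_esssup A R \<le> ereal (c * R powr (2 - \<alpha>))"
  shows "\<exists>K>0. \<forall>R>1. \<exists>\<psi> :: 'n pt \<Rightarrow> real. cylinder_cutoff A (K * R powr - \<alpha>) (R powr \<alpha>) R \<psi>"
proof -
  obtain \<eta> \<eta>' :: "real \<Rightarrow> real" and M where \<eta>: "smooth_on UNIV \<eta>" "\<And>r. (\<eta> has_real_derivative \<eta>' r) (at r)"
     "\<And>r. 0 \<le> \<eta> r" "\<And>r. \<eta> r \<le> 1" "\<And>r. r \<le> 1/4 \<Longrightarrow> \<eta> r = 1" "\<And>r. r \<ge> 1 \<Longrightarrow> \<eta> r = 0"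
     "\<And>r. \<bar>\<eta>' r\<bar> \<le> M" "\<And>r. r \<le> 1/4 \<or> 1 \<le> r \<Longrightarrow> \<eta>' r = 0"
    using ex_cutoff by metis
  have M0: "0 \<le> M" using \<eta>(7)[of 0] by simp
  define K where "K = 2 * M + 4 * M\<^sup>2 * c + 1"
  have K: "K > 0" "2 * M \<le> K" "4 * M\<^sup>2 * c \<le> K" using M0 c by (auto simp: K_def add_nonneg_pos)
  show ?thesis
  proof (intro exI[of _ K] conjI allI impI K(1))
    fix R :: real assume R: "R > 1"
    define S where "S = R powr \<alpha>"
    have S: "S > 0" using R by (simp add: S_def)
    have Si: "R powr - \<alpha> = inverse S" by (simp add: S_def powr_minus)
    define f where "f z = (inverse S)\<^sup>2 * (fst z)\<^sup>2" for z :: "'n pt"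
    define k where "k z = (inverse R)\<^sup>2 * (snd z \<bullet> snd z)" for z :: "'n pt"
    define \<psi> where "\<psi> z = \<eta> (f z) * \<eta> (k z)" for z
    have f: "f z = (\<bar>fst z\<bar> / S)\<^sup>2" for z by (simp add: f_def power_divide divide_inverse power_mult_distrib)
    have k: "k z = (norm (snd z) / R)\<^sup>2" for z
      by (simp add: k_def power_divide divide_inverse power_mult_distrib dot_square_norm)
    have sq: "x\<^sup>2 \<le> 1/4 \<longleftrightarrow> x \<le> 1/2" "1 \<le> x\<^sup>2 \<longleftrightarrow> 1 \<le> x" if "0 \<le> x" for x :: real
      using that abs_le_square_iff[of x "1/2"] abs_le_square_iff[of 1 x] by (auto simp: power2_eq_square)
    have quot: "(x / y)\<^sup>2 \<le> 1/4 \<longleftrightarrow> x \<le> y / 2" "1 \<le> (x / y)\<^sup>2 \<longleftrightarrow> y \<le> x" if "0 \<le> x" "0 < y" for x y :: real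
    proof -
      have "0 \<le> x / y" using that by simp
      from sq[OF this] show "(x / y)\<^sup>2 \<le> 1/4 \<longleftrightarrow> x \<le> y / 2" "1 \<le> (x / y)\<^sup>2 \<longleftrightarrow> y \<le> x"
        using that(2) by (simp_all only: pos_divide_le_eq pos_le_divide_eq) auto
    qed
    have f1: "f z \<le> 1/4 \<longleftrightarrow> \<bar>fst z\<bar> \<le> S / 2" "1 \<le> f z \<longleftrightarrow> S \<le> \<bar>fst z\<bar>" for z
      unfolding f using S by (simp_all only: quot abs_ge_zero)
    have k1: "k z \<le> 1/4 \<longleftrightarrow> norm (snd z) \<le> R / 2" "1 \<le> k z \<longleftrightarrow> R \<le> norm (snd z)" for z
      unfolding k by (rule quot; use R in simp)+
    have smf: "smooth_on UNIV f" unfolding f_def[abs_def]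
      by (intro smooth_on_mult smooth_on_const smooth_on_power smooth_on_bounded_linear bounded_linear_fst) auto
    have smi: "smooth_on UNIV (\<lambda>z :: 'n pt. snd z $ i)" for i
      by (intro smooth_on_bounded_linear bounded_linear_compose[OF bounded_linear_vec_nth bounded_linear_snd])
    have smk: "smooth_on UNIV k" unfolding k_def[abs_def] inner_vec_def inner_real_def
      by (intro smooth_on_mult smooth_on_const smooth_on_sum smi) auto
    have sm: "smooth_on UNIV \<psi>" unfolding \<psi>_def[abs_def]
      by (intro smooth_on_mult smooth_on_compose[OF _ _ \<eta>(1)] smf smk) auto
    have Df: "(f has_derivative (\<lambda>v. (inverse S)\<^sup>2 * (2 * fst z * fst v))) (at z)" for z
      unfolding f_def[abs_def] by (auto intro!: derivative_eq_intros)
    have Dk: "(k has_derivative (\<lambda>v. (inverse R)\<^sup>2 * (2 * (snd z \<bullet> snd v)))) (at z)" for z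
      unfolding k_def[abs_def] by (auto intro!: derivative_eq_intros simp: inner_commute)
    have D\<psi>: "(\<psi> has_derivative (\<lambda>v. \<eta> (f z) * (\<eta>' (k z) * ((inverse R)\<^sup>2 * (2 * (snd z \<bullet> snd v))))
        + \<eta>' (f z) * ((inverse S)\<^sup>2 * (2 * fst z * fst v)) * \<eta> (k z))) (at z)" for z
      unfolding \<psi>_def[abs_def]
      by (rule has_derivative_mult[OF has_derivative_compose[OF Df \<eta>(2)[unfolded has_field_derivative_def]]
            has_derivative_compose[OF Dk \<eta>(2)[unfolded has_field_derivative_def]]])
    have dt\<psi>: "dt \<psi> z = \<eta>' (f z) * ((inverse S)\<^sup>2 * (2 * fst z)) * \<eta> (k z)" for z
      unfolding dt_def frechet_derivative_at[OF D\<psi>, symmetric] by simp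
    have dx\<psi>: "dx i \<psi> z = \<eta> (f z) * (\<eta>' (k z) * ((inverse R)\<^sup>2 * (2 * (snd z $ i))))" for i z
      unfolding dx_def frechet_derivative_at[OF D\<psi>, symmetric] by (simp add: inner_axis)
    let ?T = "cylinder S R - cylinder (S / 2) (R / 2)"
    have bt: "\<bar>dt \<psi> z\<bar> \<le> K * inverse S * indicator ?T z" for z
    proof (cases "\<eta>' (f z) = 0 \<or> \<eta> (k z) = 0")
      case True then show ?thesis using K S by (auto simp: dt\<psi>)
    next
      case False
      then have "\<not> f z \<le> 1/4" "\<not> 1 \<le> f z" "\<not> 1 \<le> k z" using \<eta>(6,8) by blast+
      then have t: "\<bar>fst z\<bar> \<le> S" "\<not> \<bar>fst z\<bar> \<le> S / 2" "norm (snd z) \<le> R" using f1 k1 by auto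
      then have T: "z \<in> ?T" by (auto simp: cylinder_def)
      have "\<bar>dt \<psi> z\<bar> = \<bar>\<eta>' (f z)\<bar> * (inverse S * (2 * (\<bar>fst z\<bar> / S))) * \<eta> (k z)"
        unfolding dt\<psi> using \<eta>(3) S by (simp add: abs_mult power2_eq_square divide_inverse)
      also have "\<dots> \<le> M * (inverse S * (2 * 1)) * 1"
        using \<eta>(3,4,7) S t(1) M0 by (intro mult_mono mult_left_mono mult_nonneg_nonneg) auto
      also have "\<dots> = 2 * M * inverse S" by simp
      also have "\<dots> \<le> K * inverse S" using K S by (intro mult_right_mono) auto
      finally show ?thesis using T by simp
    qed
    have bx: "A z * (\<Sum>i\<in>UNIV. (dx i \<psi> z)\<^sup>2) \<le> K * inverse S * indicator ?T z"
      if Az: "R / 2 < norm (snd z) \<and> norm (snd z) < R \<longrightarrow> A z \<le> c * R powr (2 - \<alpha>)" for z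
    proof (cases "\<eta>' (k z) = 0 \<or> \<eta> (f z) = 0")
      case True then show ?thesis using K S by (auto simp: dx\<psi>)
    next
      case False
      then have "\<not> k z \<le> 1/4" "\<not> 1 \<le> k z" "\<not> 1 \<le> f z" using \<eta>(6,8) by blast+
      then have t: "\<bar>fst z\<bar> \<le> S" "R / 2 < norm (snd z)" "norm (snd z) < R" using f1 k1 by auto
      then have T: "z \<in> ?T" by (auto simp: cylinder_def)
      have "(\<Sum>i\<in>UNIV. (dx i \<psi> z)\<^sup>2) = (\<eta> (f z) * (\<eta>' (k z) * ((inverse R)\<^sup>2 * 2)))\<^sup>2 * (snd z \<bullet> snd z)"
        unfolding dx\<psi> inner_vec_def by (simp add: sum_distrib_left power2_eq_square algebra_simps)
      also have "\<dots> = (\<eta> (f z))\<^sup>2 * (\<eta>' (k z))\<^sup>2 * (4 * (inverse R)\<^sup>2 * (norm (snd z) / R)\<^sup>2)"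
        by (simp add: power_mult_distrib power_divide divide_inverse dot_square_norm)
      also have "\<dots> \<le> 1\<^sup>2 * M\<^sup>2 * (4 * (inverse R)\<^sup>2 * 1\<^sup>2)"
      proof -
        have 1: "(\<eta> (f z))\<^sup>2 \<le> 1\<^sup>2" using \<eta>(3,4) by (intro power_mono) auto
        have 2: "(\<eta>' (k z))\<^sup>2 \<le> M\<^sup>2" using abs_le_square_iff[of "\<eta>' (k z)" M] \<eta>(7)[of "k z"] M0 by simp
        have 3: "(norm (snd z) / R)\<^sup>2 \<le> 1\<^sup>2" using R t by (intro power_mono) auto
        show ?thesis by (intro mult_mono[OF mult_mono[OF 1 2]] mult_left_mono[OF 3]) auto
      qed
      finally have sum: "(\<Sum>i\<in>UNIV. (dx i \<psi> z)\<^sup>2) \<le> 4 * M\<^sup>2 * (inverse R)\<^sup>2" by simp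
      have "A z * (\<Sum>i\<in>UNIV. (dx i \<psi> z)\<^sup>2) \<le> (c * R powr (2 - \<alpha>)) * (4 * M\<^sup>2 * (inverse R)\<^sup>2)"
        using Az t sum A0 c by (intro mult_mono) (auto intro!: sum_nonneg)
      also have "\<dots> = 4 * M\<^sup>2 * c * (R powr (2 - \<alpha>) * R powr - 2)"
        using R by (simp add: powr_minus powr_numeral power_inverse)
      also have "R powr (2 - \<alpha>) * R powr - 2 = inverse S"
        by (simp add: powr_add[symmetric] Si[symmetric])
      also have "4 * M\<^sup>2 * c * inverse S \<le> K * inverse S" using K S by (intro mult_right_mono) auto
      finally show ?thesis using T by simp
    qed
    have "\<psi> z = 1" if "z \<in> cylinder (S / 2) (R / 2)" for z
      using that f1(1)[of z] k1(1)[of z] by (simp add: cylinder_def \<psi>_def \<eta>(5))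
    moreover have "\<psi> z = 0" if "z \<notin> cylinder S R" for z
      using that f1(2)[of z] k1(2)[of z] \<eta>(6) by (auto simp: cylinder_def \<psi>_def not_le)
    moreover have "0 \<le> \<psi> z" "\<psi> z \<le> 1" for z
      using \<eta>(3,4) by (auto simp: \<psi>_def intro!: mult_le_one)
    moreover have "AE z in lebesgue. A z * (\<Sum>i\<in>UNIV. (dx i \<psi> z)\<^sup>2) \<le> K * inverse S * indicator ?T z"
      using AE_bound_in_annulus[OF A[OF R]] by eventually_elim (rule bx)
    ultimately show "\<exists>\<psi> :: 'n pt \<Rightarrow> real. cylinder_cutoff A (K * R powr - \<alpha>) (R powr \<alpha>) R \<psi>"
      using sm bt unfolding cylinder_cutoff_def shell_def Si S_def[symmetric] by blast
  qed
qed

section \<open>The estimate on a cylinder\<close>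

text \<open>
  With \<open>\<zeta> = \<psi>\<^sup>N\<close> both \<open>|\<zeta>\<^sub>t|\<close> and \<open>\<langle>\<nabla>\<zeta>, \<nabla>\<zeta>\<rangle> / \<zeta>\<close> are bounded by \<open>N\<^sup>2 B \<psi>\<^bsup>N-2\<^esup>\<close> on the shell. The
  surviving power of \<open>\<psi>\<close> is what makes the absorption in the first rescaling step possible.
\<close>

lemma weak_solution_cutoff_estimate:
  fixes u A \<psi> :: "'n::finite pt \<Rightarrow> real" and a :: "'n coeffs" and p q \<epsilon> B C L :: real and N :: nat
    and H h h' :: "real \<Rightarrow> real"
  assumes pq: "1 < p" "p < q" and N: "N \<ge> 3"
    and adm: "admissible_operator a A" and sol: "weak_solution a q u"
    and u0: "AE z in lebesgue. u z \<ge> 0" and cut: "cylinder_cutoff A B S R \<psi>" and B: "0 \<le> B"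
    and dom: "bounded_domain \<Omega>" and cyl: "cylinder S R \<subseteq> \<Omega>" and \<epsilon>: "\<epsilon> > 0" and C: "C > 0"
    and prof: "concave_profile (\<lambda>r. C * (\<epsilon> * (1 + \<bar>r / \<epsilon>\<bar> powr p))) L H h h'"
  shows "(\<integral>z. \<bar>u z\<bar> powr q * \<psi> z ^ N \<partial>lebesgue_on \<Omega>)
    \<le> (C + 2) * (2 powr p * (real N ^ 2 * B)) * (\<integral>z. indicator (shell S R) z *
        (\<psi> z ^ (N - 2) * (\<epsilon> * (1 + \<bar>u z / \<epsilon>\<bar> powr p))) \<partial>lebesgue_on \<Omega>)"
proof -
  let ?T = "shell S R :: 'n pt set"
  have sm: "smooth_on UNIV \<psi>" and \<psi>: "\<And>z. 0 \<le> \<psi> z" "\<And>z. \<psi> z \<le> 1"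
    and \<psi>0: "\<And>z. z \<notin> cylinder S R \<Longrightarrow> \<psi> z = 0" and bt: "\<And>z. \<bar>dt \<psi> z\<bar> \<le> B * indicator ?T z"
    and bx: "AE z in lebesgue. A z * (\<Sum>i\<in>UNIV. (dx i \<psi> z)\<^sup>2) \<le> B * indicator ?T z"
    using cut unfolding cylinder_cutoff_def by blast+
  have N0: "real N > 0" using N by simp
  define \<zeta> where "\<zeta> z = \<psi> z ^ N" for z
  have \<zeta>sm: "smooth_on UNIV \<zeta>" unfolding \<zeta>_def[abs_def] by (intro smooth_on_power sm) auto
  have clc: "closed (cylinder S R :: 'n pt set)" unfolding cylinder_def
    by (intro closed_Collect_conj closed_Collect_le continuous_intros)
  have "{z. \<zeta> z \<noteq> 0} \<subseteq> cylinder S R"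
    using \<psi>0 N by (force simp: \<zeta>_def)
  then have sup: "supp \<zeta> \<subseteq> cylinder S R"
    unfolding supp_def using clc by (rule closure_minimal)
  then have sup\<Omega>: "supp \<zeta> \<subseteq> \<Omega>" using cyl by blast
  have bdd: "bounded (supp \<zeta>)" 
    by (rule bounded_subset[OF _ sup\<Omega>]) (use dom in \<open>simp add: bounded_domain_def\<close>)
  have "compact (supp \<zeta>)"
    unfolding compact_eq_bounded_closed using bdd by (simp add: supp_def)
  then have test: "test_function \<zeta>" using \<zeta>sm \<psi>(1) by (simp add: test_function_def \<zeta>_def)
  have \<zeta>1: "\<zeta> z \<le> 1" for z unfolding \<zeta>_def using \<psi> by (intro power_le_one) auto
  have \<psi>m: "\<psi> \<in> borel_measurable lebesgue"
    using smooth_on_measurable(1)[of UNIV \<psi>] sm by simp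
  define B2 where "B2 = real N ^ 2 * B"
  have B20: "0 \<le> B2" using B by (simp add: B2_def)
  define g where "g z = B2 * (indicator ?T z * \<psi> z ^ (N - 2))" for z
  have g: "g \<in> borel_measurable lebesgue" "\<And>z. 0 \<le> g z" "\<And>z. g z \<le> B2"
  proof -
    have "?T \<in> sets lebesgue" by (rule shell_sets)
    then show "g \<in> borel_measurable lebesgue" unfolding g_def using \<psi>m by measurable
    show "0 \<le> g z" for z unfolding g_def using B20 \<psi> by simp
    have "indicator ?T z * \<psi> z ^ (N - 2) \<le> 1" for z
      using \<psi> by (intro mult_le_one power_le_one) (auto simp: indicator_def)
    then show "g z \<le> B2" for z unfolding g_def using B20 mult_left_le by blast
  qed
  have \<psi>d: "\<psi> differentiable (at z)" for z using smooth_on_differentiable[OF sm] by simp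
  have D\<zeta>: "frechet_derivative \<zeta> (at z) v = real N * \<psi> z ^ (N - 1) * frechet_derivative \<psi> (at z) v" for z v
  proof -
    have "(\<psi> has_derivative frechet_derivative \<psi> (at z)) (at z)"
      using \<psi>d by (simp add: frechet_derivative_works[symmetric])
    from has_derivative_power[OF this, of N]
    have "(\<zeta> has_derivative (\<lambda>v. real N * frechet_derivative \<psi> (at z) v * \<psi> z ^ (N - 1))) (at z)"
      unfolding \<zeta>_def[abs_def] by (simp add: mult_ac)
    then have "frechet_derivative \<zeta> (at z) = (\<lambda>v. real N * frechet_derivative \<psi> (at z) v * \<psi> z ^ (N - 1))"
      by (metis frechet_derivative_at)
    then show ?thesis by simp
  qed
  have pw: "\<psi> z ^ (N - 1) \<le> \<psi> z ^ (N - 2)" for z using \<psi> by (intro power_decreasing) auto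
  have dt\<zeta>: "\<bar>dt \<zeta> z\<bar> \<le> g z" for z
  proof -
    have "\<bar>dt \<zeta> z\<bar> = real N * \<psi> z ^ (N - 1) * \<bar>dt \<psi> z\<bar>"
      unfolding dt_def D\<zeta> using \<psi>(1) by (simp add: abs_mult)
    also have "\<dots> \<le> (real N ^ 2 * \<psi> z ^ (N - 2)) * (B * indicator ?T z)"
      using bt[of z] pw[of z] N0 N \<psi> self_le_power[of "real N" 2]
      by (intro mult_mono) auto
    finally show ?thesis by (simp add: g_def B2_def mult_ac)
  qed
  have en\<zeta>: "AE z in lebesgue. energy_form a \<zeta> \<zeta> z \<le> g z * \<zeta> z"
    using AE_elliptic_at[OF adm] bx
  proof eventually_elim
    case (elim z)
    have "energy_form a \<zeta> \<zeta> z \<le> A z * (\<Sum>i\<in>UNIV. (dx i \<zeta> z)\<^sup>2)" by (rule energy_form_le[OF elim(1)])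
    also have "(\<Sum>i\<in>UNIV. (dx i \<zeta> z)\<^sup>2) = (real N * \<psi> z ^ (N - 1))\<^sup>2 * (\<Sum>i\<in>UNIV. (dx i \<psi> z)\<^sup>2)"
      unfolding dx_def D\<zeta> by (simp add: power_mult_distrib sum_distrib_left)
    also have "A z * ((real N * \<psi> z ^ (N - 1))\<^sup>2 * (\<Sum>i\<in>UNIV. (dx i \<psi> z)\<^sup>2))
        = (real N * \<psi> z ^ (N - 1))\<^sup>2 * (A z * (\<Sum>i\<in>UNIV. (dx i \<psi> z)\<^sup>2))" by (simp add: mult_ac)
    also have "\<dots> \<le> (real N * \<psi> z ^ (N - 1))\<^sup>2 * (B * indicator ?T z)"
      using elim(2) by (intro mult_left_mono) auto
    also have "(real N * \<psi> z ^ (N - 1))\<^sup>2 = real N ^ 2 * (\<psi> z ^ (N - 2) * \<psi> z ^ N)"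
    proof -
      have "(N - 1) * 2 = (N - 2) + N" using N by simp
      then show ?thesis by (simp add: power_mult_distrib power_mult[symmetric] power_add[symmetric])
    qed
    finally show ?case by (simp add: g_def B2_def \<zeta>_def[of z] mult_ac)
  qed
  have "(\<integral>z. \<bar>u z\<bar> powr q * \<zeta> z \<partial>lebesgue_on \<Omega>)
    \<le> (C + 2) * (2 powr p * (\<integral>z. g z * (\<epsilon> * (1 + \<bar>u z / \<epsilon>\<bar> powr p)) \<partial>lebesgue_on \<Omega>))"
    by (rule weak_solution_estimate[OF pq adm sol u0 dom test sup\<Omega> \<zeta>1 g AE_I2[OF dt\<zeta>] en\<zeta> \<epsilon> C prof])
  also have "(\<lambda>z. g z * (\<epsilon> * (1 + \<bar>u z / \<epsilon>\<bar> powr p)))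
      = (\<lambda>z. B2 * (indicator ?T z * (\<psi> z ^ (N - 2) * (\<epsilon> * (1 + \<bar>u z / \<epsilon>\<bar> powr p)))))"
    unfolding g_def by (simp only: mult.assoc)
  finally show ?thesis by (simp only: integral_mult_right_zero) (simp add: \<zeta>_def B2_def mult_ac)
qed

text \<open>
  The situation on one cylinder, freed from the differential inequality: \<open>\<rho>\<close> is the natural size of a
  solution there, \<open>Q\<close> the inner cylinder and \<open>T\<close> the shell. The two consequences below correspond to
  the choices \<open>\<epsilon> = \<rho>\<close> and \<open>\<epsilon> = b \<rho>\<close>.
\<close>

locale shell_inequality =
  fixes u \<psi> :: "'n::finite pt \<Rightarrow> real" and \<Omega> Q T :: "'n pt set" and p q K \<rho> V :: real and N :: nat
  assumes pq: "1 < p" "p < q" and K: "K > 0" and \<rho>: "\<rho> > 0"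
    and \<Omega>: "\<Omega> \<in> sets lebesgue" "\<Omega> \<in> lmeasurable"
    and QT: "Q \<in> sets lebesgue" "T \<in> sets lebesgue" "Q \<subseteq> \<Omega>" "T \<subseteq> \<Omega>" "Q \<inter> T = {}"
    and \<psi>m: "\<psi> \<in> borel_measurable lebesgue" and \<psi>: "\<And>z. 0 \<le> \<psi> z" "\<And>z. \<psi> z \<le> 1" "\<And>z. z \<in> Q \<Longrightarrow> \<psi> z = 1"
    and um: "u \<in> borel_measurable lebesgue"
    and ui: "integrable (lebesgue_on \<Omega>) (\<lambda>z. \<bar>u z\<bar> powr q)"
    and vol: "\<rho> powr q * measure lebesgue T \<le> V"
    and est: "\<And>\<epsilon>. \<epsilon> > 0 \<Longrightarrow> (\<integral>z. \<bar>u z\<bar> powr q * \<psi> z ^ N \<partial>lebesgue_on \<Omega>)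
       \<le> K * \<rho> powr (q - 1) * (\<integral>z. indicator T z *
            (\<psi> z ^ (N - 2) * (\<epsilon> * (1 + \<bar>u z / \<epsilon>\<bar> powr p))) \<partial>lebesgue_on \<Omega>)"
begin

abbreviation M :: "'n pt measure" where "M \<equiv> lebesgue_on \<Omega>"

definition U :: "'n pt \<Rightarrow> real" where "U z = \<bar>u z\<bar> powr q"

lemma U_nonneg: "0 \<le> U z"
  by (simp add: U_def)

lemma U_scaled:
  assumes "\<epsilon> > 0" shows "\<bar>u z / \<epsilon>\<bar> powr q = \<epsilon> powr (- q) * U z"
proof -
  have "\<bar>u z / \<epsilon>\<bar> = \<bar>u z\<bar> / \<epsilon>" using assms by simp
  then show ?thesis using assms by (simp add: powr_divide powr_minus_divide U_def)
qed

lemma integrable_mult_U: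
  assumes "f \<in> borel_measurable M" "\<And>z. 0 \<le> f z" "\<And>z. f z \<le> 1"
  shows "integrable M (\<lambda>z. f z * U z)"
proof (rule Bochner_Integration.integrable_bound)
  show U: "integrable M U" unfolding U_def[abs_def] by (rule ui)
  show "(\<lambda>z. f z * U z) \<in> borel_measurable M" using assms(1) U by measurable
  show "AE z in M. norm (f z * U z) \<le> norm (U z)"
    using assms(2,3) U_nonneg by (auto simp: abs_mult intro!: mult_left_le_one_le)
qed

lemma indicator_measurable: "S \<in> sets lebesgue \<Longrightarrow> (indicator S :: 'n pt \<Rightarrow> real) \<in> borel_measurable M"
  by (rule measurable_restrict_space1[OF borel_measurable_indicator])

lemma integrable_indicator_U: "S \<in> sets lebesgue \<Longrightarrow> integrable M (\<lambda>z. indicator S z * U z)"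
  by (rule integrable_mult_U[OF indicator_measurable]) (auto simp: indicator_def)

lemma integrable_cutoff_U: "integrable M (\<lambda>z. \<psi> z ^ N * U z)"
  using measurable_restrict_space1[OF \<psi>m] \<psi> by (intro integrable_mult_U) (auto intro: power_le_one)

lemma integrable_indicator_T: "integrable M (indicator T :: 'n pt \<Rightarrow> real)"
proof -
  interpret finite_measure M by (rule finite_measure_lebesgue_on[OF \<Omega>(2)])
  show ?thesis by (rule integrable_const_bound[of _ 1, OF _ indicator_measurable[OF QT(2)]]) (simp add: indicator_def)
qed

lemma indicator_outside: "z \<notin> \<Omega> \<Longrightarrow> S \<subseteq> \<Omega> \<Longrightarrow> indicator S z = (0::real)"
  by (auto simp: indicator_def)

lemma measure_M_T: "measure M (T \<inter> \<Omega>) = measure lebesgue T"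
  using measure_restrict_space[of \<Omega> lebesgue T] \<Omega>(1) QT(4) by (simp add: Int_absorb2)

lemma integral_indicator_U:
  "S \<subseteq> \<Omega> \<Longrightarrow> (\<integral>z. indicator S z * U z \<partial>lebesgue) = (\<integral>z. indicator S z * U z \<partial>M)"
  by (rule integral_eq_lebesgue_on[OF \<Omega>(1)]) (simp add: indicator_outside)

lemma core_integrable: "integrable lebesgue (\<lambda>z. indicator Q z * U z)"
proof -
  have "\<Omega> \<inter> space lebesgue \<in> sets lebesgue" using \<Omega>(1) by simp
  from integrable_restrict_space[OF this, of "\<lambda>z. indicator Q z * U z"] integrable_indicator_U[OF QT(1)]
  have "integrable lebesgue (\<lambda>z. indicator \<Omega> z *\<^sub>R (indicator Q z * U z))" by simp
  moreover have "indicator \<Omega> z *\<^sub>R (indicator Q z * U z) = indicator Q z * U z" for z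
    using QT(3) by (cases "z \<in> Q") auto
  ultimately show ?thesis by (simp only:)
qed

definition mass :: real where "mass = (\<integral>z. \<psi> z ^ N * U z \<partial>M)"

lemma core_le_mass: "(\<integral>z. indicator Q z * U z \<partial>lebesgue) \<le> mass"
  unfolding mass_def integral_indicator_U[OF QT(3)]
proof (rule integral_mono[OF integrable_indicator_U[OF QT(1)] integrable_cutoff_U])
  fix z show "indicator Q z * U z \<le> \<psi> z ^ N * U z"
    using \<psi>(1)[of z] \<psi>(3)[of z] U_nonneg[of z] by (cases "z \<in> Q") auto
qed

lemma mass_le:
  "\<epsilon> > 0 \<Longrightarrow> mass \<le> K * \<rho> powr (q - 1) * (\<integral>z. indicator T z * (\<psi> z ^ (N - 2) * (\<epsilon> * (1 + \<bar>u z / \<epsilon>\<bar> powr p))) \<partial>M)"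
  using est unfolding mass_def U_def by (simp add: mult.commute)

text \<open>
  With \<open>\<epsilon> = \<rho>\<close> the constant term becomes a multiple of \<open>\<rho>\<^sup>q |T|\<close>, while in the term with \<open>u\<close> all powers of
  \<open>\<rho>\<close> cancel, so that Young's inequality with parameter \<open>1 / (2 K)\<close> turns it into half of the left-hand
  side.
\<close>

lemma core_mass_bounded:
  assumes C1: "C1 > 0"
    "\<And>x y. 0 \<le> x \<Longrightarrow> 0 \<le> y \<and> y \<le> 1 \<Longrightarrow> x powr p * y ^ (N - 2) \<le> 1 / (2 * K) * (x powr q * y ^ N) + C1"
  shows "(\<integral>z. indicator Q z * U z \<partial>lebesgue) \<le> 2 * K * (1 + C1) * V"
proof -
  have "mass \<le> K * (1 + C1) * (\<rho> powr q * measure lebesgue T) + mass / 2"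
  proof -
    have "(\<integral>z. indicator T z * (\<psi> z ^ (N - 2) * (\<rho> * (1 + \<bar>u z / \<rho>\<bar> powr p))) \<partial>M)
      \<le> (\<integral>z. \<rho> * (1 + C1) * indicator T z + \<rho> * \<rho> powr (- q) / (2 * K) * (\<psi> z ^ N * U z) \<partial>M)"
    proof (rule integral_mono_AE'; (rule AE_I2)?)
      show "integrable M (\<lambda>z. \<rho> * (1 + C1) * indicator T z + \<rho> * \<rho> powr (- q) / (2 * K) * (\<psi> z ^ N * U z))"
        using integrable_indicator_T integrable_cutoff_U by simp
      fix z
      show nn: "0 \<le> \<rho> * (1 + C1) * indicator T z + \<rho> * \<rho> powr (- q) / (2 * K) * (\<psi> z ^ N * U z)"
        using \<rho> C1(1) K \<psi>(1)[of z] U_nonneg[of z] by (intro add_nonneg_nonneg mult_nonneg_nonneg) auto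
      show "indicator T z * (\<psi> z ^ (N - 2) * (\<rho> * (1 + \<bar>u z / \<rho>\<bar> powr p)))
          \<le> \<rho> * (1 + C1) * indicator T z + \<rho> * \<rho> powr (- q) / (2 * K) * (\<psi> z ^ N * U z)"
      proof (cases "z \<in> T")
        case False
        then show ?thesis using nn by simp
      next
        case True
        have 1: "\<psi> z ^ (N - 2) \<le> 1" using \<psi> by (intro power_le_one) auto
        have 2: "\<bar>u z / \<rho>\<bar> powr p * \<psi> z ^ (N - 2) \<le> 1 / (2 * K) * (\<rho> powr (- q) * U z * \<psi> z ^ N) + C1"
          using C1(2)[of "\<bar>u z / \<rho>\<bar>" "\<psi> z"] \<psi>[of z] unfolding U_scaled[OF \<rho>] by simp
        have "\<psi> z ^ (N - 2) * (\<rho> * (1 + \<bar>u z / \<rho>\<bar> powr p)) = \<rho> * (\<psi> z ^ (N - 2) + \<bar>u z / \<rho>\<bar> powr p * \<psi> z ^ (N - 2))"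
          by (simp add: algebra_simps)
        also have "\<dots> \<le> \<rho> * (1 + (1 / (2 * K) * (\<rho> powr (- q) * U z * \<psi> z ^ N) + C1))"
          using \<rho> 1 2 by (intro mult_left_mono add_mono) auto
        also have "\<dots> = \<rho> * (1 + C1) + \<rho> * \<rho> powr (- q) / (2 * K) * (\<psi> z ^ N * U z)"
          by (simp add: algebra_simps)
        finally show ?thesis using True by simp
      qed
    qed
    also have "\<dots> = \<rho> * (1 + C1) * measure lebesgue T + \<rho> * \<rho> powr (- q) / (2 * K) * mass"
      using integrable_indicator_T integrable_cutoff_U by (simp add: mass_def measure_M_T)
    finally have "K * \<rho> powr (q - 1) * (\<integral>z. indicator T z * (\<psi> z ^ (N - 2) * (\<rho> * (1 + \<bar>u z / \<rho>\<bar> powr p))) \<partial>M)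
       \<le> K * \<rho> powr (q - 1) * (\<rho> * (1 + C1) * measure lebesgue T + \<rho> * \<rho> powr (- q) / (2 * K) * mass)"
      using K by (intro mult_left_mono) auto
    also have "\<dots> = K * (1 + C1) * ((\<rho> powr (q - 1) * \<rho>) * measure lebesgue T) + (\<rho> powr (q - 1) * \<rho> * \<rho> powr (- q)) * mass / 2"
      using K by (simp add: algebra_simps)
    also have "\<rho> powr (q - 1) * \<rho> = \<rho> powr q" using \<rho> by (simp add: powr_diff)
    also have "\<rho> powr q * \<rho> powr (- q) = 1" using \<rho> by (simp add: powr_minus)
    finally show ?thesis using mass_le[OF \<rho>] by simp
  qed
  then have "mass \<le> 2 * (K * (1 + C1) * (\<rho> powr q * measure lebesgue T))" by simp
  also have "\<dots> \<le> 2 * (K * (1 + C1) * V)" using K C1(1) vol by (intro mult_left_mono) auto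
  finally show ?thesis using core_le_mass by (simp add: mult_ac)
qed

text \<open>
  With \<open>\<epsilon> = b \<rho>\<close> the constant term is proportional to \<open>b\<close>, at the price of a large factor in front of the
  mass in the shell, which is at most the mass outside \<open>Q\<close>.
\<close>

lemma core_mass_le_outer_mass:
  assumes c1: "c1 > 0" "\<And>x. 0 \<le> x \<Longrightarrow> x powr p \<le> 1 + c1 * x powr q" and b: "b > 0"
    and UL: "integrable lebesgue U"
  defines "F \<equiv> \<integral>z. indicator Q z * U z \<partial>lebesgue"
  shows "F \<le> 2 * K * b * V + K * c1 * b powr (1 - q) * ((\<integral>z. U z \<partial>lebesgue) - F)"
proof -
  define \<epsilon> where "\<epsilon> = b * \<rho>"
  have \<epsilon>: "\<epsilon> > 0" using b \<rho> by (simp add: \<epsilon>_def)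
  have "(\<integral>z. indicator T z * (\<psi> z ^ (N - 2) * (\<epsilon> * (1 + \<bar>u z / \<epsilon>\<bar> powr p))) \<partial>M)
    \<le> (\<integral>z. 2 * \<epsilon> * indicator T z + \<epsilon> * c1 * \<epsilon> powr (- q) * (indicator T z * U z) \<partial>M)"
  proof (rule integral_mono_AE'; (rule AE_I2)?)
    show "integrable M (\<lambda>z. 2 * \<epsilon> * indicator T z + \<epsilon> * c1 * \<epsilon> powr (- q) * (indicator T z * U z))"
      using integrable_indicator_T integrable_indicator_U[OF QT(2)] by simp
    fix z
    show nn: "0 \<le> 2 * \<epsilon> * indicator T z + \<epsilon> * c1 * \<epsilon> powr (- q) * (indicator T z * U z)"
      using \<epsilon> c1(1) U_nonneg[of z] by (intro add_nonneg_nonneg mult_nonneg_nonneg) auto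
    show "indicator T z * (\<psi> z ^ (N - 2) * (\<epsilon> * (1 + \<bar>u z / \<epsilon>\<bar> powr p)))
        \<le> 2 * \<epsilon> * indicator T z + \<epsilon> * c1 * \<epsilon> powr (- q) * (indicator T z * U z)"
    proof (cases "z \<in> T")
      case False then show ?thesis using nn by simp
    next
      case True
      have 1: "\<psi> z ^ (N - 2) \<le> 1" using \<psi> by (intro power_le_one) auto
      have 2: "\<bar>u z / \<epsilon>\<bar> powr p \<le> 1 + c1 * (\<epsilon> powr (- q) * U z)"
        using c1(2)[of "\<bar>u z / \<epsilon>\<bar>"] unfolding U_scaled[OF \<epsilon>] by simp
      have "\<psi> z ^ (N - 2) * (\<epsilon> * (1 + \<bar>u z / \<epsilon>\<bar> powr p)) \<le> 1 * (\<epsilon> * (1 + (1 + c1 * (\<epsilon> powr (- q) * U z))))"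
        using \<epsilon> 1 2 \<psi>(1)[of z] by (intro mult_mono mult_left_mono add_left_mono) auto
      also have "\<dots> = 2 * \<epsilon> + \<epsilon> * c1 * \<epsilon> powr (- q) * U z" by (simp add: algebra_simps)
      finally show ?thesis using True by simp
    qed
  qed
  also have "\<dots> = 2 * \<epsilon> * measure lebesgue T + \<epsilon> * c1 * \<epsilon> powr (- q) * (\<integral>z. indicator T z * U z \<partial>M)"
    using integrable_indicator_T integrable_indicator_U[OF QT(2)] by (simp add: measure_M_T)
  finally have "K * \<rho> powr (q - 1) * (\<integral>z. indicator T z * (\<psi> z ^ (N - 2) * (\<epsilon> * (1 + \<bar>u z / \<epsilon>\<bar> powr p))) \<partial>M)
     \<le> K * \<rho> powr (q - 1) * (2 * \<epsilon> * measure lebesgue T + \<epsilon> * c1 * \<epsilon> powr (- q) * (\<integral>z. indicator T z * U z \<partial>M))"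
    using K by (intro mult_left_mono) auto
  also have "\<dots> = 2 * K * b * ((\<rho> powr (q - 1) * \<rho>) * measure lebesgue T)
      + K * c1 * (\<rho> powr (q - 1) * (\<epsilon> * \<epsilon> powr (- q))) * (\<integral>z. indicator T z * U z \<partial>M)"
    by (simp add: \<epsilon>_def algebra_simps)
  also have "\<rho> powr (q - 1) * \<rho> = \<rho> powr q" using \<rho> by (simp add: powr_diff)
  also have "\<rho> powr (q - 1) * (\<epsilon> * \<epsilon> powr (- q)) = b powr (1 - q)"
  proof -
    have "\<epsilon> * \<epsilon> powr (- q) = \<epsilon> powr (1 - q)" using \<epsilon> by (simp add: powr_diff powr_minus_divide)
    also have "\<dots> = b powr (1 - q) * \<rho> powr (1 - q)" using b \<rho> by (simp add: \<epsilon>_def powr_mult)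
    finally have "\<rho> powr (q - 1) * (\<epsilon> * \<epsilon> powr (- q)) = b powr (1 - q) * (\<rho> powr (q - 1) * \<rho> powr (1 - q))"
      by (simp add: mult_ac)
    also have "\<rho> powr (q - 1) * \<rho> powr (1 - q) = 1" using \<rho> by (simp add: powr_add[symmetric])
    finally show ?thesis by simp
  qed
  finally have "F \<le> 2 * K * b * (\<rho> powr q * measure lebesgue T) + K * c1 * b powr (1 - q) * (\<integral>z. indicator T z * U z \<partial>M)"
    using mass_le[OF \<epsilon>] core_le_mass unfolding F_def by linarith
  also have "\<dots> \<le> 2 * K * b * V + K * c1 * b powr (1 - q) * ((\<integral>z. U z \<partial>lebesgue) - F)"
  proof (intro add_mono mult_left_mono vol)
    have "(\<integral>z. indicator T z * U z \<partial>M) = (\<integral>z. indicator T z * U z \<partial>lebesgue)"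
      by (rule integral_indicator_U[OF QT(4), symmetric])
    also have "\<dots> \<le> (\<integral>z. U z - indicator (Q) z * U z \<partial>lebesgue)"
    proof (rule integral_mono_AE'; (rule AE_I2)?)
      show "integrable lebesgue (\<lambda>z. U z - indicator (Q) z * U z)" using UL core_integrable by simp
      show "indicator T z * U z \<le> U z - indicator (Q) z * U z" "0 \<le> U z - indicator (Q) z * U z" for z
        using U_nonneg[of z] QT(5) by (auto simp: indicator_def)
    qed
    also have "\<dots> = (\<integral>z. U z \<partial>lebesgue) - F" using UL core_integrable by (simp add: F_def)
    finally show "(\<integral>z. indicator T z * U z \<partial>M) \<le> (\<integral>z. U z \<partial>lebesgue) - F" .
  qed (use K b c1 in auto)
  finally show ?thesis .
qed

end

section \<open>Letting the cylinders grow\<close>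

text \<open>
  This is the only place where \<open>q \<le> 1 + \<alpha> / n\<close> enters. It says that the exponent
  \<open>\<alpha> + n - \<alpha> q / (q - 1)\<close> is not positive.
\<close>

lemma critical_scaling:
  fixes R \<alpha> q :: real
  assumes R: "R > 1" and q: "1 < q" "q \<le> 1 + \<alpha> / real CARD('n::finite)"
  shows "(R powr (- \<alpha> / (q - 1))) powr q * (R powr \<alpha> * R ^ CARD('n)) \<le> 1"
proof -
  define n where "n = real CARD('n)"
  have n: "n > 0" by (simp add: n_def)
  have "(q - 1) * n \<le> \<alpha>" using q(2) n by (simp add: n_def[symmetric] field_simps)
  then have nq: "n \<le> \<alpha> / (q - 1)" using q(1) by (simp add: field_simps)
  have "- \<alpha> / (q - 1) * q = - \<alpha> - \<alpha> / (q - 1)" using q(1) by (simp add: field_simps)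
  then have ex: "- \<alpha> / (q - 1) * q + (\<alpha> + n) \<le> 0" using nq by linarith
  have "(R powr (- \<alpha> / (q - 1))) powr q * (R powr \<alpha> * R ^ CARD('n)) = R powr (- \<alpha> / (q - 1) * q + (\<alpha> + n))"
    unfolding powr_powr powr_add n_def using R by (simp add: powr_realpow)
  also have "\<dots> \<le> R powr 0" using ex R by (intro powr_mono) auto
  finally show ?thesis using R by simp
qed

theorem theorem3:
  fixes a :: "'n::finite \<Rightarrow> 'n \<Rightarrow> real \<times> (real ^ 'n) \<Rightarrow> real"
    and A u :: "real \<times> (real ^ 'n) \<Rightarrow> real"
    and \<alpha> q c :: real
  assumes "\<alpha> > 0"
    and "1 < q" and "q \<le> 1 + \<alpha> / real CARD('n)"
    and "admissible_operator a A"
    and "c > 0"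
    and "\<And>R. R > 1 \<Longrightarrow> annular_esssup A R \<le> ereal (c * R powr (2 - \<alpha>))"
    and "weak_solution a q u"
    and "AE p in lebesgue. u p \<ge> 0"
  shows "AE p in lebesgue. u p = 0"
proof -
  \<comment> \<open>the midpoint of the admissible interval \<open>1 < p < min q 2\<close>\<close>
  define p where "p = (1 + min q 2) / 2"
  have p: "1 < p" "p < 2" "p < q" "0 < p" using assms(2) by (auto simp: p_def min_def)
  obtain N :: nat where N: "N \<ge> 3" "real N * p / q \<le> real N - 2" using ex_exponent[OF p(4,3)] by blast
  have A0: "0 \<le> A z" for z using assms(4) unfolding admissible_operator_def by blast
  obtain K0 where K0: "K0 > 0"
    and cut: "\<And>R. R > 1 \<Longrightarrow> \<exists>\<psi> :: 'n pt \<Rightarrow> real. cylinder_cutoff A (K0 * R powr - \<alpha>) (R powr \<alpha>) R \<psi>"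
    using ex_cylinder_cutoff[of A, OF A0 assms(5,6)] by blast
  obtain C where C: "C > 0"
    and prof: "\<And>\<epsilon>. \<epsilon> > 0 \<Longrightarrow> \<exists>H h h'. concave_profile (\<lambda>s. C * (\<epsilon> * (1 + \<bar>s / \<epsilon>\<bar> powr p))) (2 / \<epsilon>) H h h'"
    using ex_scaled_concave_profile[OF p(1,2)] by blast
  define K where "K = (C + 2) * (2 powr p * (real N ^ 2 * K0))"
  have K: "K > 0" using C K0 N(1) by (auto simp: K_def intro!: mult_pos_pos add_pos_pos)
  let ?core = "\<lambda>R. cylinder (R powr \<alpha> / 2) (R / 2) :: 'n pt set"
  define V where "V = 2 * (2::real) ^ CARD('n)"
  have V0: "V > 0" by (simp add: V_def)
  have um: "u \<in> borel_measurable lebesgue" using assms(7) by (simp add: weak_solution_def)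
  define U where "U z = \<bar>u z\<bar> powr q" for z
  have U0: "0 \<le> U z" for z by (simp add: U_def)
  have Um: "U \<in> borel_measurable lebesgue" unfolding U_def[abs_def] using um by measurable
  define F where "F R = (\<integral>z. indicator (?core R) z * U z \<partial>lebesgue)" for R
  have "0 < 1 / (2 * K)" using K by simp
  from powr_cutoff_absorb[OF p(4,3) this N(2,1)]
  obtain C1 where C1: "C1 > 0"
    "\<And>x y. 0 \<le> x \<Longrightarrow> 0 \<le> y \<and> y \<le> 1 \<Longrightarrow> x powr p * y ^ (N - 2) \<le> 1 / (2 * K) * (x powr q * y ^ N) + C1"
    by blast
  obtain c1 where c1: "c1 > 0" "\<And>x. 0 \<le> x \<Longrightarrow> x powr p \<le> 1 + c1 * x powr q"
    using powr_le_const_add[OF p(4,3), of 1] by auto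
  have steps: "integrable lebesgue (\<lambda>z. indicator (?core R) z * U z) \<and> F R \<le> 2 * K * (1 + C1) * V \<and>
     (integrable lebesgue U \<longrightarrow> (\<forall>b>0. F R \<le> 2 * K * b * V + K * c1 * b powr (1 - q) * ((\<integral>z. U z \<partial>lebesgue) - F R)))"
    if R: "R > 1" for R
  proof -
    obtain \<psi> :: "'n pt \<Rightarrow> real" where \<psi>: "cylinder_cutoff A (K0 * R powr - \<alpha>) (R powr \<alpha>) R \<psi>"
      using cut[OF R] by blast
    define \<rho> where "\<rho> = R powr (- \<alpha> / (q - 1))"
    have \<rho>: "\<rho> > 0" using R by (simp add: \<rho>_def)
    have r\<rho>: "R powr - \<alpha> = \<rho> powr (q - 1)" using assms(2) by (simp add: \<rho>_def powr_powr)
    \<comment> \<open>any bounded domain that contains the cylinder will do\<close>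
    define \<Omega> where "\<Omega> = ball (0 :: 'n pt) (R powr \<alpha> + R + 1)"
    have rad: "0 < R powr \<alpha> + R + 1" using R by (intro add_pos_pos) auto
    have dom: "bounded_domain \<Omega>" unfolding bounded_domain_def \<Omega>_def
      using rad by (auto simp: convex_connected)
    note \<Omega> = bounded_domain_lmeasurable[OF dom]
    have cyl: "cylinder (R powr \<alpha>) R \<subseteq> \<Omega>"
    proof
      fix z :: "'n pt" assume "z \<in> cylinder (R powr \<alpha>) R"
      then have "norm (fst z) + norm (snd z) \<le> R powr \<alpha> + R" by (auto simp: cylinder_def)
      moreover have "norm z \<le> norm (fst z) + norm (snd z)" using norm_Pair_le[of "fst z" "snd z"] by simp
      ultimately show "z \<in> \<Omega>" by (simp add: \<Omega>_def)
    qed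
    have vol: "\<rho> powr q * measure lebesgue (shell (R powr \<alpha>) R :: 'n pt set) \<le> V"
    proof -
      have lm: "(cylinder (R powr \<alpha>) R :: 'n pt set) \<in> lmeasurable"
      proof (rule bounded_set_imp_lmeasurable)
        have "bounded \<Omega>" using dom by (simp add: bounded_domain_def)
        then show "bounded (cylinder (R powr \<alpha>) R :: 'n pt set)" using cyl by (rule bounded_subset)
      qed (rule cylinder_sets)
      have "measure lebesgue (shell (R powr \<alpha>) R :: 'n pt set) \<le> measure lebesgue (cylinder (R powr \<alpha>) R :: 'n pt set)"
        by (rule measure_mono_fmeasurable[OF _ shell_sets lm]) (auto simp: shell_def)
      also have "\<dots> \<le> 2 * R powr \<alpha> * (2 * R) ^ CARD('n)" using R by (intro measure_cylinder_le) auto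
      also have "\<dots> = V * (R powr \<alpha> * R ^ CARD('n))" by (simp add: V_def power_mult_distrib mult_ac)
      finally have "\<rho> powr q * measure lebesgue (shell (R powr \<alpha>) R :: 'n pt set) \<le> \<rho> powr q * (V * (R powr \<alpha> * R ^ CARD('n)))"
        by (intro mult_left_mono) auto
      also have "\<dots> = V * (\<rho> powr q * (R powr \<alpha> * R ^ CARD('n)))" by (simp add: mult_ac)
      also have "\<dots> \<le> V * 1"
        unfolding \<rho>_def using critical_scaling[OF R assms(2,3)] V0 by (intro mult_left_mono) auto
      finally show ?thesis by simp
    qed
    have est: "(\<integral>z. \<bar>u z\<bar> powr q * \<psi> z ^ N \<partial>lebesgue_on \<Omega>)
       \<le> K * \<rho> powr (q - 1) * (\<integral>z. indicator (shell (R powr \<alpha>) R) z *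
            (\<psi> z ^ (N - 2) * (\<epsilon> * (1 + \<bar>u z / \<epsilon>\<bar> powr p))) \<partial>lebesgue_on \<Omega>)" if \<epsilon>: "\<epsilon> > 0" for \<epsilon>
    proof -
      obtain H h h' where "concave_profile (\<lambda>s. C * (\<epsilon> * (1 + \<bar>s / \<epsilon>\<bar> powr p))) (2 / \<epsilon>) H h h'"
        using prof[OF \<epsilon>] by blast
      from weak_solution_cutoff_estimate[OF p(1,3) N(1) assms(4,7,8) \<psi> _ dom cyl \<epsilon> C this]
      show ?thesis using K0 by (simp add: K_def r\<rho> mult_ac)
    qed
    have \<psi>m: "\<psi> \<in> borel_measurable lebesgue"
      using \<psi> smooth_on_measurable(1)[of UNIV \<psi>] by (simp add: cylinder_cutoff_def)
    have "R powr \<alpha> \<ge> 0" by simp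
    then have sub: "?core R \<subseteq> cylinder (R powr \<alpha>) R" using R by (auto simp: cylinder_def)
    interpret S: shell_inequality u \<psi> \<Omega> "?core R" "shell (R powr \<alpha>) R" p q K \<rho> V N
    proof
      show "0 \<le> \<psi> z" "\<psi> z \<le> 1" for z using \<psi> unfolding cylinder_cutoff_def by blast+
      show "\<psi> z = 1" if "z \<in> ?core R" for z using \<psi> that unfolding cylinder_cutoff_def by blast
      show "integrable (lebesgue_on \<Omega>) (\<lambda>z. \<bar>u z\<bar> powr q)" by (rule weak_solution_integrable[OF assms(7,2) dom])
      show "shell (R powr \<alpha>) R \<subseteq> \<Omega>" "?core R \<subseteq> \<Omega>" using cyl sub by (auto simp: shell_def)
      show "?core R \<inter> shell (R powr \<alpha>) R = {}" by (auto simp: shell_def)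
    qed (rule p K \<rho> \<Omega> cylinder_sets shell_sets \<psi>m um vol est; assumption?)+
    have SU: "S.U = U" by (rule ext) (simp add: S.U_def U_def)
    show ?thesis
      using S.core_integrable S.core_mass_bounded[OF C1] S.core_mass_le_outer_mass[OF c1]
      unfolding SU F_def by blast
  qed
  \<comment> \<open>The inner cylinders that belong to the scales \<open>r i\<close> exhaust the space.\<close>
  define r where "r i = real i + 2" for i :: nat
  have r1: "r i > 1" for i by (simp add: r_def)
  have mono: "?core (r i) \<subseteq> ?core (r j)" if "i \<le> j" for i j
  proof -
    have "r i powr \<alpha> \<le> r j powr \<alpha>" using that assms(1) by (intro powr_mono2) (auto simp: r_def)
    moreover have "r i \<le> r j" using that by (simp add: r_def)
    ultimately show ?thesis by (auto simp: cylinder_def)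
  qed
  have ex: "\<exists>i. z \<in> ?core (r i)" for z
  proof -
    obtain i :: nat where i: "max (2 * norm (snd z)) ((2 * \<bar>fst z\<bar>) powr (1 / \<alpha>)) \<le> real i" using real_arch_simple by blast
    have "2 * \<bar>fst z\<bar> = ((2 * \<bar>fst z\<bar>) powr (1 / \<alpha>)) powr \<alpha>" using assms(1) by (simp add: powr_powr)
    also have "\<dots> \<le> r i powr \<alpha>" using i assms(1) by (intro powr_mono2) (auto simp: r_def)
    finally show ?thesis using i by (intro exI[of _ i]) (auto simp: cylinder_def r_def)
  qed
  have FU_mono: "mono (\<lambda>i. indicator (?core (r i)) z * U z)" for z
    using mono U0[of z] by (intro monoI mult_right_mono) (auto simp: indicator_def)
  have FU_lim: "(\<lambda>i. indicator (?core (r i)) z * U z) \<longlonglongrightarrow> U z" for z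
  proof -
    obtain i where i: "z \<in> ?core (r i)" using ex by blast
    have "\<forall>\<^sub>F j in sequentially. indicator (?core (r j)) z * U z = U z"
      unfolding eventually_sequentially
    proof (intro exI[of _ i] allI impI)
      fix j assume "j \<ge> i"
      then have "z \<in> ?core (r j)" using mono i by blast
      then show "indicator (?core (r j)) z * U z = U z" by simp
    qed
    then show ?thesis by (rule tendsto_eventually)
  qed
  have "incseq (\<lambda>i. F (r i))" unfolding F_def
    by (intro monoI integral_mono steps[THEN conjunct1] r1) (use FU_mono in \<open>auto simp: mono_def\<close>)
  then obtain J where J: "(\<lambda>i. F (r i)) \<longlonglongrightarrow> J"
    using incseq_convergent[of "\<lambda>i. F (r i)"] steps r1 by metis
  \<comment> \<open>By the uniform bound and monotone convergence \<open>u\<^sup>q\<close> is integrable.\<close>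
  have J': "(\<lambda>i. \<integral>z. indicator (?core (r i)) z * U z \<partial>lebesgue) \<longlonglongrightarrow> J" using J unfolding F_def .
  have UL: "integrable lebesgue U" and UJ: "(\<integral>z. U z \<partial>lebesgue) = J"
    using integrable_monotone_convergence[OF steps[THEN conjunct1, OF r1] AE_I2[OF FU_mono] AE_I2[OF FU_lim] J' Um]
      integral_monotone_convergence[OF steps[THEN conjunct1, OF r1] AE_I2[OF FU_mono] AE_I2[OF FU_lim] J' Um] by auto
  \<comment> \<open>Now the mass outside the inner cylinders tends to \<open>0\<close>.\<close>
  have Jb: "J \<le> 2 * K * b * V" if b: "b > 0" for b
  proof -
    have "(\<lambda>i. 2 * K * b * V + K * c1 * b powr (1 - q) * (J - F (r i))) \<longlonglongrightarrow> 2 * K * b * V + K * c1 * b powr (1 - q) * (J - J)"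
      by (intro tendsto_intros J)
    moreover have "F (r i) \<le> 2 * K * b * V + K * c1 * b powr (1 - q) * (J - F (r i))" for i
      using steps[OF r1[of i]] UL b unfolding UJ by blast
    ultimately have "J \<le> 2 * K * b * V + K * c1 * b powr (1 - q) * (J - J)"
      using J by (intro LIMSEQ_le) auto
    then show ?thesis by simp
  qed
  have "J \<le> 0"
  proof (rule field_le_epsilon)
    fix e :: real assume "e > 0"
    then show "J \<le> 0 + e" using Jb[of "e / (2 * K * V)"] K V0 by simp
  qed
  moreover have "0 \<le> J" unfolding UJ[symmetric] by (rule Bochner_Integration.integral_nonneg) (rule U0)
  ultimately have "(\<integral>z. U z \<partial>lebesgue) = 0" using UJ by simp
  then have "AE z in lebesgue. U z = 0"
    using integral_nonneg_eq_0_iff_AE[OF UL] U0 by simp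
  then show ?thesis by eventually_elim (simp add: U_def)
qed

end
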